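(* Let $\Omega\subset\mathbb{R}^n$ be a domain, $T>0$, $I=(0,T)$, $V=H^1(\Omega)$, $H=L^2(\Omega)$. Let $f\in L^1(I;L^2(\Omega))+L^2(I;V^* )$ be given with $f\ge 0$ in the sense that $\langle f,v\rangle\ge 0$ for all $v\in L^2(I;V)\cap C(\bar I;H)$ with $v\ge 0$. Let $u_0\in H$ be given with $u_0\ge 0$. Let $u\in W=\{u\in L^2(I;V):\ \partial_t u\in L^2(I;V^* )\}$ be a weak solution of the parabolic equation $$\partial_t u-\Delta u=f\ \text{ on } I\times\Omega,\qquad \partial_n u=0\ \text{ on } I\times\partial\Omega,\qquad u(0)=u_0.$$ Then $u\ge 0$ (almost everywhere on $I\times\Omega$).
   Context: All functions are real-valued. $V\subset H=H^*\subset V^*$ is the evolution (Gelfand) triple in which $h\in H$ is identified with the functional $v\mapsto(h,v)_H$ on $V$; $\langle\cdot,\cdot\rangle_{V^*,V}$ is the duality pairing. $L^p(I;X)$ are Bochner spaces and $\partial_t$ is the weak derivative with respect to $t\in I$. Elements of $W$ are identified with their representatives in $C(\bar I;H)$. For $f=f_1+f_2$ with $f_1\in L^1(I;L^2(\Omega))$, $f_2\in L^2(I;V^* )$, and $v\in L^2(I;V)\cap C(\bar I;H)$, the pairing is $\langle f,v\rangle=\int_I (f_1(t),v(t))_H\,dt+\int_I\langle f_2(t),v(t)\rangle_{V^*,V}\,dt$. A function $u\in W$ is a weak solution of the parabolic equation $\partial_t u-\Delta u=f$ on $I\times\Omega$, $\partial_n u=0$ on $I\times\partial\Omega$, $u(0)=u_0$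 (with homogeneous Neumann boundary conditions) if $u(0)=u_0$ and, for all $v\in V$ and almost all $t\in I$, $$\langle\partial_t u(t),v\rangle_{V^*,V}+\int_\Omega\nabla u(x,t)\cdot\nabla v(x)\,dx=\langle f(t),v\rangle_{V^*,V}.$$ Inequalities between functions are understood almost everywhere. *)

theory Defs
  imports "HOL-Analysis.Analysis"
begin

text \<open>
  Elements of \<open>L\<^sup>2(\<Omega>)\<close>, \<open>H\<^sup>1(\<Omega>)\<close> and of the Bochner spaces are represented by functions, and the
  norms below are seminorms on these representatives: equality in the respective space is equality
  almost everywhere. Spaces depending on the set \<open>\<Omega>\<close> cannot be types, so the Bochner spaces are
  developed for a set \<open>X\<close> of real-valued functions (closed under the pointwise vector space
  operations) with a seminorm \<open>N\<close> on it.
\<close>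

section \<open>Sobolev space\<close>

primrec Ck :: "nat \<Rightarrow> ('a::euclidean_space \<Rightarrow> real) \<Rightarrow> bool" where
  "Ck 0 \<phi> \<longleftrightarrow> continuous_on UNIV \<phi>"
| "Ck (Suc k) \<phi> \<longleftrightarrow> (\<forall>x. \<phi> differentiable (at x)) \<and>
     (\<forall>b\<in>Basis. Ck k (\<lambda>x. frechet_derivative \<phi> (at x) b))"

text \<open>\<open>C\<^sub>c\<^sup>\<infinity>(\<Omega>)\<close>, its elements being extended by zero to the whole space.\<close>

definition test_functions :: "'a::euclidean_space set \<Rightarrow> ('a \<Rightarrow> real) set" where
  "test_functions \<Omega> = {\<phi>. (\<forall>k. Ck k \<phi>) \<and>
     compact (closure {x. \<phi> x \<noteq> 0}) \<and> closure {x. \<phi> x \<noteq> 0} \<subseteq> \<Omega>}"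

definition L2 :: "'a::euclidean_space set \<Rightarrow> ('a \<Rightarrow> real) set" where
  "L2 \<Omega> = {h \<in> borel_measurable (lebesgue_on \<Omega>). integrable (lebesgue_on \<Omega>) (\<lambda>x. (h x)\<^sup>2)}"

definition L2_inner :: "'a::euclidean_space set \<Rightarrow> ('a \<Rightarrow> real) \<Rightarrow> ('a \<Rightarrow> real) \<Rightarrow> real" where
  "L2_inner \<Omega> g h = (LINT x|lebesgue_on \<Omega>. g x * h x)"

definition L2_norm :: "'a::euclidean_space set \<Rightarrow> ('a \<Rightarrow> real) \<Rightarrow> real" where
  "L2_norm \<Omega> h = sqrt (L2_inner \<Omega> h h)"

definition has_weak_grad ::
    "'a::euclidean_space set \<Rightarrow> ('a \<Rightarrow> real) \<Rightarrow> ('a \<Rightarrow> 'a) \<Rightarrow> bool" where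
  "has_weak_grad \<Omega> h g \<longleftrightarrow>
     (\<forall>b\<in>Basis. (\<lambda>x. g x \<bullet> b) \<in> L2 \<Omega> \<and>
       (\<forall>\<phi>\<in>test_functions \<Omega>.
          (LINT x|lebesgue_on \<Omega>. h x * frechet_derivative \<phi> (at x) b)
            = - (LINT x|lebesgue_on \<Omega>. (g x \<bullet> b) * \<phi> x)))"

text \<open>Determined only up to null sets (when \<open>\<Omega>\<close> is open).\<close>

definition weak_grad :: "'a::euclidean_space set \<Rightarrow> ('a \<Rightarrow> real) \<Rightarrow> 'a \<Rightarrow> 'a" where
  "weak_grad \<Omega> h = (SOME g. has_weak_grad \<Omega> h g)"

definition H1 :: "'a::euclidean_space set \<Rightarrow> ('a \<Rightarrow> real) set" where
  "H1 \<Omega> = {h \<in> L2 \<Omega>. \<exists>g. has_weak_grad \<Omega> h g}"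

definition grad_inner :: "'a::euclidean_space set \<Rightarrow> ('a \<Rightarrow> real) \<Rightarrow> ('a \<Rightarrow> real) \<Rightarrow> real" where
  "grad_inner \<Omega> g h = (LINT x|lebesgue_on \<Omega>. weak_grad \<Omega> g x \<bullet> weak_grad \<Omega> h x)"

definition H1_norm :: "'a::euclidean_space set \<Rightarrow> ('a \<Rightarrow> real) \<Rightarrow> real" where
  "H1_norm \<Omega> h = sqrt (L2_inner \<Omega> h h + grad_inner \<Omega> h h)"

text \<open>
  The dual \<open>V\<^sup>*\<close> of \<open>V = H\<^sup>1(\<Omega>)\<close>. Values of a functional outside \<open>H1 \<Omega>\<close> are irrelevant;
  boundedness forces the functional to respect equality almost everywhere.
\<close>

definition H1_dual :: "'a::euclidean_space set \<Rightarrow> (('a \<Rightarrow> real) \<Rightarrow> real) set" where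
  "H1_dual \<Omega> = {F.
     (\<forall>v\<in>H1 \<Omega>. \<forall>w\<in>H1 \<Omega>. F (\<lambda>x. v x + w x) = F v + F w) \<and>
     (\<forall>c. \<forall>v\<in>H1 \<Omega>. F (\<lambda>x. c * v x) = c * F v) \<and>
     (\<exists>C. \<forall>v\<in>H1 \<Omega>. \<bar>F v\<bar> \<le> C * H1_norm \<Omega> v)}"

definition H1_dual_norm :: "'a::euclidean_space set \<Rightarrow> (('a \<Rightarrow> real) \<Rightarrow> real) \<Rightarrow> real" where
  "H1_dual_norm \<Omega> F = (SUP v\<in>{v \<in> H1 \<Omega>. H1_norm \<Omega> v \<le> 1}. \<bar>F v\<bar>)"

section \<open>Bochner spaces\<close>

definition simple_in :: "'t measure \<Rightarrow> ('x \<Rightarrow> real) set \<Rightarrow> ('t \<Rightarrow> 'x \<Rightarrow> real) \<Rightarrow> bool" where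
  "simple_in M X s \<longleftrightarrow> simple_function M s \<and> s ` space M \<subseteq> X"

definition strongly_measurable ::
    "'t measure \<Rightarrow> ('x \<Rightarrow> real) set \<Rightarrow> (('x \<Rightarrow> real) \<Rightarrow> real) \<Rightarrow> ('t \<Rightarrow> 'x \<Rightarrow> real) \<Rightarrow> bool" where
  "strongly_measurable M X N u \<longleftrightarrow>
     (\<exists>s. (\<forall>k. simple_in M X (s k)) \<and>
       (AE t in M. u t \<in> X \<and> (\<lambda>k::nat. N (\<lambda>x. u t x - s k t x)) \<longlonglongrightarrow> 0))"

definition Bochner_Lp ::
    "nat \<Rightarrow> 't measure \<Rightarrow> ('x \<Rightarrow> real) set \<Rightarrow> (('x \<Rightarrow> real) \<Rightarrow> real) \<Rightarrow> ('t \<Rightarrow> 'x \<Rightarrow> real) set" where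
  "Bochner_Lp p M X N = {u. strongly_measurable M X N u \<and> integrable M (\<lambda>t. N (u t) ^ p)}"

text \<open>
  The \<open>X\<close>-valued Bochner integral for a finite measure \<open>M\<close>, in analogy to
  \<^const>\<open>has_bochner_integral\<close>. For the simple functions \<open>s k\<close>, the pointwise integral is the finite
  sum defining their Bochner integral.
\<close>

definition has_integral_in ::
    "'t measure \<Rightarrow> ('x \<Rightarrow> real) set \<Rightarrow> (('x \<Rightarrow> real) \<Rightarrow> real) \<Rightarrow> ('t \<Rightarrow> 'x \<Rightarrow> real) \<Rightarrow>
      ('x \<Rightarrow> real) \<Rightarrow> bool" where
  "has_integral_in M X N u J \<longleftrightarrow>
     strongly_measurable M X N u \<and> J \<in> X \<and>
     (\<exists>s. (\<forall>k. simple_in M X (s k)) \<and>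
       (\<lambda>k::nat. \<integral>\<^sup>+t. ennreal (N (\<lambda>x. u t x - s k t x)) \<partial>M) \<longlonglongrightarrow> 0 \<and>
       (\<lambda>k. N (\<lambda>x. J x - (LINT t|M. s k t x))) \<longlonglongrightarrow> 0)"

definition L2_V :: "real \<Rightarrow> 'a::euclidean_space set \<Rightarrow> (real \<Rightarrow> 'a \<Rightarrow> real) set" where
  "L2_V T \<Omega> = Bochner_Lp 2 (lebesgue_on {0<..<T}) (H1 \<Omega>) (H1_norm \<Omega>)"

definition L1_H :: "real \<Rightarrow> 'a::euclidean_space set \<Rightarrow> (real \<Rightarrow> 'a \<Rightarrow> real) set" where
  "L1_H T \<Omega> = Bochner_Lp 1 (lebesgue_on {0<..<T}) (L2 \<Omega>) (L2_norm \<Omega>)"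

definition L2_V_dual ::
    "real \<Rightarrow> 'a::euclidean_space set \<Rightarrow> (real \<Rightarrow> ('a \<Rightarrow> real) \<Rightarrow> real) set" where
  "L2_V_dual T \<Omega> = Bochner_Lp 2 (lebesgue_on {0<..<T}) (H1_dual \<Omega>) (H1_dual_norm \<Omega>)"

definition C_H :: "real \<Rightarrow> 'a::euclidean_space set \<Rightarrow> (real \<Rightarrow> 'a \<Rightarrow> real) set" where
  "C_H T \<Omega> = {v. (\<forall>t\<in>{0..T}. v t \<in> L2 \<Omega>) \<and>
     (\<forall>s\<in>{0..T}. ((\<lambda>t. L2_norm \<Omega> (\<lambda>x. v t x - v s x)) \<longlongrightarrow> 0) (at s within {0..T}))}"

text \<open>
  \<open>u \<ge> 0\<close> almost everywhere on \<open>I \<times> \<Omega>\<close>. The function \<open>(t, x) \<mapsto> u t x\<close> need not be measurable, since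
  the representative of \<open>u t\<close> is arbitrary for each \<open>t\<close>; hence \<open>u\<close> is first replaced by a jointly
  measurable representative, as in the identification of \<open>L\<^sup>2(I; L\<^sup>2(\<Omega>))\<close> with \<open>L\<^sup>2(I \<times> \<Omega>)\<close>.
\<close>

definition nonneg_ae ::
    "real set \<Rightarrow> 'a::euclidean_space set \<Rightarrow> (real \<Rightarrow> 'a \<Rightarrow> real) \<Rightarrow> bool" where
  "nonneg_ae I \<Omega> u \<longleftrightarrow>
     (\<exists>U \<in> borel_measurable (lebesgue_on (I \<times> \<Omega>)).
        (AE t in lebesgue_on I. AE x in lebesgue_on \<Omega>. U (t, x) = u t x) \<and>
        (AE z in lebesgue_on (I \<times> \<Omega>). 0 \<le> U z))"

section \<open>The parabolic equation\<close>

text \<open>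
  The identity \<open>\<integral> \<phi>' u dt = - \<integral> \<phi> w dt\<close> of Bochner integrals in \<open>V\<^sup>*\<close>, where \<open>h \<in> H\<close> is
  identified with the functional \<open>L2_inner \<Omega> h\<close>.
\<close>

definition has_time_deriv ::
    "real \<Rightarrow> 'a::euclidean_space set \<Rightarrow> (real \<Rightarrow> 'a \<Rightarrow> real) \<Rightarrow> (real \<Rightarrow> ('a \<Rightarrow> real) \<Rightarrow> real) \<Rightarrow>
      bool" where
  "has_time_deriv T \<Omega> u w \<longleftrightarrow>
     (\<forall>\<phi>\<in>test_functions {0<..<T}. \<exists>J.
        has_integral_in (lebesgue_on {0<..<T}) (H1_dual \<Omega>) (H1_dual_norm \<Omega>)
          (\<lambda>t v. deriv \<phi> t * L2_inner \<Omega> (u t) v) J \<and>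
        has_integral_in (lebesgue_on {0<..<T}) (H1_dual \<Omega>) (H1_dual_norm \<Omega>)
          (\<lambda>t v. - (\<phi> t * w t v)) J)"

definition W :: "real \<Rightarrow> 'a::euclidean_space set \<Rightarrow> (real \<Rightarrow> 'a \<Rightarrow> real) set" where
  "W T \<Omega> = {u \<in> L2_V T \<Omega>. \<exists>w\<in>L2_V_dual T \<Omega>. has_time_deriv T \<Omega> u w}"

text \<open>Determined only for almost every \<open>t\<close>, as a functional on \<open>H1 \<Omega>\<close>.\<close>

definition time_deriv ::
    "real \<Rightarrow> 'a::euclidean_space set \<Rightarrow> (real \<Rightarrow> 'a \<Rightarrow> real) \<Rightarrow> real \<Rightarrow> ('a \<Rightarrow> real) \<Rightarrow> real" where
  "time_deriv T \<Omega> u = (SOME w. w \<in> L2_V_dual T \<Omega> \<and> has_time_deriv T \<Omega> u w)"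

text \<open>\<open>u(0) = u\<^sub>0\<close>, read for the representative of \<open>u\<close> in \<open>C([0, T]; H)\<close>.\<close>

definition has_initial_value ::
    "real \<Rightarrow> 'a::euclidean_space set \<Rightarrow> (real \<Rightarrow> 'a \<Rightarrow> real) \<Rightarrow> ('a \<Rightarrow> real) \<Rightarrow> bool" where
  "has_initial_value T \<Omega> u u0 \<longleftrightarrow>
     (\<exists>v\<in>C_H T \<Omega>.
        (AE t in lebesgue_on {0<..<T}. AE x in lebesgue_on \<Omega>. v t x = u t x) \<and>
        (AE x in lebesgue_on \<Omega>. v 0 x = u0 x))"

text \<open>The right-hand side is \<open>f = f1 + f2\<close> with \<open>f1 \<in> L\<^sup>1(I; L\<^sup>2(\<Omega>))\<close> and \<open>f2 \<in> L\<^sup>2(I; V\<^sup>*)\<close>.\<close>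

definition source_pairing ::
    "real \<Rightarrow> 'a::euclidean_space set \<Rightarrow> (real \<Rightarrow> 'a \<Rightarrow> real) \<Rightarrow> (real \<Rightarrow> ('a \<Rightarrow> real) \<Rightarrow> real) \<Rightarrow>
      (real \<Rightarrow> 'a \<Rightarrow> real) \<Rightarrow> real" where
  "source_pairing T \<Omega> f1 f2 v =
     (LINT t|lebesgue_on {0<..<T}. L2_inner \<Omega> (f1 t) (v t)) +
     (LINT t|lebesgue_on {0<..<T}. f2 t (v t))"

definition weak_solution ::
    "real \<Rightarrow> 'a::euclidean_space set \<Rightarrow> (real \<Rightarrow> 'a \<Rightarrow> real) \<Rightarrow> (real \<Rightarrow> ('a \<Rightarrow> real) \<Rightarrow> real) \<Rightarrow>
      ('a \<Rightarrow> real) \<Rightarrow> (real \<Rightarrow> 'a \<Rightarrow> real) \<Rightarrow> bool" where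
  "weak_solution T \<Omega> f1 f2 u0 u \<longleftrightarrow>
     u \<in> W T \<Omega> \<and> has_initial_value T \<Omega> u u0 \<and>
     (\<forall>v\<in>H1 \<Omega>. AE t in lebesgue_on {0<..<T}.
        time_deriv T \<Omega> u t v + grad_inner \<Omega> (u t) v = L2_inner \<Omega> (f1 t) v + f2 t v)"

end

theory Submission
  imports Defs
begin

text \<open>
  The negative part \<open>u\<^sup>-\<close> is controlled through \<open>\<Phi>(u) = \<parallel>u\<^sup>-\<parallel>\<^sup>2 / 2\<close>, which is convex with derivative
  \<open>- u\<^sup>-\<close>. Hence, for \<open>t < r\<close>,
  \<open>\<Phi>(u(r)) - \<Phi>(u(t)) \<le> - (u(r) - u(t), u\<^sup>-(r)) = - \<integral> \<langle>\<partial>\<^sub>t u(s), u\<^sup>-(r)\<rangle> ds \<le> \<integral> (\<nabla>u(s), \<nabla>u\<^sup>-(r)) ds\<close>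
  with integrals over \<open>(t, r)\<close>; as \<open>u\<^sup>-(r)\<close> does not depend on \<open>s\<close>, the sign of \<open>f\<close> is only needed for the
  test functions \<open>\<eta>(s) p(x)\<close>, and no chain rule in time is involved. Since \<open>(\<nabla>u(r), \<nabla>u\<^sup>-(r)) \<le> 0\<close>,
  the right-hand side is at most \<open>\<integral> \<parallel>u(s) - u(r)\<parallel>\<^sub>V \<parallel>u(r)\<parallel>\<^sub>V ds\<close>. Approximating \<open>u\<close> in \<open>L\<^sup>2(I; V)\<close> by functions
  continuous in time and averaging over all \<open>t\<close> with \<open>r = t + h\<close>, \<open>h \<rightarrow> 0\<close>, yields \<open>\<Phi>(u(t)) \<le> \<Phi>(u\<^sub>0) = 0\<close>.

  In space, \<open>u\<^sup>- \<in> H\<^sup>1\<close> and the formula for its gradient follow from the convergence in \<open>L\<^sup>1\<close> of the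
  difference quotients of \<open>u\<close>.
\<close>

section \<open>Smooth cutoff functions\<close>

lemma Ck_SucI:
  assumes "\<And>x. (f has_derivative f' x) (at x)" "\<And>b. b \<in> Basis \<Longrightarrow> Ck k (\<lambda>x. f' x b)"
  shows "Ck (Suc k) f"
proof -
  have "frechet_derivative f (at x) = f' x" for x
    using frechet_derivative_at[OF assms(1)] by metis
  then show ?thesis
    using assms by (auto simp: differentiable_def)
qed

lemma Ck_Suc_derivative: "Ck (Suc k) f \<Longrightarrow> (f has_derivative frechet_derivative f (at x)) (at x)"
  by (simp add: frechet_derivative_works)

lemma Ck_SucD: "Ck (Suc k) f \<Longrightarrow> Ck k f"
proof (induction k arbitrary: f)
  case 0
  then show ?case
    by (auto intro!: continuous_at_imp_continuous_on differentiable_imp_continuous_within)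
qed auto

lemma Ck_const: "Ck k (\<lambda>x. c)"
proof (induction k arbitrary: c)
  case (Suc k)
  show ?case by (rule Ck_SucI[where f' = "\<lambda>_ _. 0"]) (auto intro: Suc)
qed (simp add: continuous_on_const)

lemma Ck_add: "Ck k f \<Longrightarrow> Ck k g \<Longrightarrow> Ck k (\<lambda>x. f x + g x)"
proof (induction k arbitrary: f g)
  case (Suc k)
  show ?case
    by (rule Ck_SucI[OF has_derivative_add[OF Ck_Suc_derivative[OF Suc.prems(1)]
            Ck_Suc_derivative[OF Suc.prems(2)]]])
      (use Suc in auto)
qed (simp add: continuous_on_add)

lemma Ck_mult: "Ck k f \<Longrightarrow> Ck k g \<Longrightarrow> Ck k (\<lambda>x. f x * g x)"
proof (induction k arbitrary: f g)
  case (Suc k)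
  have "Ck k f" "Ck k g"
    using Suc.prems Ck_SucD by blast+
  then show ?case
    by (intro Ck_SucI[OF has_derivative_mult[OF Ck_Suc_derivative[OF Suc.prems(1)]
            Ck_Suc_derivative[OF Suc.prems(2)]]] Ck_add)
      (use Suc in auto)
qed (simp add: continuous_on_mult)

lemma Ck_prod: "finite I \<Longrightarrow> (\<And>i. i \<in> I \<Longrightarrow> Ck k (f i)) \<Longrightarrow> Ck k (\<lambda>x. \<Prod>i\<in>I. f i x)"
  by (induction I rule: finite_induct) (auto intro: Ck_mult Ck_const)

lemma Ck_inner:
  fixes f :: "real \<Rightarrow> real" and a :: "'a::euclidean_space"
  shows "Ck k f \<Longrightarrow> Ck k (\<lambda>x. f (x \<bullet> a + c))"
proof (induction k arbitrary: f)
  case 0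
  then show ?case
    by (auto intro!: continuous_on_compose2[of UNIV f] continuous_intros)
next
  case (Suc k)
  note D = Ck_Suc_derivative[OF Suc.prems]
  have "((\<lambda>x. f (x \<bullet> a + c)) has_derivative
      (\<lambda>h. (h \<bullet> a) * frechet_derivative f (at (x \<bullet> a + c)) 1)) (at x)" for x
  proof -
    have "((\<lambda>x. f (x \<bullet> a + c)) has_derivative
      (\<lambda>h. frechet_derivative f (at (x \<bullet> a + c)) (h \<bullet> a))) (at x)"
      by (rule has_derivative_compose[OF _ D]) (auto intro!: derivative_eq_intros)
    moreover have "frechet_derivative f (at (x \<bullet> a + c)) y =
        y * frechet_derivative f (at (x \<bullet> a + c)) 1" for y
      using linear_cmul[OF has_derivative_linear[OF D], of _ y 1] by simp
    ultimately show ?thesis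
      by (elim has_derivative_eq_rhs) (rule ext)
  qed
  then show ?case
    by (rule Ck_SucI) (use Suc in \<open>auto intro!: Ck_mult Ck_const\<close>)
qed

lemma frechet_derivative_translate:
  assumes "f differentiable at (x + c)"
  shows "frechet_derivative (\<lambda>x. f (x + c)) (at x) = frechet_derivative f (at (x + c))"
proof -
  have "((\<lambda>x. f (x + c)) has_derivative frechet_derivative f (at (x + c))) (at x)"
    by (rule has_derivative_compose[of "\<lambda>x. x + c" "\<lambda>h. h"])
      (use assms in \<open>auto simp: frechet_derivative_works intro!: derivative_eq_intros\<close>)
  then show ?thesis
    using frechet_derivative_at by metis
qed

lemma Ck_translate: "Ck k f \<Longrightarrow> Ck k (\<lambda>x. f (x + c))"
proof (induction k arbitrary: f)
  case 0
  then show ?case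
    by (auto intro!: continuous_on_compose2[of UNIV f] continuous_intros)
next
  case (Suc k)
  have "((\<lambda>x. f (x + c)) has_derivative frechet_derivative f (at (x + c))) (at x)" for x
    by (rule has_derivative_compose[OF _ Ck_Suc_derivative[OF Suc.prems]])
      (auto intro!: derivative_eq_intros)
  then show ?case
    by (rule Ck_SucI) (use Suc in auto)
qed

text \<open>Equal to \<open>exp (- c / t) / t ^ m\<close> for \<open>t > 0\<close>; as \<open>c \<rightarrow> 0\<close>, the case \<open>m = 0\<close> tends to the
  indicator function of \<open>{0<..}\<close>, which avoids normalised smooth steps.\<close>

definition flat :: "real \<Rightarrow> nat \<Rightarrow> real \<Rightarrow> real" where
  "flat c m t = (if t > 0 then exp (- c / t) / t ^ m else 0)"

lemma power_le_fact_exp: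
  assumes "0 \<le> (x::real)"
  shows "x ^ n \<le> fact n * exp x"
proof -
  have "(\<Sum>k\<in>{n}. x ^ k /\<^sub>R fact k) \<le> (\<Sum>k. x ^ k /\<^sub>R fact k)"
    using assms summable_exp_generic[of x] by (intro sum_le_suminf) auto
  then show ?thesis
    by (simp add: exp_def field_simps)
qed

lemma flat_le_square:
  assumes "c > 0"
  shows "\<bar>flat c m t\<bar> \<le> fact (m + 2) / c ^ (m + 2) * t\<^sup>2"
proof (cases "t > 0")
  case True
  have "(c / t) ^ (m + 2) \<le> fact (m + 2) * exp (c / t)"
    using assms True by (intro power_le_fact_exp) simp
  then have "exp (- c / t) * (c / t) ^ (m + 2) \<le> exp (- c / t) * (fact (m + 2) * exp (c / t))"
    by (intro mult_left_mono) auto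
  also have "\<dots> = fact (m + 2)"
    by (simp add: exp_minus flip: mult.assoc)
  finally have "exp (- c / t) * (c / t) ^ (m + 2) \<le> fact (m + 2)" .
  then have "exp (- c / t) / t ^ m * (c ^ (m + 2) / t\<^sup>2) \<le> fact (m + 2)"
    by (simp add: power_divide power_add power2_eq_square ac_simps)
  then have "exp (- c / t) / t ^ m \<le> fact (m + 2) / (c ^ (m + 2) / t\<^sup>2)"
    using assms True by (subst pos_le_divide_eq) auto
  then show ?thesis
    using True by (simp add: flat_def)
qed (use assms in \<open>simp add: flat_def\<close>)

lemma flat_has_derivative:
  assumes "c > 0"
  shows "(flat c m has_real_derivative c * flat c (m + 2) t - m * flat c (m + 1) t) (at t)"
proof -
  consider "t > 0" | "t = 0" | "t < 0" by linarith
  then show ?thesis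
  proof cases
    case 1
    have "((\<lambda>t. exp (- c / t) / t ^ m) has_real_derivative
        c * flat c (m + 2) t - m * flat c (m + 1) t) (at t)"
      using 1
      by (auto intro!: derivative_eq_intros simp: flat_def power2_eq_square divide_simps)
        (cases m; auto simp: algebra_simps)+
    then show ?thesis
      by (rule has_field_derivative_transform_within_open[where S = "{0<..}"])
        (use 1 in \<open>auto simp: flat_def\<close>)
  next
    case 2
    define K where "K = fact (m + 2) / c ^ (m + 2)"
    have "((\<lambda>y. flat c m y / y) \<longlongrightarrow> 0) (at 0)"
    proof (rule Lim_null_comparison)
      show "\<forall>\<^sub>F y in at 0. norm (flat c m y / y) \<le> K * \<bar>y\<bar>"
        unfolding eventually_at_filter
      proof (rule always_eventually, intro allI impI)
        fix y :: real assume "y \<noteq> 0"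
        then have "K * \<bar>y\<bar> = K * y\<^sup>2 / \<bar>y\<bar>"
          by (auto simp: abs_if power2_eq_square)
        then show "norm (flat c m y / y) \<le> K * \<bar>y\<bar>"
          using divide_right_mono[OF flat_le_square[OF assms, of m y, folded K_def], of "\<bar>y\<bar>"]
          by (simp only: real_norm_def abs_divide abs_ge_zero simp_thms)
      qed
      show "((\<lambda>y. K * \<bar>y\<bar>) \<longlongrightarrow> 0) (at 0)"
        by (auto intro!: tendsto_eq_intros)
    qed
    then have "(flat c m has_real_derivative 0) (at 0)"
      by (simp add: has_field_derivative_iff flat_def[of c m 0])
    then show ?thesis
      using 2 by (simp add: flat_def)
  next
    case 3
    have "((\<lambda>t. 0) has_real_derivative c * flat c (m + 2) t - m * flat c (m + 1) t) (at t)"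
      using 3 by (auto simp: flat_def)
    then show ?thesis
      by (rule has_field_derivative_transform_within_open[where S = "{..<0}"])
        (use 3 in \<open>auto simp: flat_def\<close>)
  qed
qed

lemma Ck_flat: "c > 0 \<Longrightarrow> Ck k (flat c m)"
proof (induction k arbitrary: m)
  case 0
  then show ?case
    by (auto intro!: continuous_at_imp_continuous_on DERIV_isCont flat_has_derivative)
next
  case (Suc k)
  have "Ck k (\<lambda>t. c * flat c (m + 2) t + - m * flat c (m + 1) t)"
    by (intro Ck_add Ck_mult Ck_const Suc)
  then show ?case
    by (intro Ck_SucI[OF flat_has_derivative[OF \<open>c > 0\<close>, THEN has_field_derivative_imp_has_derivative]])
      auto
qed

lemma flat_bounds: "c > 0 \<Longrightarrow> 0 \<le> flat c 0 t \<and> flat c 0 t \<le> 1"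
  by (auto simp: flat_def)

lemma flat_tendsto: "(\<lambda>k. flat (1 / Suc k) 0 t) \<longlonglongrightarrow> indicator {0<..} t"
proof (cases "t > 0")
  case True
  have "(\<lambda>k. exp (- (1 / Suc k) / t)) \<longlonglongrightarrow> exp (- 0 / t)"
    using True by (intro tendsto_intros lim_1_over_n[THEN LIMSEQ_Suc]) auto
  then show ?thesis
    using True by (simp add: flat_def)
qed (simp add: flat_def)

definition box_cutoff :: "real \<Rightarrow> 'a::euclidean_space \<Rightarrow> 'a \<Rightarrow> 'a \<Rightarrow> real" where
  "box_cutoff c p q x = (\<Prod>b\<in>Basis. flat c 0 (x \<bullet> b - p \<bullet> b) * flat c 0 (q \<bullet> b - x \<bullet> b))"

lemma box_cutoff_nonzero: "c > 0 \<Longrightarrow> box_cutoff c p q x \<noteq> 0 \<longleftrightarrow> x \<in> box p q"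
  by (auto simp: box_cutoff_def flat_def mem_box)

lemma Ck_box_cutoff:
  assumes "c > 0"
  shows "Ck k (box_cutoff c p q)"
proof -
  have "Ck k (\<lambda>x. flat c 0 (x \<bullet> b + - (p \<bullet> b)) * flat c 0 (x \<bullet> - b + q \<bullet> b))" for b
    using assms by (intro Ck_mult Ck_inner Ck_flat)
  then have "Ck k (\<lambda>x. flat c 0 (x \<bullet> b - p \<bullet> b) * flat c 0 (q \<bullet> b - x \<bullet> b))" for b
    by simp
  then show ?thesis
    unfolding box_cutoff_def by (intro Ck_prod) auto
qed

lemma box_cutoff_bounds: "c > 0 \<Longrightarrow> 0 \<le> box_cutoff c p q x \<and> box_cutoff c p q x \<le> 1"
  unfolding box_cutoff_def
  by (auto intro!: prod_nonneg prod_le_1 mult_le_one simp: flat_bounds)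

lemma box_cutoff_tendsto: "(\<lambda>k. box_cutoff (1 / Suc k) p q x) \<longlonglongrightarrow> indicator (box p q) x"
proof -
  have "(\<lambda>k. box_cutoff (1 / Suc k) p q x) \<longlonglongrightarrow>
      (\<Prod>b\<in>Basis. indicator {0<..} (x \<bullet> b - p \<bullet> b) * indicator {0<..} (q \<bullet> b - x \<bullet> b))"
    unfolding box_cutoff_def by (intro tendsto_prod tendsto_mult flat_tendsto)
  also have "(\<Prod>b\<in>Basis. indicator {0<..} (x \<bullet> b - p \<bullet> b) * indicator {0<..} (q \<bullet> b - x \<bullet> b))
      = (indicator (box p q) x :: real)"
    by (auto simp: indicator_def mem_box intro!: prod.neutral)
  finally show ?thesis .
qed

lemma box_cutoff_test_function:
  assumes "c > 0" "cbox p q \<subseteq> V"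
  shows "box_cutoff c p q \<in> test_functions V"
proof -
  have "closure {x. box_cutoff c p q x \<noteq> 0} \<subseteq> cbox p q"
    using assms box_subset_cbox by (intro closure_minimal) (auto simp: box_cutoff_nonzero)
  moreover from this have "compact (closure {x. box_cutoff c p q x \<noteq> 0})"
    by (meson bounded_cbox bounded_subset closed_closure compact_eq_bounded_closed)
  ultimately show ?thesis
    using assms Ck_box_cutoff by (auto simp: test_functions_def)
qed

lemma test_function_continuous: "\<phi> \<in> test_functions V \<Longrightarrow> continuous_on UNIV \<phi>"
  unfolding test_functions_def using Ck.simps(1) by blast

lemma test_function_has_derivative:
  "\<phi> \<in> test_functions V \<Longrightarrow> (\<phi> has_derivative frechet_derivative \<phi> (at x)) (at x)"
  unfolding test_functions_def using Ck_Suc_derivative by blast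

lemma test_function_derivative_continuous:
  "\<phi> \<in> test_functions V \<Longrightarrow> b \<in> Basis \<Longrightarrow> continuous_on UNIV (\<lambda>x. frechet_derivative \<phi> (at x) b)"
  unfolding test_functions_def by (metis (mono_tags, lifting) Ck.simps mem_Collect_eq)

lemma test_function_eq_0:
  "x \<notin> closure {x. \<phi> x \<noteq> 0} \<Longrightarrow> \<phi> x = 0"
  using subsetD[OF closure_subset, of x "{x. \<phi> x \<noteq> 0}"] by auto

lemma test_function_derivative_eq_0:
  assumes "x \<notin> closure {x. \<phi> x \<noteq> 0}"
  shows "frechet_derivative \<phi> (at x) = (\<lambda>_. 0)"
proof -
  have "((\<lambda>_. 0) has_derivative (\<lambda>_. 0)) (at x)" by simp
  then have "(\<phi> has_derivative (\<lambda>_. 0)) (at x)"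
    by (rule has_derivative_transform_within_open[where s = "- closure {x. \<phi> x \<noteq> 0}"])
      (use assms test_function_eq_0 in auto)
  then show ?thesis
    using frechet_derivative_at by metis
qed

lemma test_functions_mono: "V \<subseteq> U \<Longrightarrow> test_functions V \<subseteq> test_functions U"
  by (auto simp: test_functions_def)

lemma continuous_compact_support_bounded:
  fixes f :: "'a::euclidean_space \<Rightarrow> real"
  assumes "continuous_on UNIV f" "compact K" "\<And>x. x \<notin> K \<Longrightarrow> f x = 0"
  obtains B where "B > 0" "\<And>x. \<bar>f x\<bar> \<le> B"
proof -
  have "bounded (f ` K)"
    using assms by (intro compact_imp_bounded compact_continuous_image) (auto intro: continuous_on_subset)
  then obtain B where "B > 0" "\<And>x. x \<in> K \<Longrightarrow> \<bar>f x\<bar> \<le> B"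
    by (auto simp: bounded_pos)
  then show ?thesis
    using assms(3) by (intro that[of B]) (metis abs_zero less_imp_le)+
qed

lemma test_function_support:
  assumes "\<phi> \<in> test_functions V"
  shows "compact (closure {x. \<phi> x \<noteq> 0})" "closure {x. \<phi> x \<noteq> 0} \<subseteq> V"
  using assms by (auto simp: test_functions_def simp del: compact_closure)

lemma test_function_bounded:
  assumes \<phi>: "\<phi> \<in> test_functions V"
  obtains B where "B > 0" "\<And>x. \<bar>\<phi> x\<bar> \<le> B"
  using continuous_compact_support_bounded[OF test_function_continuous[OF \<phi>] test_function_support(1)[OF \<phi>]]
    test_function_eq_0[of _ \<phi>] by metis

lemma test_function_derivative_bounded:
  assumes \<phi>: "\<phi> \<in> test_functions V" and b: "b \<in> Basis"
  obtains B where "B > 0" "\<And>x. \<bar>frechet_derivative \<phi> (at x) b\<bar> \<le> B"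
  using continuous_compact_support_bounded[OF test_function_derivative_continuous[OF \<phi> b]
      test_function_support(1)[OF \<phi>]] test_function_derivative_eq_0[of _ \<phi>]
  by (metis (no_types, lifting))

lemma integrable_mult_bounded:
  fixes k p :: "'a \<Rightarrow> real"
  assumes "integrable M k" "p \<in> borel_measurable M" "\<And>x. \<bar>p x\<bar> \<le> C"
  shows "integrable M (\<lambda>x. k x * p x)"
proof (rule Bochner_Integration.integrable_bound[where f = "\<lambda>x. C * k x"])
  show "AE x in M. norm (k x * p x) \<le> norm (C * k x)"
    using assms(3) order_trans[OF abs_ge_zero assms(3)]
    by (auto simp: abs_mult mult.commute[of "\<bar>k _\<bar>"] intro!: mult_right_mono order_trans[OF assms(3)])
qed (use assms in auto)

lemma continuous_imp_measurable_lebesgue_on: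
  "continuous_on UNIV f \<Longrightarrow> (f :: 'a::euclidean_space \<Rightarrow> real) \<in> borel_measurable (lebesgue_on S)"
  by (intro measurable_restrict_space1 measurable_completion) (simp add: borel_measurable_continuous_onI)

lemma finite_measure_lebesgue_on: "S \<in> lmeasurable \<Longrightarrow> finite_measure (lebesgue_on S)"
  by (auto intro!: finite_measureI simp: emeasure_restrict_space fmeasurable_def)

lemma test_function_translate:
  assumes "\<phi> \<in> test_functions V" "(\<lambda>x. x - c) ` V \<subseteq> U"
  shows "(\<lambda>x. \<phi> (x + c)) \<in> test_functions U"
proof -
  have "closure {x. \<phi> (x + c) \<noteq> 0} = closure ((\<lambda>x. x - c) ` {x. \<phi> x \<noteq> 0})"
    by (rule arg_cong[where f = closure]) (force simp: image_iff)
  also have "\<dots> = (\<lambda>x. x - c) ` closure {x. \<phi> x \<noteq> 0}"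
    by (rule closure_translation_subtract)
  finally have eq: "closure {x. \<phi> (x + c) \<noteq> 0} = (\<lambda>x. x - c) ` closure {x. \<phi> x \<noteq> 0}" .
  have "compact (closure {x. \<phi> x \<noteq> 0})" "closure {x. \<phi> x \<noteq> 0} \<subseteq> V" "Ck k \<phi>" for k
    using assms(1) by (auto simp: test_functions_def simp del: compact_closure)
  then show ?thesis
    using assms(2) unfolding test_functions_def mem_Collect_eq eq
    by (blast intro: Ck_translate compact_translation_subtract)
qed

section \<open>The fundamental lemma of the calculus of variations\<close>

lemma integral_box_eq_0:
  fixes F :: "'a::euclidean_space \<Rightarrow> real"
  assumes F: "integrable lborel F"
    and test: "\<And>\<phi>. \<phi> \<in> test_functions V \<Longrightarrow> (LINT x|lborel. F x * \<phi> x) = 0"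
    and "cbox p q \<subseteq> V"
  shows "(LINT x|lborel. F x * indicator (box p q) x) = 0"
proof -
  have meas [measurable]: "box_cutoff (1 / Suc k) p q \<in> borel_measurable borel" for k
    using box_cutoff_test_function[OF _ assms(3), of "1 / Suc k"]
    by (intro borel_measurable_continuous_onI test_function_continuous) auto
  have "(\<lambda>k. LINT x|lborel. F x * box_cutoff (1 / Suc k) p q x) \<longlonglongrightarrow>
      (LINT x|lborel. F x * indicator (box p q) x)"
  proof (rule integral_dominated_convergence[where w = "\<lambda>x. \<bar>F x\<bar>"])
    show "AE x in lborel. norm (F x * box_cutoff (1 / Suc k) p q x) \<le> \<bar>F x\<bar>" for k
      using box_cutoff_bounds[of "1 / Suc k" p q] by (auto simp: abs_mult intro!: mult_left_le)
    show "AE x in lborel. (\<lambda>k. F x * box_cutoff (1 / Suc k) p q x) \<longlonglongrightarrow> F x * indicator (box p q) x"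
      by (intro AE_I2 tendsto_mult tendsto_const box_cutoff_tendsto)
    show "(\<lambda>x. F x * box_cutoff (1 / Suc k) p q x) \<in> borel_measurable lborel" for k
      using F meas[of k] by measurable
  qed (use F in auto)
  moreover have "(LINT x|lborel. F x * box_cutoff (1 / Suc k) p q x) = 0" for k
    by (intro test box_cutoff_test_function) (use assms in auto)
  ultimately show ?thesis
    by (simp add: LIMSEQ_const_iff)
qed

lemma AE_cbox_diff_box: "AE x in lborel. x \<in> cbox p q \<longrightarrow> x \<in> box p (q::'a::euclidean_space)"
proof -
  have "cbox p q - box p q \<in> null_sets lborel"
    using negligible_frontier_interval[of p q]
    by (simp add: negligible_iff_null_sets null_sets_completion_iff)
  then show ?thesis
    by (rule AE_I') auto
qed

lemma fundamental_lemma_calculus_of_variations: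
  fixes F :: "'a::euclidean_space \<Rightarrow> real"
  assumes F: "integrable lborel F" and "open V"
    and test: "\<And>\<phi>. \<phi> \<in> test_functions V \<Longrightarrow> (LINT x|lborel. F x * \<phi> x) = 0"
  shows "AE x in lborel. x \<in> V \<longrightarrow> F x = 0"
proof -
  have cb: "AE x in lborel. x \<in> cbox p q \<longrightarrow> F x = 0" if pq: "cbox p q \<subseteq> V" for p q
  proof -
    define f where "f x = F x * indicator (cbox p q) x" for x
    have f: "integrable lborel f"
      unfolding f_def by (intro integrable_real_mult_indicator F) auto
    have eq: "f x = F x * indicator (box p q) x" if "x \<in> cbox p q \<longrightarrow> x \<in> box p q" for x
      using that box_subset_cbox[of p q] by (auto simp: f_def indicator_def)
    have AEeq: "AE x in lborel. f x = F x * indicator (box p q) x"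
      using AE_cbox_diff_box[of p q] eq by fastforce
    have boxes: "(LINT x|lborel. f x * indicator (box a b) x) = 0" for a b
    proof -
      obtain c d where cd: "box p q \<inter> box a b = box c d" "cbox c d \<subseteq> V"
      proof (cases "box p q \<inter> box a b = {}")
        case True
        have "box 0 0 = {}" "cbox 0 0 = {0 :: 'a}" by auto
        show ?thesis
        proof (cases "V = {}")
          case False
          then obtain z where "z \<in> V" by auto
          then show ?thesis by (intro that[of z z]) (use True in auto)
        next
          case True': True
          have "cbox p q = {}" using pq True' by auto
          moreover have "box p q = {}"
            using calculation box_subset_cbox[of p q] by auto
          ultimately show ?thesis using that[of p q] pq by simp
        qed
      next
        case False
        define c d where "c = (\<Sum>i\<in>Basis. max (p\<bullet>i) (a\<bullet>i) *\<^sub>R i)"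
          and "d = (\<Sum>i\<in>Basis. min (q\<bullet>i) (b\<bullet>i) *\<^sub>R i)"
        have eqb: "box p q \<inter> box a b = box c d"
          unfolding box_Int_box c_def d_def ..
        then have "cbox c d = closure (box c d)"
          using False by simp
        also have "\<dots> \<subseteq> closure (box p q)"
          using eqb by (intro closure_mono) auto
        also have "\<dots> \<subseteq> cbox p q"
          using box_subset_cbox by (intro closure_minimal) auto
        finally show ?thesis
          using that eqb pq by blast
      qed
      have "(LINT x|lborel. f x * indicator (box a b) x) = (LINT x|lborel. F x * indicator (box c d) x)"
        using F f AEeq
        by (intro integral_cong_AE) (auto simp: cd(1)[symmetric] indicator_inter_arith)
      then show ?thesis
        using integral_box_eq_0[OF F test cd(2)] by simp
    qed
    have all: "(LINT x|lborel. f x) = 0"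
      using AEeq integral_box_eq_0[OF F test pq] F f by (subst integral_cong_AE[OF _ _ AEeq]) auto
    have Int_stable_boxes: "Int_stable (range (\<lambda>(a, b). box a b :: 'a set))"
      unfolding Int_stable_def by (auto simp: box_Int_box)
    have int: "integrable lborel (\<lambda>x. f x * indicator A x)" if "A \<in> sets borel" for A
      using that by (intro integrable_real_mult_indicator f) auto
    have "A \<in> sets borel \<and> (LINT x|lborel. f x * indicator A x) = 0"
      if "A \<in> sigma_sets UNIV (range (\<lambda>(a, b). box a b :: 'a set))" for A
      using Int_stable_boxes Pow_UNIV[THEN equalityD2, THEN subset_trans[OF subset_UNIV]] that
    proof (induction rule: sigma_sets_induct_disjoint)
      case (compl A)
      have "(LINT x|lborel. f x * indicator (UNIV - A) x) = (LINT x|lborel. f x - f x * indicator A x)"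
        by (intro Bochner_Integration.integral_cong) (auto simp: indicator_def)
      also have "\<dots> = 0"
        using compl f int all by (subst Bochner_Integration.integral_diff) auto
      finally show ?case
        using compl by auto
    next
      case (union A)
      have U: "(\<Union>i. A i) \<in> sets borel"
        using union by (intro sets.countable_UN) auto
      have "(LINT x:(\<Union>i. A i)|lborel. f x) = (\<Sum>i. (LINT x:(A i)|lborel. f x))"
        using int[OF U] union
        by (intro lebesgue_integral_countable_add)
          (auto simp: set_integrable_def mult.commute disjoint_family_on_def)
      moreover have "set_lebesgue_integral lborel (A i) f = 0" for i
        using union by (simp add: set_lebesgue_integral_def mult.commute)
      ultimately have "set_lebesgue_integral lborel (\<Union>i. A i) f = 0"
        by simp
      then show ?case
        using U by (auto simp: set_lebesgue_integral_def mult.commute)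
    qed (use boxes in auto)
    then have "set_lebesgue_integral lborel A f = 0" if "A \<in> sets lborel" for A
      using that unfolding set_lebesgue_integral_def
      by (auto simp: borel_eq_box mult.commute)
    then have "AE x in lborel. f x = 0"
      by (intro density_unique_real f) (auto simp: set_lebesgue_integral_def)
    then show ?thesis
      by eventually_elim (auto simp: f_def indicator_def)
  qed
  obtain \<D> where \<D>: "countable \<D>" "\<D> \<subseteq> Pow V" "\<And>X. X \<in> \<D> \<Longrightarrow> \<exists>a b. X = cbox a b" "\<Union>\<D> = V"
    using open_countable_Union_open_cbox[OF \<open>open V\<close>] by metis
  have "AE x in lborel. x \<in> X \<longrightarrow> F x = 0" if X: "X \<in> \<D>" for X
  proof -
    obtain a b where "X = cbox a b"
      using \<D>(3) X by blast
    moreover have "X \<subseteq> V"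
      using \<D>(2) X by blast
    ultimately show ?thesis
      using cb by metis
  qed
  then have "AE x in lborel. \<forall>X\<in>\<D>. x \<in> X \<longrightarrow> F x = 0"
    unfolding AE_ball_countable[OF \<D>(1)] by blast
  then show ?thesis
    by eventually_elim (use \<D>(4) in blast)
qed

section \<open>Continuity of translation in \<open>L\<^sup>1\<close>\<close>

lemma compact_open_approximation:
  fixes A :: "'a::euclidean_space set"
  assumes A: "A \<in> sets borel" "emeasure lborel A < \<infinity>" and "e > (0::real)"
  obtains K U where "compact K" "open U" "K \<subseteq> A" "A \<subseteq> U" "U - K \<in> fmeasurable lborel"
    "measure lborel (U - K) < e"
proof -
  obtain U where U: "open U" "A \<subseteq> U" "emeasure lborel (U - A) < ennreal (e / 2)"
    using outer_regular_lborel[OF A(1), of "e / 2"] \<open>e > 0\<close> by auto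
  define M where "M = density lborel (indicator A)"
  have M_emeasure: "emeasure M B = emeasure lborel (A \<inter> B)" if "B \<in> sets borel" for B
    using that A(1) by (simp add: M_def emeasure_density nn_integral_cmult_indicator flip: indicator_inter_arith)
  have "emeasure M A = (SUP K\<in>{K. K \<subseteq> A \<and> compact K}. emeasure M K)"
    by (rule inner_regular) (use A M_emeasure[of UNIV] in \<open>auto simp: M_def\<close>)
  moreover have "emeasure M A \<noteq> \<infinity>"
    using A M_emeasure[OF A(1)] by auto
  ultimately have "\<exists>K\<in>{K. K \<subseteq> A \<and> compact K}. emeasure M A < emeasure M K + ennreal (e / 2)"
    using \<open>e > 0\<close> by (intro SUP_approx_ennreal) auto
  then obtain K where K: "K \<subseteq> A" "compact K" "emeasure M A < emeasure M K + ennreal (e / 2)"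
    by auto
  have [measurable]: "K \<in> sets borel" "U \<in> sets borel" "A \<in> sets borel"
    using K U A by (auto simp: borel_compact)
  have Kfin: "emeasure lborel K < \<infinity>"
    using emeasure_mono[OF K(1), of lborel] A by (auto intro: le_less_trans)
  have "emeasure lborel A < emeasure lborel K + ennreal (e / 2)"
    using K M_emeasure[of A] M_emeasure[of K] by (simp add: Int_absorb1)
  then have AK: "emeasure lborel (A - K) < ennreal (e / 2)"
    using K Kfin emeasure_Diff[of lborel K A] emeasure_mono[OF K(1), of lborel]
    by (simp add: minus_less_iff_ennreal add.commute)
  have "emeasure lborel (U - K) \<le> emeasure lborel ((U - A) \<union> (A - K))"
    by (rule emeasure_mono) auto
  also have "\<dots> \<le> emeasure lborel (U - A) + emeasure lborel (A - K)"
    by (rule emeasure_subadditive) auto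
  also have "\<dots> < ennreal (e / 2) + ennreal (e / 2)"
    using U AK by (intro add_strict_mono)
  also have "\<dots> = ennreal e"
    using \<open>e > 0\<close> by (simp flip: ennreal_plus)
  finally have UK: "emeasure lborel (U - K) < ennreal e" .
  then have "U - K \<in> fmeasurable lborel"
    by (intro fmeasurableI) (auto intro: less_trans)
  moreover have "measure lborel (U - K) < e"
    using UK calculation by (simp add: emeasure_eq_measure2 ennreal_less_iff)
  ultimately show ?thesis
    using that K U by blast
qed

lemma integrable_translate:
  fixes f :: "'a::euclidean_space \<Rightarrow> real"
  assumes "integrable lborel f"
  shows "integrable lborel (\<lambda>x. f (x + c))"
proof -
  have "integrable (distr lborel borel ((+) c)) f"
    using assms by (simp add: lborel_distr_plus)
  then show ?thesis
    using assms by (subst (asm) integrable_distr_eq) (auto simp: add.commute)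
qed

lemma integral_translate:
  fixes f :: "'a::euclidean_space \<Rightarrow> real"
  assumes [measurable]: "f \<in> borel_measurable borel"
  shows "(LINT x|lborel. f (x + c)) = (LINT x|lborel. f x)"
proof -
  have "(LINT x|lborel. f x) = (LINT x|distr lborel borel ((+) c). f x)"
    by (simp add: lborel_distr_plus)
  also have "\<dots> = (LINT x|lborel. f (c + x))"
    by (rule integral_distr) auto
  finally show ?thesis
    by (simp add: add.commute)
qed

definition translation_modulus :: "('a::euclidean_space \<Rightarrow> real) \<Rightarrow> 'a \<Rightarrow> real" where
  "translation_modulus f y = (LINT x|lborel. \<bar>f (x + y) - f x\<bar>)"

lemma translation_modulus_le:
  assumes "integrable lborel f" "integrable lborel g"
  shows "translation_modulus f y \<le> translation_modulus g y + 2 * (LINT x|lborel. \<bar>f x - g x\<bar>)"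
proof -
  have d: "integrable lborel (\<lambda>x. \<bar>f x - g x\<bar>)"
    using assms by auto
  have "translation_modulus f y \<le>
      (LINT x|lborel. \<bar>g (x + y) - g x\<bar> + (\<bar>f (x + y) - g (x + y)\<bar> + \<bar>f x - g x\<bar>))"
    unfolding translation_modulus_def
    using assms d integrable_translate[OF d, of y] integrable_translate[OF assms(1), of y]
      integrable_translate[OF assms(2), of y]
    by (intro integral_mono Bochner_Integration.integrable_add integrable_abs
        Bochner_Integration.integrable_diff) auto
  also have "\<dots> = translation_modulus g y +
      ((LINT x|lborel. \<bar>f (x + y) - g (x + y)\<bar>) + (LINT x|lborel. \<bar>f x - g x\<bar>))"
    unfolding translation_modulus_def
    using assms d integrable_translate[OF d, of y] integrable_translate[OF assms(2), of y]
    by (subst Bochner_Integration.integral_add; simp)+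
  also have "(LINT x|lborel. \<bar>f (x + y) - g (x + y)\<bar>) = (LINT x|lborel. \<bar>f x - g x\<bar>)"
    by (rule integral_translate[of "\<lambda>x. \<bar>f x - g x\<bar>"]) (use assms in auto)
  finally show ?thesis by simp
qed

lemma translation_modulus_nonneg: "0 \<le> translation_modulus f y"
  by (simp add: translation_modulus_def)

lemma translation_modulus_indicator:
  fixes A :: "'a::euclidean_space set"
  assumes A: "A \<in> sets borel" "emeasure lborel A < \<infinity>"
  shows "((\<lambda>y. translation_modulus (indicator A) y) \<longlongrightarrow> 0) (at 0)"
proof (rule tendstoI)
  fix e :: real assume "e > 0"
  obtain K U where KU: "compact K" "open U" "K \<subseteq> A" "A \<subseteq> U" "U - K \<in> fmeasurable lborel"
    "measure lborel (U - K) < e / 2"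
    using compact_open_approximation[OF A, of "e / 2"] \<open>e > 0\<close> by auto
  obtain d where d: "d > 0" "(\<Union>x\<in>K. ball x d) \<subseteq> U"
    using compact_subset_open_imp_ball_epsilon_subset[of K U] KU by blast
  have "translation_modulus (indicator A) y < e" if "norm y < d" for y
  proof -
    have near: "x + y \<in> U" "x - y \<in> U" if "x \<in> K" for x
      using subsetD[OF d(2), OF UN_I[OF that], of "x + y"] subsetD[OF d(2), OF UN_I[OF that], of "x - y"]
        \<open>norm y < d\<close>
      by (auto simp: dist_norm norm_minus_commute)
    have pt: "\<bar>indicator A (x + y) - indicator A x\<bar> \<le>
        (indicator (U - K) (x + y) + indicator (U - K) x :: real)" for x
      using near[of "x + y"] near[of x] KU(3,4) by (auto simp: indicator_def)
    have i: "integrable lborel (\<lambda>x. indicator (U - K) x :: real)"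
      using KU(5) by (simp add: fmeasurable_def)
    have "translation_modulus (indicator A) y \<le>
        (LINT x|lborel. indicator (U - K) (x + y) + indicator (U - K) x)"
      unfolding translation_modulus_def
      by (intro integral_mono pt) (use A i integrable_translate[OF i] integrable_translate[of "indicator A"] in auto)
    also have "\<dots> = (LINT x|lborel. indicator (U - K) (x + y)) + (LINT x|lborel. indicator (U - K) x)"
      by (intro Bochner_Integration.integral_add i integrable_translate[OF i])
    also have "\<dots> = 2 * measure lborel (U - K)"
      using KU(5) by (subst integral_translate) (auto simp: fmeasurable_def)
    finally show ?thesis
      using KU by simp
  qed
  then show "\<forall>\<^sub>F y in at 0. dist (translation_modulus (indicator A) y) 0 < e"
    using \<open>d > 0\<close> translation_modulus_nonneg[of "indicator A"]
    by (auto simp: eventually_at dist_norm intro!: exI[of _ d])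
qed

lemma translation_modulus_tendsto_0:
  fixes f :: "'a::euclidean_space \<Rightarrow> real"
  assumes "integrable lborel f"
  shows "((\<lambda>y. translation_modulus f y) \<longlongrightarrow> 0) (at 0)"
  using assms
proof (induction rule: integrable_induct)
  case (base A c)
  have "translation_modulus (\<lambda>x. indicator A x *\<^sub>R c) y = translation_modulus (indicator A) y * \<bar>c\<bar>" for y
    unfolding translation_modulus_def by (simp add: abs_mult flip: left_diff_distrib)
  then show ?case
    using tendsto_mult_right[OF translation_modulus_indicator, of A "\<bar>c\<bar>"] base by simp
next
  case (add f g)
  show ?case
  proof (rule tendsto_sandwich[OF _ _ tendsto_const])
    show "((\<lambda>y. translation_modulus f y + translation_modulus g y) \<longlongrightarrow> 0) (at 0)"
      using tendsto_add[OF add.IH] by simp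
    have "translation_modulus (\<lambda>x. f x + g x) y \<le> translation_modulus f y + translation_modulus g y" for y
    proof -
      have "translation_modulus (\<lambda>x. f x + g x) y \<le>
          (LINT x|lborel. \<bar>f (x + y) - f x\<bar> + \<bar>g (x + y) - g x\<bar>)"
        unfolding translation_modulus_def
        using add integrable_translate[OF add(1), of y] integrable_translate[OF add(2), of y]
        by (intro integral_mono Bochner_Integration.integrable_add integrable_abs
            Bochner_Integration.integrable_diff) auto
      also have "\<dots> = translation_modulus f y + translation_modulus g y"
        unfolding translation_modulus_def
        using add integrable_translate[OF add(1), of y] integrable_translate[OF add(2), of y]
        by (intro Bochner_Integration.integral_add integrable_abs
            Bochner_Integration.integrable_diff) auto
      finally show ?thesis .
    qed
    then show "\<forall>\<^sub>F y in at 0. translation_modulus (\<lambda>x. f x + g x) y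
        \<le> translation_modulus f y + translation_modulus g y"
      by simp
  qed (simp add: translation_modulus_nonneg)
next
  case (lim f s)
  have L: "(\<lambda>i. LINT x|lborel. \<bar>f x - s i x\<bar>) \<longlonglongrightarrow> (LINT x|(lborel :: 'a measure). 0)"
  proof (rule integral_dominated_convergence[where w = "\<lambda>x. 3 * \<bar>f x\<bar>"])
    show "AE x in lborel. (\<lambda>i. \<bar>f x - s i x\<bar>) \<longlonglongrightarrow> 0"
      using lim.hyps(2) by (auto intro!: AE_I2 tendsto_eq_intros)
    show "AE x in lborel. norm \<bar>f x - s i x\<bar> \<le> 3 * \<bar>f x\<bar>" for i
    proof (rule AE_I2)
      fix x
      show "norm \<bar>f x - s i x\<bar> \<le> 3 * \<bar>f x\<bar>"
        using lim.hyps(3)[of x i] by simp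
    qed
  qed (use lim.hyps(1,4) in auto)
  show ?case
  proof (rule tendstoI)
    fix e :: real assume "e > 0"
    then have "\<forall>\<^sub>F i in sequentially. (LINT x|lborel. \<bar>f x - s i x\<bar>) < e / 4"
      using L by (intro order_tendstoD(2)) auto
    then obtain i where i: "(LINT x|lborel. \<bar>f x - s i x\<bar>) < e / 4"
      by (auto simp: eventually_sequentially)
    have "\<forall>\<^sub>F y in at 0. translation_modulus (s i) y < e / 2"
      using lim.IH[of i] \<open>e > 0\<close> by (intro order_tendstoD(2)) auto
    then show "\<forall>\<^sub>F y in at 0. dist (translation_modulus f y) 0 < e"
    proof eventually_elim
      case (elim y)
      then show ?case
        using translation_modulus_le[OF lim.hyps(4) lim.hyps(1)[of i], of y] i translation_modulus_nonneg[of f y]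
        by simp
    qed
  qed
qed

section \<open>Difference quotients\<close>

lemma integrable_translate_product:
  fixes g :: "'a::euclidean_space \<Rightarrow> real" and b :: 'a
  assumes g: "integrable lborel g"
  shows "integrable (lborel \<Otimes>\<^sub>M lborel) (\<lambda>(s::real, x). indicator {0..\<tau>} s * g (x + s *\<^sub>R b))"
proof -
  have [measurable]: "g \<in> borel_measurable borel"
    using g by auto
  show ?thesis
  proof (rule lborel_pair.Fubini_integrable)
    have "(LINT x|lborel. norm (case (s, x) of (s::real, x) \<Rightarrow> indicator {0..\<tau>} s * g (x + s *\<^sub>R b))) =
        indicator {0..\<tau>} s * (LINT x|lborel. \<bar>g x\<bar>)" for s
      using integral_translate[of "\<lambda>x. \<bar>g x\<bar>" "s *\<^sub>R b"] by (simp add: abs_mult)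
    moreover have "integrable lborel (indicator {0..\<tau>} :: real \<Rightarrow> real)"
      by (rule integrable_real_indicator) (auto simp: emeasure_lborel_Icc_eq)
    ultimately show "integrable lborel (\<lambda>s. LINT x|lborel.
        norm (case (s, x) of (s::real, x) \<Rightarrow> indicator {0..\<tau>} s * g (x + s *\<^sub>R b)))"
      by simp
    show "AE s in lborel. integrable lborel
        (\<lambda>x. case (s, x) of (s::real, x) \<Rightarrow> indicator {0..\<tau>} s * g (x + s *\<^sub>R b))"
      using integrable_translate[OF g] by simp
  qed measurable
qed

lemma test_function_line_derivative:
  assumes "\<psi> \<in> test_functions V"
  shows "((\<lambda>s. \<psi> (x - s *\<^sub>R b)) has_real_derivative - frechet_derivative \<psi> (at (x - s *\<^sub>R b)) b) (at s)"
proof -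
  let ?D = "frechet_derivative \<psi> (at (x - s *\<^sub>R b))"
  have D: "(\<psi> has_derivative ?D) (at (x - s *\<^sub>R b))"
    by (rule test_function_has_derivative[OF assms])
  have "((\<lambda>s. x - s *\<^sub>R b) has_derivative (\<lambda>h. - (h *\<^sub>R b))) (at s)"
    by (auto intro!: derivative_eq_intros)
  then have "((\<lambda>s. \<psi> (x - s *\<^sub>R b)) has_derivative (\<lambda>h. ?D (- (h *\<^sub>R b)))) (at s)"
    using D by (rule has_derivative_compose)
  moreover have "(\<lambda>h. ?D (- (h *\<^sub>R b))) = (*) (- ?D b)"
    using linear_cmul[OF has_derivative_linear[OF D], of "- h" b for h] by (auto simp: mult.commute)
  ultimately show ?thesis
    by (simp only: has_field_derivative_def)
qed

locale local_weak_derivative =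
  fixes U :: "'a::euclidean_space set" and b :: 'a and h g :: "'a \<Rightarrow> real" and V :: "'a set" and \<rho> :: real
  assumes b: "b \<in> Basis"
    and h: "integrable lborel h" and g: "integrable lborel g"
    and weak: "\<And>\<phi>. \<phi> \<in> test_functions U \<Longrightarrow>
      (LINT x|lborel. h x * frechet_derivative \<phi> (at x) b) = - (LINT x|lborel. g x * \<phi> x)"
    and V: "open V" and \<rho>: "\<rho> > 0"
    and VU: "\<And>x s. x \<in> V \<Longrightarrow> 0 \<le> s \<Longrightarrow> s \<le> \<rho> \<Longrightarrow> x + s *\<^sub>R b \<in> U"
begin

lemma hg_measurable [measurable]: "h \<in> borel_measurable borel" "g \<in> borel_measurable borel"
  using h g by auto

lemma difference_eq_integral:
  assumes \<tau>: "0 < \<tau>" "\<tau> \<le> \<rho>"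
  shows "AE x in lborel. x \<in> V \<longrightarrow>
    h (x + \<tau> *\<^sub>R b) - h x = (LINT s|lborel. indicator {0..\<tau>} s * g (x + s *\<^sub>R b))"
proof -
  define I where "I x = (LINT s|lborel. indicator {0..\<tau>} s * g (x + s *\<^sub>R b))" for x
  note pair = integrable_translate_product[OF g, of \<tau> b]
  have I: "integrable lborel I"
    using lborel_pair.integrable_fst'[OF lborel_pair.integrable_product_swap[OF pair]]
    by (simp add: I_def[abs_def])
  have ht: "integrable lborel (\<lambda>x. h (x + \<tau> *\<^sub>R b))"
    by (rule integrable_translate[OF h])
  have "(LINT x|lborel. (h (x + \<tau> *\<^sub>R b) - h x - I x) * \<psi> x) = 0" if \<psi>: "\<psi> \<in> test_functions V" for \<psi>
  proof -
    let ?d = "\<lambda>x. frechet_derivative \<psi> (at x) b"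
    have cont: "continuous_on UNIV \<psi>" "continuous_on UNIV ?d"
      using test_function_continuous[OF \<psi>] test_function_derivative_continuous[OF \<psi> b] .
    then have [measurable]: "\<psi> \<in> borel_measurable borel" "?d \<in> borel_measurable borel"
      by (auto intro: borel_measurable_continuous_onI)
    obtain B where B: "B > 0" "\<And>x. \<bar>\<psi> x\<bar> \<le> B"
      using test_function_bounded[OF \<psi>] by blast
    obtain B' where B': "B' > 0" "\<And>x. \<bar>?d x\<bar> \<le> B'"
      using test_function_derivative_bounded[OF \<psi> b] by blast
    have i1: "integrable lborel (\<lambda>x. h (x + \<tau> *\<^sub>R b) * \<psi> x)" "integrable lborel (\<lambda>x. h x * \<psi> x)"
        "integrable lborel (\<lambda>x. I x * \<psi> x)" "integrable lborel (\<lambda>x. h x * \<psi> (x - \<tau> *\<^sub>R b))"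
      using B by (auto intro!: integrable_mult_bounded h ht I)
    have h_part: "(LINT x|lborel. h (x + \<tau> *\<^sub>R b) * \<psi> x) = (LINT x|lborel. h x * \<psi> (x - \<tau> *\<^sub>R b))"
      using integral_translate[of "\<lambda>x. h x * \<psi> (x - \<tau> *\<^sub>R b)" "\<tau> *\<^sub>R b"] by simp
    have slice: "(LINT x|lborel. g (x + s *\<^sub>R b) * \<psi> x) = - (LINT x|lborel. h x * ?d (x - s *\<^sub>R b))"
      if s: "0 \<le> s" "s \<le> \<tau>" for s
    proof -
      have "(\<lambda>x. \<psi> (x + - (s *\<^sub>R b))) \<in> test_functions U"
        using s \<tau> VU by (intro test_function_translate[OF \<psi>]) auto
      from weak[OF this]
      have "(LINT x|lborel. g x * \<psi> (x + - (s *\<^sub>R b))) =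
          - (LINT x|lborel. h x * frechet_derivative (\<lambda>x. \<psi> (x + - (s *\<^sub>R b))) (at x) b)"
        by simp
      also have "\<dots> = - (LINT x|lborel. h x * ?d (x - s *\<^sub>R b))"
        using test_function_has_derivative[OF \<psi>]
        by (subst frechet_derivative_translate) (auto simp: differentiable_def)
      finally show ?thesis
        using integral_translate[of "\<lambda>x. g x * \<psi> (x - s *\<^sub>R b)" "s *\<^sub>R b"] by simp
    qed
    have "(LINT x|lborel. I x * \<psi> x) =
        (LINT x|lborel. LINT s|lborel. indicator {0..\<tau>} s * g (x + s *\<^sub>R b) * \<psi> x)"
      by (simp add: I_def)
    also have "\<dots> = (LINT s|lborel. LINT x|lborel. indicator {0..\<tau>} s * g (x + s *\<^sub>R b) * \<psi> x)"
    proof (rule lborel_pair.Fubini_integral)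
      show "integrable (lborel \<Otimes>\<^sub>M lborel) (\<lambda>(s, x). indicator {0..\<tau>} s * g (x + s *\<^sub>R b) * \<psi> x)"
      proof (rule Bochner_Integration.integrable_bound[OF integrable_mult_right[OF pair, of B]])
        show "AE p in lborel \<Otimes>\<^sub>M lborel. norm (case p of (s, x) \<Rightarrow> indicator {0..\<tau>} s * g (x + s *\<^sub>R b) * \<psi> x)
            \<le> norm (B * (case p of (s, x) \<Rightarrow> indicator {0..\<tau>} s * g (x + s *\<^sub>R b)))"
          using B by (auto simp: abs_mult mult.commute[of B] intro!: AE_I2 mult_left_mono)
      qed measurable
    qed
    also have "\<dots> = (LINT s|lborel. - (LINT x|lborel. indicator {0..\<tau>} s * (h x * ?d (x - s *\<^sub>R b))))"
    proof (rule Bochner_Integration.integral_cong[OF refl])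
      fix s
      show "(LINT x|lborel. indicator {0..\<tau>} s * g (x + s *\<^sub>R b) * \<psi> x) =
          - (LINT x|lborel. indicator {0..\<tau>} s * (h x * ?d (x - s *\<^sub>R b)))"
        using slice[of s] by (cases "s \<in> {0..\<tau>}") (auto simp: mult.assoc)
    qed
    also have "\<dots> = - (LINT s|lborel. LINT x|lborel. indicator {0..\<tau>} s * (h x * ?d (x - s *\<^sub>R b)))"
      by simp
    also have "(LINT s|lborel. LINT x|lborel. indicator {0..\<tau>} s * (h x * ?d (x - s *\<^sub>R b))) =
        (LINT x|lborel. LINT s|lborel. indicator {0..\<tau>} s * (h x * ?d (x - s *\<^sub>R b)))"
    proof (rule lborel_pair.Fubini_integral[symmetric])
      have pair': "integrable (lborel \<Otimes>\<^sub>M lborel) (\<lambda>(s::real, x). indicator {0..\<tau>} s * h x)"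
        using integrable_translate_product[OF h, of \<tau> 0] by simp
      show "integrable (lborel \<Otimes>\<^sub>M lborel) (\<lambda>(s, x). indicator {0..\<tau>} s * (h x * ?d (x - s *\<^sub>R b)))"
      proof (rule Bochner_Integration.integrable_bound[OF integrable_mult_right[OF pair', of B']])
        show "AE p in lborel \<Otimes>\<^sub>M lborel. norm (case p of (s, x) \<Rightarrow> indicator {0..\<tau>} s * (h x * ?d (x - s *\<^sub>R b)))
            \<le> norm (B' * (case p of (s, x) \<Rightarrow> indicator {0..\<tau>} s * h x))"
          using B' by (auto simp: abs_mult mult.commute[of B'] mult.assoc[symmetric] intro!: AE_I2 mult_left_mono)
      qed measurable
    qed
    also have "\<dots> = (LINT x|lborel. h x * (\<psi> x - \<psi> (x - \<tau> *\<^sub>R b)))"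
    proof (rule Bochner_Integration.integral_cong[OF refl])
      fix x
      have "(LINT s|lborel. - ?d (x - s *\<^sub>R b) * indicator {0..\<tau>} s) = \<psi> (x - \<tau> *\<^sub>R b) - \<psi> (x - 0 *\<^sub>R b)"
      proof (rule integral_FTC_Icc_real)
        fix s show "isCont (\<lambda>s. - ?d (x - s *\<^sub>R b)) s"
          using continuous_on_compose2[OF cont(2), of UNIV "\<lambda>s. x - s *\<^sub>R b"]
          by (auto intro!: continuous_intros simp: continuous_on_eq_continuous_at)
      qed (use \<tau> test_function_line_derivative[OF \<psi>] in auto)
      then have "(LINT s|lborel. indicator {0..\<tau>} s * ?d (x - s *\<^sub>R b)) = \<psi> x - \<psi> (x - \<tau> *\<^sub>R b)"
        by (simp add: mult.commute)
      moreover have "indicator {0..\<tau>} s * (h x * ?d (x - s *\<^sub>R b)) =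
          h x * (indicator {0..\<tau>} s * ?d (x - s *\<^sub>R b))" for s
        by simp
      ultimately show "(LINT s|lborel. indicator {0..\<tau>} s * (h x * ?d (x - s *\<^sub>R b))) =
          h x * (\<psi> x - \<psi> (x - \<tau> *\<^sub>R b))"
        by (simp only: integral_mult_right_zero)
    qed
    finally have "(LINT x|lborel. I x * \<psi> x) =
        - (LINT x|lborel. h x * \<psi> x) + (LINT x|lborel. h x * \<psi> (x - \<tau> *\<^sub>R b))"
      using i1 by (simp add: right_diff_distrib)
    then show ?thesis
      using i1 h_part by (simp add: left_diff_distrib)
  qed
  then have "AE x in lborel. x \<in> V \<longrightarrow> h (x + \<tau> *\<^sub>R b) - h x - I x = 0"
    using I h ht by (intro fundamental_lemma_calculus_of_variations V) auto
  then show ?thesis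
    by (simp add: I_def)
qed

lemma difference_quotient_L1:
  assumes "e > 0"
  shows "\<exists>\<delta>>0. \<forall>\<tau>. 0 < \<tau> \<and> \<tau> < \<delta> \<longrightarrow>
    integrable lborel (\<lambda>x. indicator V x * ((h (x + \<tau> *\<^sub>R b) - h x) / \<tau> - g x)) \<and>
    (LINT x|lborel. \<bar>indicator V x * ((h (x + \<tau> *\<^sub>R b) - h x) / \<tau> - g x)\<bar>) \<le> e"
proof -
  have "\<forall>\<^sub>F y in at 0. translation_modulus g y < e"
    using translation_modulus_tendsto_0[OF g] \<open>e > 0\<close> by (intro order_tendstoD(2)) auto
  then obtain d where "d > 0" and d: "\<And>y. y \<noteq> 0 \<Longrightarrow> norm y < d \<Longrightarrow> translation_modulus g y < e"
    by (auto simp: eventually_at)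
  have small: "translation_modulus g y \<le> e" if "norm y < d" for y
    using d[of y] that \<open>e > 0\<close> by (cases "y = 0") (auto simp: translation_modulus_def)
  show ?thesis
  proof (intro exI[of _ "min d \<rho>"] conjI allI impI)
    show "min d \<rho> > 0"
      using \<open>d > 0\<close> \<rho> by simp
    fix \<tau> :: real assume \<tau>: "0 < \<tau> \<and> \<tau> < min d \<rho>"
    define D where "D x = (h (x + \<tau> *\<^sub>R b) - h x) / \<tau>" for x
    have [measurable]: "V \<in> sets borel" "D \<in> borel_measurable borel"
      using V by (auto simp: D_def[abs_def])
    have D: "integrable lborel D"
      using h integrable_translate[OF h, of "\<tau> *\<^sub>R b"] by (simp add: D_def[abs_def])
    have "integrable lborel (\<lambda>x. (D x - g x) * indicator V x)"
      by (intro integrable_real_mult_indicator Bochner_Integration.integrable_diff D g) simp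
    then show "integrable lborel (\<lambda>x. indicator V x * ((h (x + \<tau> *\<^sub>R b) - h x) / \<tau> - g x))"
      by (simp only: D_def mult.commute)
    then have iD: "integrable lborel (\<lambda>x. indicator V x * (D x - g x))"
      by (simp add: D_def)
    define k where "k s x = indicator {0..\<tau>} s * \<bar>g (x + s *\<^sub>R b) - g x\<bar>" for s x
    note pair = integrable_translate_product[OF g, of \<tau> b]
    have "integrable (lborel \<Otimes>\<^sub>M lborel) (\<lambda>p. \<bar>(case p of (s::real, x) \<Rightarrow> indicator {0..\<tau>} s * g (x + s *\<^sub>R b)) -
        (case p of (s, x) \<Rightarrow> indicator {0..\<tau>} s * g (x + s *\<^sub>R 0))\<bar>)"
      by (intro integrable_abs Bochner_Integration.integrable_diff integrable_translate_product g)
    also have "(\<lambda>p. \<bar>(case p of (s::real, x) \<Rightarrow> indicator {0..\<tau>} s * g (x + s *\<^sub>R b)) -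
        (case p of (s, x) \<Rightarrow> indicator {0..\<tau>} s * g (x + s *\<^sub>R 0))\<bar>) = (\<lambda>(s, x). k s x)"
      by (auto simp: k_def fun_eq_iff indicator_def)
    finally have k: "integrable (lborel \<Otimes>\<^sub>M lborel) (\<lambda>(s, x). k s x)" .
    have kx: "integrable lborel (\<lambda>x. LINT s|lborel. k s x)"
      using lborel_pair.integrable_fst'[OF lborel_pair.integrable_product_swap[OF k]] by simp
    have "AE x in lborel. integrable lborel (\<lambda>s. indicator {0..\<tau>} s * g (x + s *\<^sub>R b))"
      using lborel_pair.AE_integrable_fst'[OF lborel_pair.integrable_product_swap[OF pair]] by simp
    moreover have "AE x in lborel. x \<in> V \<longrightarrow>
        h (x + \<tau> *\<^sub>R b) - h x = (LINT s|lborel. indicator {0..\<tau>} s * g (x + s *\<^sub>R b))"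
      using \<tau> by (intro difference_eq_integral) auto
    ultimately have pt: "AE x in lborel. \<bar>indicator V x * (D x - g x)\<bar> \<le> (LINT s|lborel. k s x) / \<tau>"
    proof eventually_elim
      case (elim x)
      show ?case
      proof (cases "x \<in> V")
        case True
        have i2: "integrable lborel (\<lambda>s. indicator {0..\<tau>} s * g x)"
          by (intro integrable_mult_left integrable_real_indicator) (auto simp: emeasure_lborel_Icc_eq)
        have "(LINT s|lborel. indicator {0..\<tau>} s * g x) = \<tau> * g x"
          using \<tau> by simp
        then have "\<tau> * (D x - g x) =
            (LINT s|lborel. indicator {0..\<tau>} s * g (x + s *\<^sub>R b) - indicator {0..\<tau>} s * g x)"
          using elim True \<tau> i2 by (simp add: D_def right_diff_distrib)
        also have "\<bar>\<dots>\<bar> \<le> (LINT s|lborel. \<bar>indicator {0..\<tau>} s * g (x + s *\<^sub>R b) - indicator {0..\<tau>} s * g x\<bar>)"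
          by (rule integral_abs_bound)
        also have "\<dots> = (LINT s|lborel. k s x)"
          by (intro Bochner_Integration.integral_cong) (auto simp: k_def indicator_def)
        finally show ?thesis
          using True \<tau> by (simp add: abs_mult pos_le_divide_eq mult.commute)
      qed (use \<tau> in \<open>auto intro!: divide_nonneg_pos Bochner_Integration.integral_nonneg simp: k_def\<close>)
    qed
    have "(LINT x|lborel. \<bar>indicator V x * (D x - g x)\<bar>) \<le> (LINT x|lborel. (LINT s|lborel. k s x) / \<tau>)"
      using iD kx pt by (intro integral_mono_AE) auto
    also have "\<dots> = (LINT s|lborel. LINT x|lborel. k s x) / \<tau>"
      using lborel_pair.Fubini_integral[OF k] by simp
    also have "(LINT s|lborel. LINT x|lborel. k s x) = (LINT s|lborel. indicator {0..\<tau>} s * translation_modulus g (s *\<^sub>R b))"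
      by (simp add: k_def translation_modulus_def)
    also have "\<dots> \<le> (LINT s|lborel. indicator {0..\<tau>} s * e)"
    proof (rule integral_mono)
      show "integrable lborel (\<lambda>s. indicator {0..\<tau>} s * translation_modulus g (s *\<^sub>R b))"
        using lborel_pair.integrable_fst'[OF k] by (simp add: k_def translation_modulus_def)
      show "integrable lborel (\<lambda>s. indicator {0..\<tau>} s * e)"
        by (intro integrable_mult_left integrable_real_indicator) (auto simp: emeasure_lborel_Icc_eq)
      show "indicator {0..\<tau>} s * translation_modulus g (s *\<^sub>R b) \<le> indicator {0..\<tau>} s * e" for s
        using \<tau> b by (auto simp: indicator_def intro!: small)
    qed
    also have "\<dots> = \<tau> * e"
      using \<tau> by simp
    finally show "(LINT x|lborel. \<bar>indicator V x * ((h (x + \<tau> *\<^sub>R b) - h x) / \<tau> - g x)\<bar>) \<le> e"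
      using \<tau> by (simp add: D_def divide_right_mono)
  qed
qed

end

section \<open>The weak derivative of the negative part\<close>

text \<open>The slope at \<open>a\<close> of \<open>y \<mapsto> max (- y) 0\<close> in the direction \<open>d\<close>. That the weak derivative vanishes
  almost everywhere on \<open>{h = 0}\<close> is not needed, so the one-sided slope is kept there.\<close>

definition neg_slope :: "real \<Rightarrow> real \<Rightarrow> real" where
  "neg_slope a d = (if a < 0 then - d else if a = 0 then max (- d) 0 else 0)"

lemma neg_slope_tendsto:
  assumes \<tau>: "\<And>k. \<tau> k > 0" "\<tau> \<longlonglongrightarrow> 0" and q: "q \<longlonglongrightarrow> d"
  shows "(\<lambda>k. (max (- (a + \<tau> k * q k)) 0 - max (- a) 0) / \<tau> k) \<longlonglongrightarrow> neg_slope a d"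
proof -
  have lim: "(\<lambda>k. a + \<tau> k * q k) \<longlonglongrightarrow> a"
    using tendsto_add[OF tendsto_const tendsto_mult[OF \<tau>(2) q]] by simp
  consider "a < 0" | "a = 0" | "a > 0" by linarith
  then show ?thesis
  proof cases
    case 1
    then have "\<forall>\<^sub>F k in sequentially. a + \<tau> k * q k < 0"
      using lim by (intro order_tendstoD(2)) auto
    then have "\<forall>\<^sub>F k in sequentially. - q k = (max (- (a + \<tau> k * q k)) 0 - max (- a) 0) / \<tau> k"
    proof eventually_elim
      case (elim k)
      then show ?case using \<tau>(1)[of k] 1 by (simp add: max_def field_simps)
    qed
    then show ?thesis
      using 1 tendsto_minus[OF q] by (simp add: neg_slope_def tendsto_cong)
  next
    case 2
    have "(max (- (a + \<tau> k * q k)) 0 - max (- a) 0) / \<tau> k = max (- q k) 0" for k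
      using \<tau>(1)[of k] 2 by (auto simp: max_def mult_less_0_iff zero_less_mult_iff mult_le_0_iff zero_le_mult_iff)
    then show ?thesis
      using 2 tendsto_max[OF tendsto_minus[OF q] tendsto_const[of 0]] by (simp add: neg_slope_def)
  next
    case 3
    then have "\<forall>\<^sub>F k in sequentially. a + \<tau> k * q k > 0"
      using lim by (intro order_tendstoD(1)) auto
    then have "\<forall>\<^sub>F k in sequentially. (max (- (a + \<tau> k * q k)) 0 - max (- a) 0) / \<tau> k = 0"
      by eventually_elim (use 3 in auto)
    then show ?thesis
      using 3 by (simp add: neg_slope_def tendsto_eventually)
  qed
qed

lemma abs_neg_slope_le: "\<bar>neg_slope a d\<bar> \<le> \<bar>d\<bar>"
  by (auto simp: neg_slope_def)

lemma mult_neg_slope_le: "d * neg_slope a d \<le> - (neg_slope a d)\<^sup>2"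
  by (auto simp: neg_slope_def power2_eq_square max_def mult_nonneg_nonpos)

lemma neg_slope_measurable [measurable (raw)]:
  assumes [measurable]: "f \<in> borel_measurable M" "g \<in> borel_measurable M"
  shows "(\<lambda>x. neg_slope (f x) (g x)) \<in> borel_measurable M"
  unfolding neg_slope_def by measurable

lemma dominated_convergence_perturbed:
  fixes f :: "nat \<Rightarrow> 'a \<Rightarrow> real"
  assumes f: "\<And>k. integrable M (f k)" "integrable M l" and w: "integrable M w"
    and d: "\<And>k. integrable M (d k)" "(\<lambda>k. LINT x|M. d k x) \<longlonglongrightarrow> 0"
    and lim: "AE x in M. (\<lambda>k. f k x) \<longlonglongrightarrow> l x"
    and bound: "\<And>k x. \<bar>f k x - l x\<bar> \<le> w x + d k x" "\<And>k x. 0 \<le> d k x" "\<And>x. 0 \<le> w x"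
  shows "(\<lambda>k. LINT x|M. f k x) \<longlonglongrightarrow> (LINT x|M. l x)"
proof -
  note [measurable] = borel_measurable_integrable[OF f(1)] borel_measurable_integrable[OF f(2)]
    borel_measurable_integrable[OF w]
  have "(\<lambda>k. LINT x|M. min \<bar>f k x - l x\<bar> (w x)) \<longlonglongrightarrow> (LINT x|M. 0)"
  proof (rule integral_dominated_convergence[OF _ _ w])
    show "AE x in M. (\<lambda>k. min \<bar>f k x - l x\<bar> (w x)) \<longlonglongrightarrow> 0"
      using lim
    proof eventually_elim
      case (elim x)
      have "(\<lambda>k. min \<bar>f k x - l x\<bar> (w x)) \<longlonglongrightarrow> min \<bar>l x - l x\<bar> (w x)"
        by (intro tendsto_intros elim)
      then show ?case
        using bound(3)[of x] by simp
    qed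
    show "AE x in M. norm (min \<bar>f k x - l x\<bar> (w x)) \<le> w x" for k
      using bound(3) by (auto intro!: AE_I2)
  qed auto
  then have L: "(\<lambda>k. (LINT x|M. min \<bar>f k x - l x\<bar> (w x)) + (LINT x|M. d k x)) \<longlonglongrightarrow> 0"
    using tendsto_add[OF _ d(2)] by simp
  have "\<bar>(LINT x|M. f k x) - (LINT x|M. l x)\<bar> \<le> (LINT x|M. min \<bar>f k x - l x\<bar> (w x)) + (LINT x|M. d k x)" for k
  proof -
    have m: "integrable M (\<lambda>x. min \<bar>f k x - l x\<bar> (w x))"
      by (rule Bochner_Integration.integrable_bound[OF w]) (use bound(3) in auto)
    have "\<bar>(LINT x|M. f k x) - (LINT x|M. l x)\<bar> = \<bar>LINT x|M. f k x - l x\<bar>"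
      using f by simp
    also have "\<dots> \<le> (LINT x|M. \<bar>f k x - l x\<bar>)"
      by (rule integral_abs_bound)
    also have "\<dots> \<le> (LINT x|M. min \<bar>f k x - l x\<bar> (w x) + d k x)"
    proof (rule integral_mono)
      show "\<bar>f k x - l x\<bar> \<le> min \<bar>f k x - l x\<bar> (w x) + d k x" for x
        using bound(1)[where x = x and k = k] bound(2)[where x = x and k = k] by auto
    qed (use f m d in auto)
    finally show ?thesis
      using m d by simp
  qed
  then have "(\<lambda>k. (LINT x|M. f k x) - (LINT x|M. l x)) \<longlonglongrightarrow> 0"
    by (intro Lim_null_comparison[OF _ L]) auto
  then show ?thesis
    by (simp add: LIM_zero_iff)
qed

context local_weak_derivative
begin

lemma weak_derivative_negative_part:
  assumes \<phi>: "\<phi> \<in> test_functions V"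
  shows "(LINT x|lborel. max (- h x) 0 * frechet_derivative \<phi> (at x) b) =
    - (LINT x|lborel. neg_slope (h x) (g x) * \<phi> x)"
proof -
  let ?d = "\<lambda>x. frechet_derivative \<phi> (at x) b"
  have cont: "continuous_on UNIV \<phi>" "continuous_on UNIV ?d"
    using test_function_continuous[OF \<phi>] test_function_derivative_continuous[OF \<phi> b] .
  then have [measurable]: "\<phi> \<in> borel_measurable borel" "?d \<in> borel_measurable borel"
    by (auto intro: borel_measurable_continuous_onI)
  obtain B where B: "B > 0" "\<And>x. \<bar>\<phi> x\<bar> \<le> B"
    using test_function_bounded[OF \<phi>] by blast
  obtain B' where B': "B' > 0" "\<And>x. \<bar>?d x\<bar> \<le> B'"
    using test_function_derivative_bounded[OF \<phi> b] by blast
  define n where "n x = max (- h x) 0" for x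
  define G where "G x = neg_slope (h x) (g x)" for x
  have [measurable]: "n \<in> borel_measurable borel" "G \<in> borel_measurable borel"
    by (simp_all add: n_def[abs_def] G_def[abs_def])
  have n: "integrable lborel n"
    by (rule Bochner_Integration.integrable_bound[OF h]) (auto simp: n_def)
  have G: "integrable lborel G"
    by (rule Bochner_Integration.integrable_bound[OF g]) (auto simp: G_def abs_neg_slope_le)
  define \<tau> where "\<tau> k = \<rho> / Suc k" for k
  have \<tau>: "\<tau> k > 0" for k
    using \<rho> by (simp add: \<tau>_def)
  have \<tau>0: "\<tau> \<longlonglongrightarrow> 0"
    using LIMSEQ_Suc[OF lim_const_over_n[of \<rho>]] by (simp add: \<tau>_def[abs_def])
  have "\<tau> k \<noteq> 0" for k
    using \<tau>[of k] by simp
  then have \<tau>_at: "filterlim \<tau> (at 0) sequentially"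
    using \<tau>0 by (simp add: filterlim_at)
  define D where "D k x = (h (x + \<tau> k *\<^sub>R b) - h x) / \<tau> k" for k x
  define E where "E k x = (n (x + \<tau> k *\<^sub>R b) - n x) / \<tau> k" for k x
  have D: "integrable lborel (D k)" and E: "integrable lborel (E k)" for k
    using h n integrable_translate[OF h, of "\<tau> k *\<^sub>R b"] integrable_translate[OF n, of "\<tau> k *\<^sub>R b"]
    by (simp_all add: D_def[abs_def] E_def[abs_def])
  note [measurable] = borel_measurable_integrable[OF D] borel_measurable_integrable[OF E]
  have VD: "integrable lborel (\<lambda>x. indicator V x * (D k x - g x))" for k
    using integrable_real_mult_indicator[of V lborel "\<lambda>x. D k x - g x"] D g V
    by (simp add: mult.commute)
  have VD0: "(\<lambda>k. LINT x|lborel. norm (indicator V x * (D k x - g x))) \<longlonglongrightarrow> 0"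
  proof (rule tendstoI)
    fix e :: real assume "e > 0"
    obtain \<delta> where "\<delta> > 0" and \<delta>: "\<And>t. 0 < t \<Longrightarrow> t < \<delta> \<Longrightarrow>
        (LINT x|lborel. \<bar>indicator V x * ((h (x + t *\<^sub>R b) - h x) / t - g x)\<bar>) \<le> e / 2"
      using difference_quotient_L1[of "e / 2"] \<open>e > 0\<close> by auto
    have "\<forall>\<^sub>F k in sequentially. \<tau> k < \<delta>"
      using \<tau>0 \<open>\<delta> > 0\<close> by (intro order_tendstoD(2)) auto
    then show "\<forall>\<^sub>F k in sequentially. dist (LINT x|lborel. norm (indicator V x * (D k x - g x))) 0 < e"
    proof eventually_elim
      case (elim k)
      then show ?case
        using \<delta>[OF \<tau>, of k] \<open>e > 0\<close> by (simp add: D_def)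
    qed
  qed
  obtain r where r: "strict_mono r"
    and AE_r: "AE x in lborel. (\<lambda>k. indicator V x * (D (r k) x - g x)) \<longlonglongrightarrow> 0"
    using tendsto_L1_AE_subseq[OF VD VD0] by blast
  have quotients: "(\<lambda>k. LINT x|lborel. n x * ((\<phi> x - \<phi> (x - \<tau> k *\<^sub>R b)) / \<tau> k)) \<longlonglongrightarrow> (LINT x|lborel. n x * ?d x)"
  proof (rule integral_dominated_convergence[where w = "\<lambda>x. B' * n x"])
    show "AE x in lborel. (\<lambda>k. n x * ((\<phi> x - \<phi> (x - \<tau> k *\<^sub>R b)) / \<tau> k)) \<longlonglongrightarrow> n x * ?d x"
    proof (intro AE_I2 tendsto_mult tendsto_const)
      fix x
      have "((\<lambda>s. (\<phi> (x - s *\<^sub>R b) - \<phi> x) / s) \<longlongrightarrow> - ?d x) (at 0)"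
        using test_function_line_derivative[OF \<phi>, of x b 0] by (simp add: DERIV_def)
      then have "(\<lambda>k. (\<phi> (x - \<tau> k *\<^sub>R b) - \<phi> x) / \<tau> k) \<longlonglongrightarrow> - ?d x"
        by (rule filterlim_compose) (rule \<tau>_at)
      from tendsto_minus[OF this]
      show "(\<lambda>k. (\<phi> x - \<phi> (x - \<tau> k *\<^sub>R b)) / \<tau> k) \<longlonglongrightarrow> ?d x"
        by (simp add: minus_divide_left)
    qed
    show "AE x in lborel. norm (n x * ((\<phi> x - \<phi> (x - \<tau> k *\<^sub>R b)) / \<tau> k)) \<le> B' * n x" for k
    proof (rule AE_I2)
      fix x
      obtain z where "\<phi> (x - \<tau> k *\<^sub>R b) - \<phi> (x - 0 *\<^sub>R b) = (\<tau> k - 0) * - ?d (x - z *\<^sub>R b)"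
        using MVT2[OF \<tau>[of k], of "\<lambda>s. \<phi> (x - s *\<^sub>R b)" "\<lambda>s. - ?d (x - s *\<^sub>R b)"]
          test_function_line_derivative[OF \<phi>] by metis
      then have "(\<phi> x - \<phi> (x - \<tau> k *\<^sub>R b)) / \<tau> k = ?d (x - z *\<^sub>R b)"
        using \<tau>[of k] by (simp add: field_simps)
      then show "norm (n x * ((\<phi> x - \<phi> (x - \<tau> k *\<^sub>R b)) / \<tau> k)) \<le> B' * n x"
        using mult_right_mono[OF B'(2)[of "x - z *\<^sub>R b"], of "n x"]
        by (simp add: abs_mult n_def mult.commute)
    qed
  qed (use n in auto)
  have swap: "(LINT x|lborel. n x * ((\<phi> x - \<phi> (x - \<tau> k *\<^sub>R b)) / \<tau> k)) = - (LINT x|lborel. E k x * \<phi> x)" for k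
  proof -
    have i: "integrable lborel (\<lambda>x. n x * \<phi> x)" "integrable lborel (\<lambda>x. n x * \<phi> (x - \<tau> k *\<^sub>R b))"
      "integrable lborel (\<lambda>x. n (x + \<tau> k *\<^sub>R b) * \<phi> x)"
      using B by (auto intro!: integrable_mult_bounded n integrable_translate)
    have "(LINT x|lborel. n (x + \<tau> k *\<^sub>R b) * \<phi> x) = (LINT x|lborel. n x * \<phi> (x - \<tau> k *\<^sub>R b))"
      using integral_translate[of "\<lambda>x. n x * \<phi> (x - \<tau> k *\<^sub>R b)" "\<tau> k *\<^sub>R b"] by simp
    then show ?thesis
      using i by (simp add: E_def right_diff_distrib left_diff_distrib diff_divide_distrib)
  qed
  have E_lim: "(\<lambda>k. LINT x|lborel. E (r k) x * \<phi> x) \<longlonglongrightarrow> (LINT x|lborel. G x * \<phi> x)"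
  proof (rule dominated_convergence_perturbed)
    show "integrable lborel (\<lambda>x. E (r k) x * \<phi> x)" "integrable lborel (\<lambda>x. G x * \<phi> x)" for k
      using B by (auto intro!: integrable_mult_bounded E G)
    show "integrable lborel (\<lambda>x. 2 * B * \<bar>g x\<bar>)"
      using g by auto
    show "integrable lborel (\<lambda>x. B * norm (indicator V x * (D (r k) x - g x)))" for k
      using VD by auto
    show "(\<lambda>k. LINT x|lborel. B * norm (indicator V x * (D (r k) x - g x))) \<longlonglongrightarrow> 0"
      using tendsto_mult_left[OF LIMSEQ_subseq_LIMSEQ[OF VD0 r], of B] by (simp add: o_def)
    show "AE x in lborel. (\<lambda>k. E (r k) x * \<phi> x) \<longlonglongrightarrow> G x * \<phi> x"
      using AE_r
    proof eventually_elim
      case (elim x)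
      show ?case
      proof (cases "x \<in> V")
        case True
        then have "(\<lambda>k. D (r k) x) \<longlonglongrightarrow> g x"
          using elim by (simp add: LIM_zero_iff)
        then have "(\<lambda>k. (max (- (h x + \<tau> (r k) * D (r k) x)) 0 - max (- h x) 0) / \<tau> (r k)) \<longlonglongrightarrow> G x"
          unfolding G_def using \<tau> LIMSEQ_subseq_LIMSEQ[OF \<tau>0 r]
          by (intro neg_slope_tendsto) (auto simp: o_def)
        moreover have "h x + \<tau> (r k) * D (r k) x = h (x + \<tau> (r k) *\<^sub>R b)" for k
          using \<tau>[of "r k"] by (simp add: D_def)
        ultimately show ?thesis
          by (intro tendsto_mult tendsto_const) (simp add: E_def n_def)
      next
        case False
        then have "\<phi> x = 0"
          using test_function_support(2)[OF \<phi>] test_function_eq_0 by blast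
        then show ?thesis by simp
      qed
    qed
    show "\<bar>E (r k) x * \<phi> x - G x * \<phi> x\<bar> \<le> 2 * B * \<bar>g x\<bar> + B * norm (indicator V x * (D (r k) x - g x))" for k x
    proof (cases "x \<in> V")
      case True
      have "\<bar>n (x + \<tau> (r k) *\<^sub>R b) - n x\<bar> \<le> \<bar>h (x + \<tau> (r k) *\<^sub>R b) - h x\<bar>"
        by (auto simp: n_def)
      then have "\<bar>E (r k) x\<bar> \<le> \<bar>D (r k) x\<bar>"
        using \<tau>[of "r k"] by (simp add: E_def D_def divide_right_mono)
      then have "\<bar>E (r k) x - G x\<bar> \<le> 2 * \<bar>g x\<bar> + \<bar>D (r k) x - g x\<bar>"
        using abs_neg_slope_le[of "h x" "g x"] by (simp add: G_def)
      then have "\<bar>E (r k) x - G x\<bar> * \<bar>\<phi> x\<bar> \<le> (2 * \<bar>g x\<bar> + \<bar>D (r k) x - g x\<bar>) * B"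
        using B(2) by (intro mult_mono) auto
      moreover have "\<bar>E (r k) x * \<phi> x - G x * \<phi> x\<bar> = \<bar>E (r k) x - G x\<bar> * \<bar>\<phi> x\<bar>"
        by (simp flip: left_diff_distrib abs_mult)
      ultimately show ?thesis
        using True by (simp add: algebra_simps)
    next
      case False
      then have "\<phi> x = 0"
        using test_function_support(2)[OF \<phi>] test_function_eq_0 by blast
      then show ?thesis using B(1) by simp
    qed
  qed (use B(1) in auto)
  have "(\<lambda>k. - (LINT x|lborel. E (r k) x * \<phi> x)) \<longlonglongrightarrow> (LINT x|lborel. n x * ?d x)"
    using LIMSEQ_subseq_LIMSEQ[OF quotients r] unfolding swap o_def .
  from LIMSEQ_unique[OF this tendsto_minus[OF E_lim]] show ?thesis
    by (simp add: n_def G_def)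
qed

end

section \<open>Seminormed function spaces\<close>

locale function_space =
  fixes X :: "('x \<Rightarrow> real) set"
  assumes zero_mem: "(\<lambda>_. 0) \<in> X"
    and add_mem: "v \<in> X \<Longrightarrow> w \<in> X \<Longrightarrow> (\<lambda>x. v x + w x) \<in> X"
    and scale_mem: "v \<in> X \<Longrightarrow> (\<lambda>x. c * v x) \<in> X"
begin

lemma diff_mem: "v \<in> X \<Longrightarrow> w \<in> X \<Longrightarrow> (\<lambda>x. v x - w x) \<in> X"
  using add_mem[OF _ scale_mem[of w "-1"], of v] by simp

lemma sum_mem: "finite I \<Longrightarrow> (\<And>i. i \<in> I \<Longrightarrow> f i \<in> X) \<Longrightarrow> (\<lambda>x. \<Sum>i\<in>I. f i x) \<in> X"
  by (induction I rule: finite_induct) (auto intro: add_mem zero_mem)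

end

locale function_seminorm = function_space X
  for X :: "('x \<Rightarrow> real) set" +
  fixes N :: "('x \<Rightarrow> real) \<Rightarrow> real"
  assumes norm_add: "v \<in> X \<Longrightarrow> w \<in> X \<Longrightarrow> N (\<lambda>x. v x + w x) \<le> N v + N w"
    and norm_scale: "v \<in> X \<Longrightarrow> N (\<lambda>x. c * v x) = \<bar>c\<bar> * N v"
begin

lemma norm_minus: "v \<in> X \<Longrightarrow> N (\<lambda>x. - v x) = N v"
  using norm_scale[of v "-1"] by simp

lemma norm_diff_commute: "v \<in> X \<Longrightarrow> w \<in> X \<Longrightarrow> N (\<lambda>x. v x - w x) = N (\<lambda>x. w x - v x)"
  using norm_minus[OF diff_mem[of w v]] by simp

lemma norm_diff: "v \<in> X \<Longrightarrow> w \<in> X \<Longrightarrow> N (\<lambda>x. v x - w x) \<le> N v + N w"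
  using norm_add[OF _ scale_mem[of w "-1"], of v] norm_minus[of w] by simp

lemma norm_zero: "N (\<lambda>_. 0) = 0"
  using norm_scale[OF zero_mem, of 0] by simp

lemma norm_nonneg: "v \<in> X \<Longrightarrow> 0 \<le> N v"
  using norm_diff[of v v] norm_zero by simp

lemma norm_diff_triangle:
  assumes "u \<in> X" "v \<in> X" "w \<in> X"
  shows "N (\<lambda>x. u x - w x) \<le> N (\<lambda>x. u x - v x) + N (\<lambda>x. v x - w x)"
  using norm_add[OF diff_mem[of u v] diff_mem[of v w]] assms by simp

lemma norm_diff_bound:
  assumes "v \<in> X" "w \<in> X"
  shows "\<bar>N v - N w\<bar> \<le> N (\<lambda>x. v x - w x)"
  using norm_add[OF diff_mem[OF assms] assms(2)] norm_add[OF diff_mem[OF assms(2,1)] assms(1)]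
    norm_diff_commute[OF assms] by simp

lemma norm_sum_le:
  "finite I \<Longrightarrow> (\<And>i. i \<in> I \<Longrightarrow> f i \<in> X) \<Longrightarrow> N (\<lambda>x. \<Sum>i\<in>I. f i x) \<le> (\<Sum>i\<in>I. N (f i))"
proof (induction I rule: finite_induct)
  case (insert i I)
  then show ?case
    using norm_add[of "f i" "\<lambda>x. \<Sum>i\<in>I. f i x"] sum_mem[of I f] by auto
qed (simp add: norm_zero)

end

locale function_semi_inner = function_space X
  for X :: "('x \<Rightarrow> real) set" +
  fixes B :: "('x \<Rightarrow> real) \<Rightarrow> ('x \<Rightarrow> real) \<Rightarrow> real"
  assumes inner_add_left: "u \<in> X \<Longrightarrow> v \<in> X \<Longrightarrow> w \<in> X \<Longrightarrow> B (\<lambda>x. u x + v x) w = B u w + B v w"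
    and inner_scale_left: "v \<in> X \<Longrightarrow> w \<in> X \<Longrightarrow> B (\<lambda>x. c * v x) w = c * B v w"
    and inner_commute: "B v w = B w v"
    and inner_nonneg: "v \<in> X \<Longrightarrow> 0 \<le> B v v"
begin

lemma inner_add_self:
  assumes "v \<in> X" "w \<in> X"
  shows "B (\<lambda>x. v x + c * w x) (\<lambda>x. v x + c * w x) = B v v + 2 * c * B v w + c\<^sup>2 * B w w"
proof -
  let ?z = "\<lambda>x. v x + c * w x"
  have z: "?z \<in> X" and cw: "(\<lambda>x. c * w x) \<in> X"
    using assms by (auto intro: add_mem scale_mem)
  have "B ?z ?z = B v ?z + c * B w ?z"
    using inner_add_left[OF assms(1) cw z] inner_scale_left[OF assms(2) z] by simp
  also have "B v ?z = B v v + c * B v w"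
    using inner_add_left[OF assms(1) cw assms(1)] inner_scale_left[OF assms(2,1)] inner_commute by metis
  also have "B w ?z = B v w + c * B w w"
    using inner_add_left[OF assms(1) cw assms(2)] inner_scale_left[OF assms(2,2)] inner_commute by metis
  finally show ?thesis
    by (simp add: algebra_simps power2_eq_square)
qed

lemma Cauchy_Schwarz_squared:
  assumes "v \<in> X" "w \<in> X"
  shows "(B v w)\<^sup>2 \<le> B v v * B w w"
proof -
  have nn: "0 \<le> B v v + 2 * c * B v w + c\<^sup>2 * B w w" for c
    using inner_nonneg[OF add_mem[OF assms(1) scale_mem[OF assms(2)]]] inner_add_self[OF assms] by metis
  show ?thesis
  proof (cases "B w w = 0")
    case True
    have "B v w = 0"
    proof (rule ccontr)
      assume "B v w \<noteq> 0"
      then show False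
        using nn[of "- (B v v + 1) / (2 * B v w)"] True by (simp add: field_simps)
    qed
    then show ?thesis using True by simp
  next
    case False
    then have pos: "B w w > 0"
      using inner_nonneg[OF assms(2)] by simp
    have "0 \<le> B w w * (B v v + 2 * (- B v w / B w w) * B v w + (- B v w / B w w)\<^sup>2 * B w w)"
      using nn[of "- B v w / B w w"] pos by (intro mult_nonneg_nonneg) (simp_all only: less_imp_le)
    also have "\<dots> = B v v * B w w - (B v w)\<^sup>2"
      using pos by (simp add: field_simps power2_eq_square)
    finally show ?thesis by simp
  qed
qed

lemma Cauchy_Schwarz:
  assumes "v \<in> X" "w \<in> X"
  shows "\<bar>B v w\<bar> \<le> sqrt (B v v) * sqrt (B w w)"
  using real_sqrt_le_mono[OF Cauchy_Schwarz_squared[OF assms]] by (simp add: real_sqrt_mult)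

sublocale function_seminorm X "\<lambda>v. sqrt (B v v)"
proof
  fix v w assume vw: "v \<in> X" "w \<in> X"
  have "B (\<lambda>x. v x + w x) (\<lambda>x. v x + w x) = B v v + 2 * B v w + B w w"
    using inner_add_self[OF vw, of 1] by simp
  also have "\<dots> \<le> (sqrt (B v v) + sqrt (B w w))\<^sup>2"
    using Cauchy_Schwarz[OF vw] inner_nonneg vw by (simp add: power2_sum)
  finally show "sqrt (B (\<lambda>x. v x + w x) (\<lambda>x. v x + w x)) \<le> sqrt (B v v) + sqrt (B w w)"
    using inner_nonneg vw by (intro real_le_lsqrt) (auto intro: add_mem)
next
  fix v c assume v: "v \<in> X"
  have "B (\<lambda>x. c * v x) (\<lambda>x. c * v x) = c\<^sup>2 * B v v"
    using inner_scale_left[OF v scale_mem[OF v]] inner_scale_left[OF v v] inner_commute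
    by (metis (no_types, lifting) mult.assoc power2_eq_square)
  then show "sqrt (B (\<lambda>x. c * v x) (\<lambda>x. c * v x)) = \<bar>c\<bar> * sqrt (B v v)"
    by (simp add: real_sqrt_mult)
qed

lemma seminorm: "function_seminorm X (\<lambda>v. sqrt (B v v))"
  by (rule function_seminorm_axioms)

end

section \<open>The spaces \<open>L\<^sup>2\<close> and \<open>H\<^sup>1\<close>\<close>

lemma L2_measurable: "h \<in> L2 \<Omega> \<Longrightarrow> h \<in> borel_measurable (lebesgue_on \<Omega>)"
  by (simp add: L2_def)

lemma L2_I:
  assumes "h \<in> borel_measurable (lebesgue_on \<Omega>)" "integrable (lebesgue_on \<Omega>) k" "\<And>x. (h x)\<^sup>2 \<le> k x"
  shows "h \<in> L2 \<Omega>"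
proof -
  have "integrable (lebesgue_on \<Omega>) (\<lambda>x. (h x)\<^sup>2)"
    by (rule Bochner_Integration.integrable_bound[OF assms(2)])
      (use assms order_trans[OF zero_le_power2 assms(3)] in auto)
  then show ?thesis
    using assms by (simp add: L2_def)
qed

lemma L2_product_integrable:
  assumes "g \<in> L2 \<Omega>" "h \<in> L2 \<Omega>"
  shows "integrable (lebesgue_on \<Omega>) (\<lambda>x. g x * h x)"
proof (rule Bochner_Integration.integrable_bound)
  show "integrable (lebesgue_on \<Omega>) (\<lambda>x. (g x)\<^sup>2 + (h x)\<^sup>2)"
    using assms by (auto simp: L2_def)
  have "\<bar>a * b\<bar> \<le> a\<^sup>2 + b\<^sup>2" for a b :: real
    using sum_squares_bound[of "\<bar>a\<bar>" "\<bar>b\<bar>"] mult_nonneg_nonneg[of "\<bar>a\<bar>" "\<bar>b\<bar>"]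
    unfolding abs_mult power2_abs by linarith
  then show "AE x in lebesgue_on \<Omega>. norm (g x * h x) \<le> norm ((g x)\<^sup>2 + (h x)\<^sup>2)"
    by (auto intro!: AE_I2)
qed (use assms in \<open>auto simp: L2_def\<close>)

lemma L2_add: assumes "g \<in> L2 \<Omega>" "h \<in> L2 \<Omega>" shows "(\<lambda>x. g x + h x) \<in> L2 \<Omega>"
proof (rule L2_I)
  show "integrable (lebesgue_on \<Omega>) (\<lambda>x. (g x)\<^sup>2 + 2 * (g x * h x) + (h x)\<^sup>2)"
    using assms L2_product_integrable[OF assms] by (auto simp: L2_def)
qed (use assms in \<open>auto simp: L2_def power2_sum\<close>)

lemma L2_scale: "h \<in> L2 \<Omega> \<Longrightarrow> (\<lambda>x. c * h x) \<in> L2 \<Omega>"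
  by (auto simp: L2_def power_mult_distrib)

lemma L2_zero: "(\<lambda>_. 0) \<in> L2 \<Omega>"
  by (simp add: L2_def)

lemma L2_diff: "g \<in> L2 \<Omega> \<Longrightarrow> h \<in> L2 \<Omega> \<Longrightarrow> (\<lambda>x. g x - h x) \<in> L2 \<Omega>"
  using L2_add[OF _ L2_scale[of h \<Omega> "-1"], of g] by simp

lemma L2_neg: "h \<in> L2 \<Omega> \<Longrightarrow> (\<lambda>x. max (- h x) 0) \<in> L2 \<Omega>"
  by (rule L2_I[where k = "\<lambda>x. (h x)\<^sup>2"]) (auto simp: L2_def max_def)

interpretation L2: function_semi_inner "L2 \<Omega>" "L2_inner \<Omega>" for \<Omega>
proof
  fix u v w assume "u \<in> L2 \<Omega>" "v \<in> L2 \<Omega>" "w \<in> L2 \<Omega>"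
  then show "L2_inner \<Omega> (\<lambda>x. u x + v x) w = L2_inner \<Omega> u w + L2_inner \<Omega> v w"
    by (simp add: L2_inner_def distrib_right L2_product_integrable)
qed (auto intro: L2_add L2_scale L2_zero simp: L2_inner_def mult.commute mult.left_commute)

interpretation L2N: function_seminorm "L2 \<Omega>" "L2_norm \<Omega>" for \<Omega>
  using L2.seminorm[of \<Omega>] by (simp add: L2_norm_def[abs_def])

lemma L2_inner_cong_AE:
  assumes "g \<in> L2 \<Omega>" "g' \<in> L2 \<Omega>" "h \<in> L2 \<Omega>" "AE x in lebesgue_on \<Omega>. g x = g' x"
  shows "L2_inner \<Omega> g h = L2_inner \<Omega> g' h"
  unfolding L2_inner_def
  using assms by (intro integral_cong_AE) (auto dest!: L2_measurable)

lemma L2_norm_nonneg: "0 \<le> L2_norm \<Omega> h"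
  by (simp add: L2_norm_def L2_inner_def)

lemma L2_norm_squared: "(L2_norm \<Omega> h)\<^sup>2 = (LINT x|lebesgue_on \<Omega>. (h x)\<^sup>2)"
  by (simp add: L2_norm_def L2_inner_def power2_eq_square)

lemma L2_norm_eq_0_AE:
  assumes "h \<in> L2 \<Omega>" "L2_norm \<Omega> h = 0"
  shows "AE x in lebesgue_on \<Omega>. h x = 0"
proof -
  have "(LINT x|lebesgue_on \<Omega>. (h x)\<^sup>2) = 0"
    using L2_norm_squared[of \<Omega> h] assms by simp
  then have "AE x in lebesgue_on \<Omega>. (h x)\<^sup>2 = 0"
    using assms by (subst (asm) integral_nonneg_eq_0_iff_AE) (auto simp: L2_def)
  then show ?thesis by simp
qed

lemma L2_norm_mono:
  assumes "g \<in> L2 \<Omega>" "h \<in> L2 \<Omega>" "\<And>x. \<bar>g x\<bar> \<le> \<bar>h x\<bar>"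
  shows "L2_norm \<Omega> g \<le> L2_norm \<Omega> h"
proof -
  have "(L2_norm \<Omega> g)\<^sup>2 \<le> (L2_norm \<Omega> h)\<^sup>2"
    unfolding L2_norm_squared
    using assms by (intro integral_mono) (auto simp: L2_def abs_le_square_iff)
  then show ?thesis
    using L2_norm_nonneg by (rule power2_le_imp_le)
qed

lemma continuous_compact_support_L2:
  fixes f :: "'a::euclidean_space \<Rightarrow> real"
  assumes "continuous_on UNIV f" "compact K" "\<And>x. x \<notin> K \<Longrightarrow> f x = 0" "\<Omega> \<in> sets lebesgue"
  shows "f \<in> L2 \<Omega>"
proof -
  obtain B where B: "B > 0" "\<And>x. \<bar>f x\<bar> \<le> B"
    using continuous_compact_support_bounded[OF assms(1,2)] assms(3) by metis
  show ?thesis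
  proof (rule L2_I)
    show "f \<in> borel_measurable (lebesgue_on \<Omega>)"
      by (rule continuous_imp_measurable_lebesgue_on[OF assms(1)])
    have "K \<in> lmeasurable"
      using assms(2) by (rule lmeasurable_compact)
    then have "integrable lebesgue (\<lambda>x. B\<^sup>2 * indicator (\<Omega> \<inter> K) x)"
      using assms(4) by (intro integrable_mult_right integrable_real_indicator)
        (auto simp: fmeasurable_def Int_commute emeasure_mono intro!: le_less_trans[OF emeasure_mono, of _ K])
    then show "integrable (lebesgue_on \<Omega>) (\<lambda>x. B\<^sup>2 * indicator K x)"
      using assms(4) unfolding integrable_restrict_space[of _ lebesgue] real_scaleR_def
      by (subst integrable_restrict_space) (simp_all add: indicator_inter_arith mult.left_commute del: integrable_mult_right_iff)
    show "(f x)\<^sup>2 \<le> B\<^sup>2 * indicator K x" for x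
      using B assms(3)[of x] by (auto simp: indicator_def abs_le_square_iff[symmetric])
  qed
qed

lemma test_function_L2:
  assumes "\<phi> \<in> test_functions V" "\<Omega> \<in> sets lebesgue"
  shows "\<phi> \<in> L2 \<Omega>" "b \<in> Basis \<Longrightarrow> (\<lambda>x. frechet_derivative \<phi> (at x) b) \<in> L2 \<Omega>"
proof -
  have K: "compact (closure {x. \<phi> x \<noteq> 0})"
    using assms(1) by (rule test_function_support)
  show "\<phi> \<in> L2 \<Omega>"
    using continuous_compact_support_L2[OF test_function_continuous[OF assms(1)] K _ assms(2)]
      test_function_eq_0[of _ \<phi>] by blast
  show "(\<lambda>x. frechet_derivative \<phi> (at x) b) \<in> L2 \<Omega>" if "b \<in> Basis"
    using continuous_compact_support_L2[OF test_function_derivative_continuous[OF assms(1) that] K _ assms(2)]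
      test_function_derivative_eq_0[of _ \<phi>] by metis
qed

lemma integral_lebesgue_on_eq_lborel:
  fixes f f' \<psi> :: "'a::euclidean_space \<Rightarrow> real"
  assumes \<Omega>: "\<Omega> \<in> sets lebesgue" and f: "f \<in> borel_measurable (lebesgue_on \<Omega>)"
    and [measurable]: "f' \<in> borel_measurable borel" "\<psi> \<in> borel_measurable borel"
    and eq: "AE x in lborel. f' x = indicator V x * f x"
    and "V \<subseteq> \<Omega>" "\<And>x. x \<notin> V \<Longrightarrow> \<psi> x = 0"
  shows "(LINT x|lebesgue_on \<Omega>. f x * \<psi> x) = (LINT x|lborel. f' x * \<psi> x)"
proof -
  have [measurable]: "(\<lambda>x. indicator \<Omega> x * f x) \<in> borel_measurable lebesgue"
    using f \<Omega> by (simp add: borel_measurable_restrict_space_iff)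
  have [measurable]: "\<psi> \<in> borel_measurable lebesgue" "f' \<in> borel_measurable lebesgue"
    by (simp_all add: measurable_completion)
  have "(LINT x|lebesgue_on \<Omega>. f x * \<psi> x) = (LINT x|lebesgue. (indicator \<Omega> x * f x) * \<psi> x)"
    using \<Omega> by (simp add: integral_restrict_space mult.assoc)
  also have "\<dots> = (LINT x|lebesgue. f' x * \<psi> x)"
  proof (rule integral_cong_AE)
    show "AE x in lebesgue. indicator \<Omega> x * f x * \<psi> x = f' x * \<psi> x"
      using AE_completion[OF eq]
    proof eventually_elim
      case (elim x)
      then show ?case using assms(6) assms(7)[of x] by (cases "x \<in> V") auto
    qed
  qed measurable
  also have "\<dots> = (LINT x|lborel. f' x * \<psi> x)"
    by (rule integral_completion) measurable
  finally show ?thesis .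
qed

lemma L2_local_borel_version:
  fixes f :: "'a::euclidean_space \<Rightarrow> real"
  assumes f: "f \<in> L2 \<Omega>" and \<Omega>: "\<Omega> \<in> sets lebesgue" and V: "open V" "bounded V" "V \<subseteq> \<Omega>"
  obtains f' where "integrable lborel f'" "AE x in lborel. f' x = indicator V x * f x"
proof -
  have Vs: "V \<in> sets lebesgue" "V \<in> lmeasurable"
    using V by (auto intro: lmeasurable_open)
  have fm: "f \<in> borel_measurable (lebesgue_on V)"
    using measurable_restrict_mono[OF L2_measurable[OF f] V(3)] .
  then have g: "(\<lambda>x. indicator V x * f x) \<in> borel_measurable lebesgue"
    using Vs by (simp add: borel_measurable_restrict_space_iff)
  have bound: "integrable lebesgue (\<lambda>x. indicator V x + indicator \<Omega> x * (f x)\<^sup>2)"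
    using Vs f \<Omega> by (auto simp: L2_def integrable_restrict_space fmeasurable_def)
  have "integrable lebesgue (\<lambda>x. indicator V x * f x)"
  proof (rule Bochner_Integration.integrable_bound[OF bound g])
    have "\<bar>a\<bar> \<le> 1 + a\<^sup>2" for a :: real
      using zero_le_power2[of "\<bar>a\<bar> - 1"] by (simp add: power2_diff)
    then show "AE x in lebesgue. norm (indicator V x * f x) \<le> norm (indicator V x + indicator \<Omega> x * (f x)\<^sup>2)"
      using V(3) by (auto simp: indicator_def intro!: AE_I2)
  qed
  moreover obtain f' where f': "f' \<in> borel_measurable lborel" "AE x in lborel. indicator V x * f x = f' x"
    using completion_ex_borel_measurable_real[OF g] by blast
  ultimately have "integrable lebesgue f'"
    using AE_completion[OF f'(2)] g measurable_completion[OF f'(1)]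
    by (subst integrable_cong_AE[symmetric]) auto
  then have "integrable lborel f'"
    using integrable_completion[OF f'(1)] by simp
  then show ?thesis
    using that f'(2) by (auto simp: eq_commute)
qed

lemma AE_lebesgue_on_iff:
  "\<Omega> \<in> sets lebesgue \<Longrightarrow> (AE x in lebesgue_on \<Omega>. P x) \<longleftrightarrow> (AE x in lborel. x \<in> \<Omega> \<longrightarrow> P x)"
  by (simp add: AE_restrict_space_iff AE_completion_iff)

lemma has_weak_grad_components:
  "has_weak_grad \<Omega> h g \<Longrightarrow> b \<in> Basis \<Longrightarrow> (\<lambda>x. g x \<bullet> b) \<in> L2 \<Omega>"
  by (simp add: has_weak_grad_def)

lemma has_weak_grad_integral:
  "has_weak_grad \<Omega> h g \<Longrightarrow> b \<in> Basis \<Longrightarrow> \<phi> \<in> test_functions \<Omega> \<Longrightarrow>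
    (LINT x|lebesgue_on \<Omega>. h x * frechet_derivative \<phi> (at x) b) = - (LINT x|lebesgue_on \<Omega>. (g x \<bullet> b) * \<phi> x)"
  by (simp add: has_weak_grad_def)

lemma has_weak_grad_unique:
  fixes \<Omega> :: "'a::euclidean_space set"
  assumes g: "has_weak_grad \<Omega> h g" and k: "has_weak_grad \<Omega> h k" and "open \<Omega>"
  shows "AE x in lebesgue_on \<Omega>. g x = k x"
proof -
  have \<Omega>: "\<Omega> \<in> sets lebesgue"
    using \<open>open \<Omega>\<close> by auto
  have comp: "AE x in lborel. x \<in> \<Omega> \<longrightarrow> g x \<bullet> b - k x \<bullet> b = 0" if b: "b \<in> Basis" for b
  proof -
    let ?f = "\<lambda>x. g x \<bullet> b - k x \<bullet> b"
    note comps = has_weak_grad_components[OF g b] has_weak_grad_components[OF k b]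
    have f: "?f \<in> L2 \<Omega>"
      by (intro L2_diff comps)
    have "AE x in lborel. x \<in> \<Omega> \<inter> ball 0 (real n) \<longrightarrow> ?f x = 0" for n
    proof -
      let ?V = "\<Omega> \<inter> ball 0 (real n)"
      have V: "open ?V" "bounded ?V" "?V \<subseteq> \<Omega>"
        using \<open>open \<Omega>\<close> by (auto intro: bounded_subset[OF bounded_ball])
      obtain f' where f': "integrable lborel f'" "AE x in lborel. f' x = indicator ?V x * ?f x"
        using L2_local_borel_version[OF f \<Omega> V] .
      have "(LINT x|lborel. f' x * \<phi> x) = 0" if \<phi>: "\<phi> \<in> test_functions ?V" for \<phi>
      proof -
        have \<phi>': "\<phi> \<in> test_functions \<Omega>"
          using \<phi> test_functions_mono[OF V(3)] by auto
        have "(LINT x|lborel. f' x * \<phi> x) = (LINT x|lebesgue_on \<Omega>. ?f x * \<phi> x)"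
        proof (rule integral_lebesgue_on_eq_lborel[symmetric, OF \<Omega> L2_measurable[OF f] _ _ f'(2) V(3)])
          show "\<phi> x = 0" if "x \<notin> ?V" for x
            using \<phi> that test_function_eq_0[of x \<phi>] unfolding test_functions_def by blast
        qed (use f' test_function_continuous[OF \<phi>] in \<open>auto intro: borel_measurable_continuous_onI\<close>)
        also have "\<dots> = (LINT x|lebesgue_on \<Omega>. (g x \<bullet> b) * \<phi> x) - (LINT x|lebesgue_on \<Omega>. (k x \<bullet> b) * \<phi> x)"
          using comps test_function_L2(1)[OF \<phi> \<Omega>]
          by (simp add: left_diff_distrib L2_product_integrable)
        also have "\<dots> = 0"
          using has_weak_grad_integral[OF g b \<phi>'] has_weak_grad_integral[OF k b \<phi>'] by simp
        finally show ?thesis .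
      qed
      then have "AE x in lborel. x \<in> ?V \<longrightarrow> f' x = 0"
        using f' V by (intro fundamental_lemma_calculus_of_variations) auto
      then show ?thesis
        using f'(2) by eventually_elim auto
    qed
    then have "AE x in lborel. \<forall>n. x \<in> \<Omega> \<inter> ball 0 (real n) \<longrightarrow> ?f x = 0"
      unfolding AE_all_countable by blast
    then show ?thesis
    proof eventually_elim
      case (elim x)
      obtain n where "norm x < real n"
        using reals_Archimedean2 by blast
      then show ?case using elim by auto
    qed
  qed
  have "AE x in lborel. \<forall>b\<in>Basis. x \<in> \<Omega> \<longrightarrow> g x \<bullet> b - k x \<bullet> b = 0"
    using comp by (subst AE_ball_countable) (simp_all add: countable_finite)
  then have "AE x in lborel. x \<in> \<Omega> \<longrightarrow> g x = k x"
    by eventually_elim (auto intro: euclidean_eqI)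
  then show ?thesis
    using \<Omega> by (simp add: AE_lebesgue_on_iff)
qed

lemma has_weak_grad_inner_integrable:
  assumes "has_weak_grad \<Omega> h g" "has_weak_grad \<Omega> k l"
  shows "integrable (lebesgue_on \<Omega>) (\<lambda>x. g x \<bullet> l x)"
proof -
  have "(\<lambda>x. g x \<bullet> l x) = (\<lambda>x. \<Sum>b\<in>Basis. (g x \<bullet> b) * (l x \<bullet> b))"
    by (intro ext euclidean_inner)
  then show ?thesis
    using assms
    by (auto intro!: Bochner_Integration.integrable_sum L2_product_integrable has_weak_grad_components)
qed

lemma H1_has_weak_grad: "h \<in> H1 \<Omega> \<Longrightarrow> has_weak_grad \<Omega> h (weak_grad \<Omega> h)"
  unfolding H1_def weak_grad_def by (simp add: someI_ex)

lemma H1_L2: "h \<in> H1 \<Omega> \<Longrightarrow> h \<in> L2 \<Omega>"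
  by (simp add: H1_def)

lemma H1_I: "h \<in> L2 \<Omega> \<Longrightarrow> has_weak_grad \<Omega> h g \<Longrightarrow> h \<in> H1 \<Omega>"
  by (auto simp: H1_def)

lemma grad_inner_eq:
  assumes "has_weak_grad \<Omega> h g" "has_weak_grad \<Omega> k l" "h \<in> L2 \<Omega>" "k \<in> L2 \<Omega>" "open \<Omega>"
  shows "grad_inner \<Omega> h k = (LINT x|lebesgue_on \<Omega>. g x \<bullet> l x)"
proof -
  have H: "has_weak_grad \<Omega> h (weak_grad \<Omega> h)" "has_weak_grad \<Omega> k (weak_grad \<Omega> k)"
    using assms by (auto intro!: H1_has_weak_grad H1_I)
  show ?thesis
    unfolding grad_inner_def
  proof (rule integral_cong_AE)
    show "AE x in lebesgue_on \<Omega>. weak_grad \<Omega> h x \<bullet> weak_grad \<Omega> k x = g x \<bullet> l x"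
      using has_weak_grad_unique[OF H(1) assms(1,5)] has_weak_grad_unique[OF H(2) assms(2,5)]
      by eventually_elim simp
  qed (use has_weak_grad_inner_integrable H assms in blast)+
qed

lemma has_weak_grad_add:
  assumes "has_weak_grad \<Omega> h g" "has_weak_grad \<Omega> k l" "h \<in> L2 \<Omega>" "k \<in> L2 \<Omega>" "\<Omega> \<in> sets lebesgue"
  shows "has_weak_grad \<Omega> (\<lambda>x. h x + k x) (\<lambda>x. g x + l x)"
  unfolding has_weak_grad_def
proof (intro ballI conjI)
  fix b :: 'a assume b: "b \<in> Basis"
  note comps = has_weak_grad_components[OF assms(1) b] has_weak_grad_components[OF assms(2) b]
  show "(\<lambda>x. (g x + l x) \<bullet> b) \<in> L2 \<Omega>"
    using L2_add[OF comps] by (simp add: inner_add_left)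
  fix \<phi> assume \<phi>: "\<phi> \<in> test_functions \<Omega>"
  show "(LINT x|lebesgue_on \<Omega>. (h x + k x) * frechet_derivative \<phi> (at x) b) =
      - (LINT x|lebesgue_on \<Omega>. ((g x + l x) \<bullet> b) * \<phi> x)"
    using has_weak_grad_integral[OF assms(1) b \<phi>] has_weak_grad_integral[OF assms(2) b \<phi>]
      comps assms(3,4) test_function_L2[OF \<phi> assms(5)] b
    by (simp add: inner_add_left distrib_right L2_product_integrable)
qed

lemma has_weak_grad_scale:
  assumes "has_weak_grad \<Omega> h g"
  shows "has_weak_grad \<Omega> (\<lambda>x. c * h x) (\<lambda>x. c *\<^sub>R g x)"
  using assms unfolding has_weak_grad_def by (simp add: L2_scale mult.assoc)

lemma H1_zero: "(\<lambda>_. 0) \<in> H1 \<Omega>"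
  by (rule H1_I[where g = "\<lambda>_. 0"]) (auto simp: has_weak_grad_def L2_zero)

lemma H1_add: "h \<in> H1 \<Omega> \<Longrightarrow> k \<in> H1 \<Omega> \<Longrightarrow> open \<Omega> \<Longrightarrow> (\<lambda>x. h x + k x) \<in> H1 \<Omega>"
  by (rule H1_I[OF L2_add has_weak_grad_add]) (auto intro: H1_L2 H1_has_weak_grad)

lemma H1_scale: "h \<in> H1 \<Omega> \<Longrightarrow> (\<lambda>x. c * h x) \<in> H1 \<Omega>"
  by (rule H1_I[OF L2_scale has_weak_grad_scale]) (auto intro: H1_L2 H1_has_weak_grad)

lemma grad_inner_add_left:
  assumes "u \<in> H1 \<Omega>" "v \<in> H1 \<Omega>" "w \<in> H1 \<Omega>" "open \<Omega>"
  shows "grad_inner \<Omega> (\<lambda>x. u x + v x) w = grad_inner \<Omega> u w + grad_inner \<Omega> v w"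
proof -
  note H = assms(1-3)[THEN H1_has_weak_grad] and L = assms(1-3)[THEN H1_L2]
  have "has_weak_grad \<Omega> (\<lambda>x. u x + v x) (\<lambda>x. weak_grad \<Omega> u x + weak_grad \<Omega> v x)"
    using H L assms(4) by (intro has_weak_grad_add) auto
  from grad_inner_eq[OF this H(3) L2_add[OF L(1,2)] L(3) assms(4)] show ?thesis
    using has_weak_grad_inner_integrable[OF H(1,3)] has_weak_grad_inner_integrable[OF H(2,3)]
    by (simp add: inner_add_left grad_inner_def)
qed

lemma grad_inner_scale_left:
  assumes "v \<in> H1 \<Omega>" "w \<in> H1 \<Omega>" "open \<Omega>"
  shows "grad_inner \<Omega> (\<lambda>x. c * v x) w = c * grad_inner \<Omega> v w"
  using grad_inner_eq[OF has_weak_grad_scale[OF H1_has_weak_grad[OF assms(1)]] H1_has_weak_grad[OF assms(2)]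
      L2_scale[OF H1_L2[OF assms(1)]] H1_L2[OF assms(2)] assms(3), of c]
  by (simp add: grad_inner_def)

lemma grad_inner_commute: "grad_inner \<Omega> v w = grad_inner \<Omega> w v"
  by (simp add: grad_inner_def inner_commute)

lemma grad_inner_nonneg: "0 \<le> grad_inner \<Omega> v v"
  by (simp add: grad_inner_def)

lemma grad_semi_inner: "open \<Omega> \<Longrightarrow> function_semi_inner (H1 \<Omega>) (grad_inner \<Omega>)"
  by unfold_locales
    (auto intro: H1_zero H1_add H1_scale grad_inner_add_left grad_inner_scale_left grad_inner_commute
      grad_inner_nonneg)

definition H1_inner :: "'a::euclidean_space set \<Rightarrow> ('a \<Rightarrow> real) \<Rightarrow> ('a \<Rightarrow> real) \<Rightarrow> real" where
  "H1_inner \<Omega> v w = L2_inner \<Omega> v w + grad_inner \<Omega> v w"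

lemma H1_semi_inner:
  assumes "open \<Omega>"
  shows "function_semi_inner (H1 \<Omega>) (H1_inner \<Omega>)"
proof -
  interpret G: function_semi_inner "H1 \<Omega>" "grad_inner \<Omega>"
    using assms by (rule grad_semi_inner)
  show ?thesis
  proof
    show "H1_inner \<Omega> v w = H1_inner \<Omega> w v" for v w
      by (simp only: H1_inner_def G.inner_commute[of v w] L2.inner_commute[of _ v w])
    show "0 \<le> H1_inner \<Omega> v v" for v
      by (simp add: H1_inner_def grad_inner_nonneg L2_inner_def)
  qed (simp_all add: H1_inner_def G.inner_add_left G.inner_scale_left L2.inner_add_left
      L2.inner_scale_left H1_L2 distrib_left)
qed

lemma H1_norm_eq: "H1_norm \<Omega> = (\<lambda>v. sqrt (H1_inner \<Omega> v v))"
  by (simp add: H1_norm_def[abs_def] H1_inner_def)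

lemma H1_seminorm: "open \<Omega> \<Longrightarrow> function_seminorm (H1 \<Omega>) (H1_norm \<Omega>)"
  unfolding H1_norm_eq by (rule function_semi_inner.seminorm[OF H1_semi_inner])

lemma L2_norm_le_H1_norm: "L2_norm \<Omega> v \<le> H1_norm \<Omega> v"
  by (simp add: L2_norm_def H1_norm_def grad_inner_nonneg)

lemma grad_norm_le_H1_norm: "sqrt (grad_inner \<Omega> v v) \<le> H1_norm \<Omega> v"
  by (simp add: H1_norm_def L2_inner_def)

lemma has_weak_grad_negative_part:
  fixes \<Omega> :: "'a::euclidean_space set"
  assumes H: "has_weak_grad \<Omega> h g" and h: "h \<in> L2 \<Omega>" and "open \<Omega>"
  shows "has_weak_grad \<Omega> (\<lambda>x. max (- h x) 0) (\<lambda>x. \<Sum>b\<in>Basis. neg_slope (h x) (g x \<bullet> b) *\<^sub>R b)"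
  unfolding has_weak_grad_def
proof (intro ballI conjI)
  fix b :: 'a assume b: "b \<in> Basis"
  have comp: "(\<Sum>i\<in>Basis. neg_slope (h x) (g x \<bullet> i) *\<^sub>R i) \<bullet> b = neg_slope (h x) (g x \<bullet> b)" for x
    using b by simp
  have \<Omega>: "\<Omega> \<in> sets lebesgue"
    using \<open>open \<Omega>\<close> by auto
  note gb = has_weak_grad_components[OF H b]
  have [measurable]: "h \<in> borel_measurable (lebesgue_on \<Omega>)" "(\<lambda>x. g x \<bullet> b) \<in> borel_measurable (lebesgue_on \<Omega>)"
    using gb h by (auto dest: L2_measurable)
  have slope_L2: "(\<lambda>x. neg_slope (h x) (g x \<bullet> b)) \<in> L2 \<Omega>"
  proof (rule L2_I)
    show "(\<lambda>x. neg_slope (h x) (g x \<bullet> b)) \<in> borel_measurable (lebesgue_on \<Omega>)"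
      by measurable
    show "integrable (lebesgue_on \<Omega>) (\<lambda>x. (g x \<bullet> b)\<^sup>2)"
      using gb by (simp add: L2_def)
    show "(neg_slope (h x) (g x \<bullet> b))\<^sup>2 \<le> (g x \<bullet> b)\<^sup>2" for x
      using abs_neg_slope_le by (simp flip: abs_le_square_iff)
  qed
  then show "(\<lambda>x. (\<Sum>i\<in>Basis. neg_slope (h x) (g x \<bullet> i) *\<^sub>R i) \<bullet> b) \<in> L2 \<Omega>"
    by (simp only: comp)
  fix \<phi> assume \<phi>: "\<phi> \<in> test_functions \<Omega>"
  let ?K = "closure {x. \<phi> x \<noteq> 0}"
  note K = test_function_support[OF \<phi>]
  obtain e where e: "e > 0" "(\<Union>x\<in>?K. ball x e) \<subseteq> \<Omega>"
    using compact_subset_open_imp_ball_epsilon_subset[OF K(1) \<open>open \<Omega>\<close> K(2)] by blast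
  define U where "U = (\<Union>x\<in>?K. ball x e)"
  define V where "V = (\<Union>x\<in>?K. ball x (e / 2))"
  have U: "open U" "U \<subseteq> \<Omega>" "?K \<subseteq> U"
    using e by (auto simp: U_def)
  have bU: "bounded U"
  proof -
    obtain c where c: "\<And>x. x \<in> ?K \<Longrightarrow> norm x \<le> c"
      using compact_imp_bounded[OF K(1)] by (auto simp: bounded_iff)
    have "U \<subseteq> ball 0 (c + e)"
    proof
      fix y assume "y \<in> U"
      then obtain x where "x \<in> ?K" "dist x y < e"
        by (auto simp: U_def)
      then show "y \<in> ball 0 (c + e)"
        using c[of x] norm_triangle_ineq[of x "y - x"] by (simp add: dist_norm norm_minus_commute)
    qed
    then show ?thesis by (rule bounded_subset[OF bounded_ball])
  qed
  have KV: "?K \<subseteq> V"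
    using e by (auto simp: V_def)
  have \<phi>V: "\<phi> \<in> test_functions V"
    using \<phi> KV by (auto simp: test_functions_def)
  obtain h' where h': "integrable lborel h'" "AE x in lborel. h' x = indicator U x * h x"
    using L2_local_borel_version[OF h \<Omega> U(1) bU U(2)] .
  obtain g' where g': "integrable lborel g'" "AE x in lborel. g' x = indicator U x * (g x \<bullet> b)"
    using L2_local_borel_version[OF gb \<Omega> U(1) bU U(2)] .
  have [measurable]: "h' \<in> borel_measurable borel" "g' \<in> borel_measurable borel"
    using h' g' by auto
  have transfer: "(LINT x|lebesgue_on \<Omega>. k x * \<psi> x) = (LINT x|lborel. k' x * \<psi> x)"
    if "k \<in> borel_measurable (lebesgue_on \<Omega>)" "k' \<in> borel_measurable borel"
      "AE x in lborel. k' x = indicator U x * k x" "continuous_on UNIV \<psi>" "\<And>x. x \<notin> U \<Longrightarrow> \<psi> x = 0"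
    for k k' \<psi> :: "'a \<Rightarrow> real"
    using integral_lebesgue_on_eq_lborel[OF \<Omega> that(1,2) borel_measurable_continuous_onI[OF that(4)] that(3) U(2) that(5)] .
  have zero: "\<psi> x = 0" "frechet_derivative \<psi> (at x) b = 0" if "\<psi> \<in> test_functions U" "x \<notin> U" for \<psi> x
  proof -
    have "x \<notin> closure {x. \<psi> x \<noteq> 0}"
      using that by (auto simp: test_functions_def)
    then show "\<psi> x = 0" "frechet_derivative \<psi> (at x) b = 0"
      using test_function_eq_0[of x \<psi>] test_function_derivative_eq_0[of x \<psi>] by auto
  qed
  interpret local_weak_derivative U b h' g' V "e / 2"
  proof
    fix \<psi> assume \<psi>: "\<psi> \<in> test_functions U"
    then have \<psi>\<Omega>: "\<psi> \<in> test_functions \<Omega>"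
      using test_functions_mono[OF U(2)] by auto
    have "(LINT x|lebesgue_on \<Omega>. h x * frechet_derivative \<psi> (at x) b) =
        (LINT x|lborel. h' x * frechet_derivative \<psi> (at x) b)"
      using h' zero[OF \<psi>] test_function_derivative_continuous[OF \<psi> b] by (intro transfer) auto
    moreover have "(LINT x|lebesgue_on \<Omega>. (g x \<bullet> b) * \<psi> x) = (LINT x|lborel. g' x * \<psi> x)"
      using g' zero[OF \<psi>] test_function_continuous[OF \<psi>] by (intro transfer) auto
    ultimately show "(LINT x|lborel. h' x * frechet_derivative \<psi> (at x) b) = - (LINT x|lborel. g' x * \<psi> x)"
      using has_weak_grad_integral[OF H b \<psi>\<Omega>] by simp
  next
    fix x and s :: real assume x: "x \<in> V" and s: "0 \<le> s" "s \<le> e / 2"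
    then obtain y where y: "y \<in> ?K" "dist y x < e / 2"
      by (auto simp: V_def)
    have "dist y (x + s *\<^sub>R b) \<le> dist y x + dist x (x + s *\<^sub>R b)"
      by (rule dist_triangle)
    also have "dist x (x + s *\<^sub>R b) = s"
      using s b by (simp add: dist_norm)
    finally have "dist y (x + s *\<^sub>R b) < e"
      using s y by simp
    then show "x + s *\<^sub>R b \<in> U"
      using y by (auto simp: U_def)
  qed (use b h' g' e in \<open>auto simp: V_def\<close>)
  have \<phi>U: "\<phi> \<in> test_functions U"
    using \<phi> U(3) by (auto simp: test_functions_def)
  have "(LINT x|lebesgue_on \<Omega>. max (- h x) 0 * frechet_derivative \<phi> (at x) b) =
      (LINT x|lborel. max (- h' x) 0 * frechet_derivative \<phi> (at x) b)"
  proof (rule transfer)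
    show "AE x in lborel. max (- h' x) 0 = indicator U x * max (- h x) 0"
      using h'(2) by eventually_elim (auto simp: indicator_def)
  qed (use zero[OF \<phi>U] test_function_derivative_continuous[OF \<phi> b] in auto)
  also have "\<dots> = - (LINT x|lborel. neg_slope (h' x) (g' x) * \<phi> x)"
    by (rule weak_derivative_negative_part[OF \<phi>V])
  also have "(LINT x|lborel. neg_slope (h' x) (g' x) * \<phi> x) =
      (LINT x|lebesgue_on \<Omega>. neg_slope (h x) (g x \<bullet> b) * \<phi> x)"
  proof (rule transfer[symmetric])
    show "AE x in lborel. neg_slope (h' x) (g' x) = indicator U x * neg_slope (h x) (g x \<bullet> b)"
      using h'(2) g'(2) by eventually_elim (auto simp: indicator_def neg_slope_def)
    show "(\<lambda>x. neg_slope (h x) (g x \<bullet> b)) \<in> borel_measurable (lebesgue_on \<Omega>)"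
      by measurable
  qed (use zero[OF \<phi>U] test_function_continuous[OF \<phi>] in auto)
  finally show "(LINT x|lebesgue_on \<Omega>. max (- h x) 0 * frechet_derivative \<phi> (at x) b) =
      - (LINT x|lebesgue_on \<Omega>. ((\<Sum>i\<in>Basis. neg_slope (h x) (g x \<bullet> i) *\<^sub>R i) \<bullet> b) * \<phi> x)"
    by (simp only: comp)
qed

lemma H1_neg: "h \<in> H1 \<Omega> \<Longrightarrow> open \<Omega> \<Longrightarrow> (\<lambda>x. max (- h x) 0) \<in> H1 \<Omega>"
  by (rule H1_I[OF L2_neg has_weak_grad_negative_part]) (auto intro: H1_L2 H1_has_weak_grad)

lemma grad_inner_neg:
  fixes \<Omega> :: "'a::euclidean_space set"
  assumes "h \<in> H1 \<Omega>" "open \<Omega>"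
  shows "grad_inner \<Omega> h (\<lambda>x. max (- h x) 0) \<le> 0"
    and "grad_inner \<Omega> (\<lambda>x. max (- h x) 0) (\<lambda>x. max (- h x) 0) \<le> grad_inner \<Omega> h h"
proof -
  define G where "G x = (\<Sum>b\<in>Basis. neg_slope (h x) (weak_grad \<Omega> h x \<bullet> b) *\<^sub>R b)" for x
  note H = H1_has_weak_grad[OF assms(1)]
  have N: "has_weak_grad \<Omega> (\<lambda>x. max (- h x) 0) G"
    unfolding G_def using has_weak_grad_negative_part[OF H H1_L2[OF assms(1)] assms(2)] .
  note L = H1_L2[OF assms(1)] L2_neg[OF H1_L2[OF assms(1)]]
  have G: "G x \<bullet> b = neg_slope (h x) (weak_grad \<Omega> h x \<bullet> b)" if "b \<in> Basis" for x b
    using that by (simp add: G_def)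
  have "weak_grad \<Omega> h x \<bullet> G x \<le> 0" for x
    by (subst euclidean_inner, rule sum_nonpos)
      (simp add: G order_trans[OF mult_neg_slope_le])
  then have "0 \<le> (LINT x|lebesgue_on \<Omega>. - (weak_grad \<Omega> h x \<bullet> G x))"
    by (intro Bochner_Integration.integral_nonneg) simp
  then show "grad_inner \<Omega> h (\<lambda>x. max (- h x) 0) \<le> 0"
    by (simp add: grad_inner_eq[OF H N L assms(2)])
  have "G x \<bullet> G x \<le> weak_grad \<Omega> h x \<bullet> weak_grad \<Omega> h x" for x
    by (subst (1 2) euclidean_inner, rule sum_mono)
      (simp add: G abs_neg_slope_le flip: power2_eq_square abs_le_square_iff)
  then show "grad_inner \<Omega> (\<lambda>x. max (- h x) 0) (\<lambda>x. max (- h x) 0) \<le> grad_inner \<Omega> h h"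
    unfolding grad_inner_eq[OF N N L(2,2) assms(2)] grad_inner_eq[OF H H L(1,1) assms(2)]
    by (intro integral_mono has_weak_grad_inner_integrable[OF N N] has_weak_grad_inner_integrable[OF H H])
qed

lemma grad_inner_neg_le:
  assumes "u \<in> H1 \<Omega>" "v \<in> H1 \<Omega>" "open \<Omega>"
  shows "grad_inner \<Omega> u (\<lambda>x. max (- v x) 0) \<le> H1_norm \<Omega> (\<lambda>x. u x - v x) * H1_norm \<Omega> v"
proof -
  interpret G: function_semi_inner "H1 \<Omega>" "grad_inner \<Omega>"
    using assms(3) by (rule grad_semi_inner)
  let ?p = "\<lambda>x. max (- v x) 0"
  have p: "?p \<in> H1 \<Omega>"
    using H1_neg assms by auto
  have d: "(\<lambda>x. u x - v x) \<in> H1 \<Omega>"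
    using G.diff_mem assms by auto
  have "grad_inner \<Omega> u ?p = grad_inner \<Omega> (\<lambda>x. u x - v x) ?p + grad_inner \<Omega> v ?p"
    using G.inner_add_left[OF d assms(2) p] by simp
  also have "\<dots> \<le> grad_inner \<Omega> (\<lambda>x. u x - v x) ?p"
    using grad_inner_neg(1)[OF assms(2,3)] by simp
  also have "\<dots> \<le> sqrt (grad_inner \<Omega> (\<lambda>x. u x - v x) (\<lambda>x. u x - v x)) * sqrt (grad_inner \<Omega> ?p ?p)"
    using G.Cauchy_Schwarz[OF d p] by simp
  also have "\<dots> \<le> H1_norm \<Omega> (\<lambda>x. u x - v x) * H1_norm \<Omega> v"
    using order_trans[OF real_sqrt_le_mono[OF grad_inner_neg(2)[OF assms(2,3)]] grad_norm_le_H1_norm]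
    by (intro mult_mono grad_norm_le_H1_norm) (simp_all add: grad_inner_nonneg H1_norm_def L2_inner_def)
  finally show ?thesis .
qed

section \<open>Strongly measurable functions\<close>

lemma borel_measurable_lebesgue_on_AE:
  fixes f g :: "'a::euclidean_space \<Rightarrow> real"
  assumes S: "S \<in> sets lebesgue" and f: "f \<in> borel_measurable (lebesgue_on S)"
    and eq: "AE x in lebesgue_on S. f x = g x"
  shows "g \<in> borel_measurable (lebesgue_on S)"
proof -
  have "(\<lambda>x. indicator S x *\<^sub>R f x) \<in> borel_measurable lebesgue"
    using f S by (subst (asm) borel_measurable_restrict_space_iff) auto
  moreover have "AE x in lebesgue. indicator S x *\<^sub>R f x = indicator S x *\<^sub>R g x"
    using eq S by (auto simp: AE_restrict_space_iff indicator_def elim!: eventually_mono)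
  ultimately have "(\<lambda>x. indicator S x *\<^sub>R g x) \<in> borel_measurable lebesgue"
    by (rule borel_measurable_AE)
  then show ?thesis
    using S by (subst borel_measurable_restrict_space_iff) auto
qed

lemma borel_measurable_lebesgue_on_AE_LIMSEQ:
  fixes f :: "nat \<Rightarrow> 'a::euclidean_space \<Rightarrow> real"
  assumes S: "S \<in> sets lebesgue" and f: "\<And>k. f k \<in> borel_measurable (lebesgue_on S)"
    and lim: "AE x in lebesgue_on S. (\<lambda>k. f k x) \<longlonglongrightarrow> g x"
  shows "g \<in> borel_measurable (lebesgue_on S)"
proof (rule borel_measurable_lebesgue_on_AE[OF S])
  show "(\<lambda>x. lim (\<lambda>k. f k x)) \<in> borel_measurable (lebesgue_on S)"
    using f by measurable
  show "AE x in lebesgue_on S. lim (\<lambda>k. f k x) = g x"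
    using lim by eventually_elim (rule limI)
qed

lemma AE_summable:
  fixes f :: "nat \<Rightarrow> 'a \<Rightarrow> real"
  assumes f: "\<And>k. integrable M (f k)" "\<And>k x. 0 \<le> f k x" and s: "summable (\<lambda>k. LINT x|M. f k x)"
  shows "AE x in M. summable (\<lambda>k. f k x)"
proof -
  have [measurable]: "f k \<in> borel_measurable M" for k
    using f by auto
  have "(\<integral>\<^sup>+x. (\<Sum>k. ennreal (f k x)) \<partial>M) = (\<Sum>k. \<integral>\<^sup>+x. ennreal (f k x) \<partial>M)"
    by (rule nn_integral_suminf) measurable
  also have "\<dots> = (\<Sum>k. ennreal (LINT x|M. f k x))"
    using f by (simp add: nn_integral_eq_integral)
  also have "\<dots> < \<infinity>"
    using f s by (subst suminf_ennreal2) (auto simp: integral_nonneg)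
  finally have "AE x in M. (\<Sum>k. ennreal (f k x)) \<noteq> \<infinity>"
    by (intro nn_integral_PInf_AE) auto
  then show ?thesis
    by eventually_elim (use f in \<open>auto intro: summable_suminf_not_top\<close>)
qed

lemma strongly_measurable_simple:
  assumes "simple_in M X s"
  shows "simple_function M (\<lambda>t. L (s t))" "t \<in> space M \<Longrightarrow> s t \<in> X"
  using assms simple_function_compose1[of M s L] unfolding simple_in_def by auto

lemma strongly_measurable_AE_mem: "strongly_measurable M X N u \<Longrightarrow> AE t in M. u t \<in> X"
  unfolding strongly_measurable_def by auto

lemma borel_measurable_strongly_measurable:
  fixes u :: "'t::euclidean_space \<Rightarrow> 'x \<Rightarrow> real" and L :: "('x \<Rightarrow> real) \<Rightarrow> real"
  assumes S: "S \<in> sets lebesgue" and u: "strongly_measurable (lebesgue_on S) X N u"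
    and L: "\<And>v w. v \<in> X \<Longrightarrow> w \<in> X \<Longrightarrow> \<bar>L v - L w\<bar> \<le> C * N (\<lambda>x. v x - w x)"
  shows "(\<lambda>t. L (u t)) \<in> borel_measurable (lebesgue_on S)"
proof -
  obtain s where s: "\<And>k. simple_in (lebesgue_on S) X (s k)"
    and lim: "AE t in lebesgue_on S. u t \<in> X \<and> (\<lambda>k::nat. N (\<lambda>x. u t x - s k t x)) \<longlonglongrightarrow> 0"
    using u unfolding strongly_measurable_def by blast
  show ?thesis
  proof (rule borel_measurable_lebesgue_on_AE_LIMSEQ[OF S])
    show "(\<lambda>t. L (s k t)) \<in> borel_measurable (lebesgue_on S)" for k
      by (intro borel_measurable_simple_function strongly_measurable_simple[OF s])
    show "AE t in lebesgue_on S. (\<lambda>k. L (s k t)) \<longlonglongrightarrow> L (u t)"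
      using lim AE_space
    proof eventually_elim
      case (elim t)
      have "\<bar>L (s k t) - L (u t)\<bar> \<le> C * N (\<lambda>x. u t x - s k t x)" for k
        using L[of "u t" "s k t"] elim strongly_measurable_simple(2)[OF s] by (simp add: abs_minus_commute)
      moreover have "(\<lambda>k. C * N (\<lambda>x. u t x - s k t x)) \<longlonglongrightarrow> 0"
        using tendsto_mult_left[OF conjunct2[OF elim(1)], of C] by simp
      ultimately have "(\<lambda>k. L (s k t) - L (u t)) \<longlonglongrightarrow> 0"
        by (intro Lim_null_comparison[of "\<lambda>k. L (s k t) - L (u t)"]) auto
      then show ?case by (simp add: LIM_zero_iff)
    qed
  qed
qed

lemma strongly_measurable_mono:
  assumes u: "strongly_measurable M X N u" and "X \<subseteq> Y"
    and "\<And>v. v \<in> X \<Longrightarrow> N' v \<le> C * N v" "\<And>v. 0 \<le> N' v"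
    and diff: "\<And>v w. v \<in> X \<Longrightarrow> w \<in> X \<Longrightarrow> (\<lambda>x. v x - w x) \<in> X"
  shows "strongly_measurable M Y N' u"
proof -
  obtain s where s: "\<And>k. simple_in M X (s k)"
    and lim: "AE t in M. u t \<in> X \<and> (\<lambda>k::nat. N (\<lambda>x. u t x - s k t x)) \<longlonglongrightarrow> 0"
    using u unfolding strongly_measurable_def by blast
  have "AE t in M. u t \<in> Y \<and> (\<lambda>k::nat. N' (\<lambda>x. u t x - s k t x)) \<longlonglongrightarrow> 0"
    using lim AE_space
  proof eventually_elim
    case (elim t)
    have "N' (\<lambda>x. u t x - s k t x) \<le> C * N (\<lambda>x. u t x - s k t x)" for k
      using elim strongly_measurable_simple(2)[OF s] by (intro assms diff) auto
    moreover have "(\<lambda>k. C * N (\<lambda>x. u t x - s k t x)) \<longlonglongrightarrow> 0"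
      using tendsto_mult_left[OF conjunct2[OF elim(1)], of C] by simp
    ultimately have "(\<lambda>k. N' (\<lambda>x. u t x - s k t x)) \<longlonglongrightarrow> 0"
      using assms(4) by (intro Lim_null_comparison[of "\<lambda>k. N' (\<lambda>x. u t x - s k t x)"]) auto
    then show ?case using elim \<open>X \<subseteq> Y\<close> by auto
  qed
  moreover have "simple_in M Y (s k)" for k
    using s[of k] \<open>X \<subseteq> Y\<close> by (auto simp: simple_in_def)
  ultimately show ?thesis
    unfolding strongly_measurable_def by blast
qed

context function_seminorm
begin

lemma strongly_measurable_diff_simple:
  assumes u: "strongly_measurable M X N u" and \<sigma>: "simple_in M X \<sigma>"
  shows "strongly_measurable M X N (\<lambda>t x. u t x - \<sigma> t x)"
proof -
  obtain s where s: "\<And>k. simple_in M X (s k)"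
    and lim: "AE t in M. u t \<in> X \<and> (\<lambda>k::nat. N (\<lambda>x. u t x - s k t x)) \<longlonglongrightarrow> 0"
    using u unfolding strongly_measurable_def by blast
  have "simple_in M X (\<lambda>t x. s k t x - \<sigma> t x)" for k
    using s[of k] \<sigma> unfolding simple_in_def
    by (auto intro: diff_mem simple_function_compose2[where h = "\<lambda>f g x. f x - g x"])
  moreover have "AE t in M. (\<lambda>x. u t x - \<sigma> t x) \<in> X \<and>
      (\<lambda>k. N (\<lambda>x. (u t x - \<sigma> t x) - (s k t x - \<sigma> t x))) \<longlonglongrightarrow> 0"
    using lim AE_space by eventually_elim (use strongly_measurable_simple(2)[OF \<sigma>] in \<open>auto intro: diff_mem\<close>)
  ultimately show ?thesis
    unfolding strongly_measurable_def by (intro exI[of _ "\<lambda>k t x. s k t x - \<sigma> t x"]) simp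
qed

lemma strongly_measurable_add:
  assumes u: "strongly_measurable M X N u" and w: "strongly_measurable M X N w"
  shows "strongly_measurable M X N (\<lambda>t x. u t x + w t x)"
proof -
  obtain s where s: "\<And>k. simple_in M X (s k)"
    and s_lim: "AE t in M. u t \<in> X \<and> (\<lambda>k::nat. N (\<lambda>x. u t x - s k t x)) \<longlonglongrightarrow> 0"
    using u unfolding strongly_measurable_def by blast
  obtain r where r: "\<And>k. simple_in M X (r k)"
    and r_lim: "AE t in M. w t \<in> X \<and> (\<lambda>k::nat. N (\<lambda>x. w t x - r k t x)) \<longlonglongrightarrow> 0"
    using w unfolding strongly_measurable_def by blast
  have "simple_in M X (\<lambda>t x. s k t x + r k t x)" for k
    using s[of k] r[of k] unfolding simple_in_def
    by (auto intro: add_mem simple_function_compose2[where h = "\<lambda>f g x. f x + g x"])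
  moreover have "AE t in M. (\<lambda>x. u t x + w t x) \<in> X \<and>
      (\<lambda>k. N (\<lambda>x. (u t x + w t x) - (s k t x + r k t x))) \<longlonglongrightarrow> 0"
    using s_lim r_lim AE_space
  proof eventually_elim
    case (elim t)
    have mem: "(\<lambda>x. u t x - s k t x) \<in> X" "(\<lambda>x. w t x - r k t x) \<in> X" for k
      using elim strongly_measurable_simple(2)[OF s] strongly_measurable_simple(2)[OF r]
      by (auto intro: diff_mem)
    have eq: "(\<lambda>x. (u t x + w t x) - (s k t x + r k t x)) = (\<lambda>x. (u t x - s k t x) + (w t x - r k t x))" for k
      by auto
    have lim0: "(\<lambda>k. N (\<lambda>x. u t x - s k t x) + N (\<lambda>x. w t x - r k t x)) \<longlonglongrightarrow> 0"
      using elim tendsto_add[of "\<lambda>k. N (\<lambda>x. u t x - s k t x)" 0 sequentially "\<lambda>k. N (\<lambda>x. w t x - r k t x)" 0]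
      by simp
    have "norm (N (\<lambda>x. (u t x + w t x) - (s k t x + r k t x))) \<le>
        N (\<lambda>x. u t x - s k t x) + N (\<lambda>x. w t x - r k t x)" for k
      unfolding eq using norm_add[OF mem] norm_nonneg[OF add_mem[OF mem]] by simp
    from Lim_null_comparison[OF always_eventually[OF allI[OF this]] lim0]
    have "(\<lambda>k. N (\<lambda>x. (u t x + w t x) - (s k t x + r k t x))) \<longlonglongrightarrow> 0" .
    then show ?case
      using elim add_mem[of "u t" "w t"] by blast
  qed
  ultimately show ?thesis
    unfolding strongly_measurable_def by (intro exI[of _ "\<lambda>k t x. s k t x + r k t x"]) simp
qed

lemma strongly_measurable_scale:
  assumes \<eta>: "\<eta> \<in> borel_measurable M" and v: "v \<in> X"
  shows "strongly_measurable M X N (\<lambda>t x. \<eta> t * v x)"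
proof -
  obtain F where F: "\<And>i. simple_function M (F i)" "\<And>t. t \<in> space M \<Longrightarrow> (\<lambda>i. F i t) \<longlonglongrightarrow> \<eta> t"
    using borel_measurable_implies_sequence_metric[OF \<eta>] by metis
  have "simple_in M X (\<lambda>t x. F i t * v x)" for i
    using simple_function_compose1[OF F(1)[of i], of "\<lambda>c x. c * v x"] v
    unfolding simple_in_def by (auto intro: scale_mem)
  moreover have "AE t in M. (\<lambda>x. \<eta> t * v x) \<in> X \<and> (\<lambda>i. N (\<lambda>x. \<eta> t * v x - F i t * v x)) \<longlonglongrightarrow> 0"
    using AE_space
  proof eventually_elim
    case (elim t)
    have "(\<lambda>i. \<bar>\<eta> t - F i t\<bar> * N v) \<longlonglongrightarrow> \<bar>\<eta> t - \<eta> t\<bar> * N v"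
      by (intro tendsto_intros F elim)
    moreover have "N (\<lambda>x. \<eta> t * v x - F i t * v x) = \<bar>\<eta> t - F i t\<bar> * N v" for i
      using norm_scale[OF v, of "\<eta> t - F i t"] by (simp add: left_diff_distrib)
    ultimately show ?case
      using scale_mem[OF v] by simp
  qed
  ultimately show ?thesis
    unfolding strongly_measurable_def by (intro exI[of _ "\<lambda>i t x. F i t * v x"]) simp
qed

lemma strongly_measurable_zero: "strongly_measurable M X N (\<lambda>t x. 0)"
  using strongly_measurable_scale[of "\<lambda>_. 0" M "\<lambda>_. 0"] zero_mem by simp

lemma strongly_measurable_sum:
  assumes "finite J" "\<And>v. v \<in> J \<Longrightarrow> strongly_measurable M X N (f v)"
  shows "strongly_measurable M X N (\<lambda>t x. \<Sum>v\<in>J. f v t x)"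
  using assms
  by (induction J rule: finite_induct) (auto intro: strongly_measurable_add strongly_measurable_zero)

lemma norm_measurable:
  fixes u :: "'t::euclidean_space \<Rightarrow> 'x \<Rightarrow> real"
  assumes "S \<in> sets lebesgue" "strongly_measurable (lebesgue_on S) X N u"
  shows "(\<lambda>t. N (u t)) \<in> borel_measurable (lebesgue_on S)"
  by (rule borel_measurable_strongly_measurable[OF assms, of N 1]) (simp add: norm_diff_bound)

lemma Bochner_L2_simple_approximation:
  fixes u :: "'t::euclidean_space \<Rightarrow> 'x \<Rightarrow> real"
  assumes S: "S \<in> sets lebesgue" and u: "u \<in> Bochner_Lp 2 (lebesgue_on S) X N" and "e > 0"
  obtains \<sigma> where "simple_in (lebesgue_on S) X \<sigma>"
    "integrable (lebesgue_on S) (\<lambda>t. (N (\<lambda>x. u t x - \<sigma> t x))\<^sup>2)"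
    "(LINT t|lebesgue_on S. (N (\<lambda>x. u t x - \<sigma> t x))\<^sup>2) < e"
proof -
  let ?M = "lebesgue_on S"
  have um: "strongly_measurable ?M X N u" and ui: "integrable ?M (\<lambda>t. (N (u t))\<^sup>2)"
    using u by (auto simp: Bochner_Lp_def)
  obtain s where s: "\<And>k. simple_in ?M X (s k)"
    and lim: "AE t in ?M. u t \<in> X \<and> (\<lambda>k::nat. N (\<lambda>x. u t x - s k t x)) \<longlonglongrightarrow> 0"
    using um unfolding strongly_measurable_def by blast
  have [measurable]: "(\<lambda>t. N (u t)) \<in> borel_measurable ?M"
    by (rule norm_measurable[OF S um])
  have [measurable]: "(\<lambda>t. N (s k t)) \<in> borel_measurable ?M" for k
    by (intro borel_measurable_simple_function strongly_measurable_simple[OF s])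
  define \<sigma> where "\<sigma> k t = (if N (s k t) \<le> 2 * N (u t) then s k t else (\<lambda>_. 0))" for k t
  have \<sigma>: "simple_in ?M X (\<sigma> k)" for k
  proof -
    have "simple_function ?M (\<sigma> k)"
      unfolding \<sigma>_def
    proof (rule simple_function_If)
      show "{t \<in> space ?M. N (s k t) \<le> 2 * N (u t)} \<in> sets ?M"
        by measurable
    qed (use s[of k] in \<open>auto simp: simple_in_def\<close>)
    then show ?thesis
      using s[of k] zero_mem by (auto simp: simple_in_def \<sigma>_def)
  qed
  have [measurable]: "(\<lambda>t. N (\<lambda>x. u t x - \<sigma> k t x)) \<in> borel_measurable ?M" for k
    by (rule norm_measurable[OF S strongly_measurable_diff_simple[OF um \<sigma>]])
  have bound: "AE t in ?M. (N (\<lambda>x. u t x - \<sigma> k t x))\<^sup>2 \<le> 9 * (N (u t))\<^sup>2" for k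
    using lim AE_space
  proof eventually_elim
    case (elim t)
    have \<sigma>t: "\<sigma> k t \<in> X"
      using strongly_measurable_simple(2)[OF \<sigma>] elim by auto
    have "N (\<sigma> k t) \<le> 2 * N (u t)"
      using norm_nonneg[of "u t"] elim norm_zero by (auto simp: \<sigma>_def)
    then have "N (\<lambda>x. u t x - \<sigma> k t x) \<le> 3 * N (u t)"
      using norm_diff[OF conjunct1[OF elim(1)] \<sigma>t] by simp
    from power_mono[OF this norm_nonneg[OF diff_mem], of "2"] show ?case
      using elim \<sigma>t by (simp add: power_mult_distrib)
  qed
  have int: "integrable ?M (\<lambda>t. (N (\<lambda>x. u t x - \<sigma> k t x))\<^sup>2)" for k
    by (rule Bochner_Integration.integrable_bound[where f = "\<lambda>t. 9 * (N (u t))\<^sup>2"])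
      (use ui bound[of k] in auto)
  have "(\<lambda>k. LINT t|?M. (N (\<lambda>x. u t x - \<sigma> k t x))\<^sup>2) \<longlonglongrightarrow> (LINT t|?M. 0)"
  proof (rule integral_dominated_convergence[where w = "\<lambda>t. 9 * (N (u t))\<^sup>2"])
    show "AE t in ?M. (\<lambda>k. (N (\<lambda>x. u t x - \<sigma> k t x))\<^sup>2) \<longlonglongrightarrow> 0"
      using lim AE_space
    proof eventually_elim
      case (elim t)
      have st: "s k t \<in> X" for k
        using strongly_measurable_simple(2)[OF s] elim by auto
      have "(\<lambda>k. N (\<lambda>x. u t x - \<sigma> k t x)) \<longlonglongrightarrow> 0"
      proof (cases "N (u t) = 0")
        case True
        have "N (\<lambda>x. u t x - \<sigma> k t x) = 0" for k
        proof -
          have \<sigma>t: "\<sigma> k t \<in> X"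
            using strongly_measurable_simple(2)[OF \<sigma>] elim by auto
          have "N (\<sigma> k t) \<le> 0"
            using True norm_zero by (auto simp: \<sigma>_def)
          then show ?thesis
            using norm_diff[OF conjunct1[OF elim(1)] \<sigma>t] True norm_nonneg[OF diff_mem[OF conjunct1[OF elim(1)] \<sigma>t]]
            by simp
        qed
        then show ?thesis by simp
      next
        case False
        then have pos: "N (u t) > 0"
          using norm_nonneg[of "u t"] elim by auto
        have "\<forall>\<^sub>F k in sequentially. N (\<lambda>x. u t x - s k t x) < N (u t)"
          using elim pos by (intro order_tendstoD(2)) auto
        then have "\<forall>\<^sub>F k in sequentially. N (\<lambda>x. u t x - s k t x) = N (\<lambda>x. u t x - \<sigma> k t x)"
        proof eventually_elim
          case (elim k)
          have "N (s k t) \<le> 2 * N (u t)"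
            using elim norm_diff_bound[OF conjunct1[OF \<open>u t \<in> X \<and> _\<close>] st[of k]] by simp
          then show ?case by (simp add: \<sigma>_def)
        qed
        then show ?thesis
          using elim by (auto simp: tendsto_cong)
      qed
      from tendsto_power[OF this, of 2] show ?case by simp
    qed
    show "AE t in ?M. norm ((N (\<lambda>x. u t x - \<sigma> k t x))\<^sup>2) \<le> 9 * (N (u t))\<^sup>2" for k
      using bound[of k] by simp
  qed (use ui in auto)
  then have "\<forall>\<^sub>F k in sequentially. (LINT t|?M. (N (\<lambda>x. u t x - \<sigma> k t x))\<^sup>2) < e"
    using \<open>e > 0\<close> by (intro order_tendstoD(2)) auto
  then obtain k where "(LINT t|?M. (N (\<lambda>x. u t x - \<sigma> k t x))\<^sup>2) < e"
    by (auto simp: eventually_sequentially)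
  then show ?thesis
    using that \<sigma> int by blast
qed

end

lemma lebesgue_set_continuous_approximation:
  fixes A :: "'a::euclidean_space set"
  assumes A: "A \<in> sets lebesgue" and "e > 0"
  obtains \<psi> B where "continuous_on UNIV \<psi>" "B \<in> lmeasurable" "measure lebesgue B < e"
    "\<And>x. \<bar>indicator A x - \<psi> x :: real\<bar> \<le> indicator B x"
proof -
  obtain U where U: "open U" "A \<subseteq> U" "U - A \<in> lmeasurable" "emeasure lebesgue (U - A) < ennreal (e / 2)"
    using sets_lebesgue_outer_open[OF A, of "e / 2"] \<open>e > 0\<close> by auto
  obtain K where K: "closed K" "K \<subseteq> A" "A - K \<in> lmeasurable" "emeasure lebesgue (A - K) < ennreal (e / 2)"
    using sets_lebesgue_inner_closed[OF A, of "e / 2"] \<open>e > 0\<close> by auto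
  obtain \<psi> :: "'a \<Rightarrow> real" where \<psi>: "continuous_on UNIV \<psi>" "\<And>x. \<psi> x \<in> closed_segment 1 0"
      "\<And>x. x \<in> K \<Longrightarrow> \<psi> x = 1" "\<And>x. x \<in> - U \<Longrightarrow> \<psi> x = 0"
    using Urysohn[of K "- U" 1 "0::real"] U K by auto
  define B where "B = (U - A) \<union> (A - K)"
  have B: "B \<in> lmeasurable"
    using U K by (simp add: B_def fmeasurable.Un)
  moreover have "measure lebesgue B < e"
  proof -
    have "measure lebesgue B \<le> measure lebesgue (U - A) + measure lebesgue (A - K)"
      unfolding B_def using U K by (intro measure_Un_le) (auto simp: fmeasurable_def)
    also have "\<dots> < e / 2 + e / 2"
      using U K \<open>e > 0\<close> by (intro add_strict_mono) (auto simp: emeasure_eq_measure2 ennreal_less_iff)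
    finally show ?thesis by simp
  qed
  moreover have "\<bar>indicator A x - \<psi> x :: real\<bar> \<le> indicator B x" for x
    using \<psi>(2)[of x] \<psi>(3)[of x] \<psi>(4)[of x] U(2) K(2)
    by (auto simp: closed_segment_eq_real_ivl indicator_def B_def)
  ultimately show ?thesis
    using that \<psi>(1) by blast
qed

lemma lmeasurable_indicator_integrable:
  "A \<in> lmeasurable \<Longrightarrow> integrable lebesgue (\<lambda>t. indicator A t :: real)"
  by (rule integrable_real_indicator) (auto simp: fmeasurable_def)

lemma simple_function_sum_representation:
  assumes s: "simple_function M s" and "t \<in> space M"
  shows "s t x = (\<Sum>v\<in>s ` space M. indicator (s -` {v} \<inter> space M) t * v x :: real)"
proof -
  have "(\<Sum>v\<in>s ` space M. indicator (s -` {v} \<inter> space M) t * v x) =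
      (\<Sum>v\<in>s ` space M. if v = s t then v x else 0)"
    using \<open>t \<in> space M\<close> by (intro sum.cong) (auto simp: indicator_def)
  also have "\<dots> = s t x"
    using assms simple_functionD(1)[OF s] by simp
  finally show ?thesis ..
qed

lemma (in function_seminorm) Bochner_L2_continuous_approximation:
  fixes u :: "'t::euclidean_space \<Rightarrow> 'x \<Rightarrow> real"
  assumes S: "S \<in> sets lebesgue" and u: "u \<in> Bochner_Lp 2 (lebesgue_on S) X N" and "e > 0"
  obtains J \<psi> where "finite J" "J \<subseteq> X" "\<And>v. v \<in> J \<Longrightarrow> continuous_on UNIV (\<psi> v :: 't \<Rightarrow> real)"
    "integrable (lebesgue_on S) (\<lambda>t. (N (\<lambda>x. u t x - (\<Sum>v\<in>J. \<psi> v t * v x)))\<^sup>2)"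
    "(LINT t|lebesgue_on S. (N (\<lambda>x. u t x - (\<Sum>v\<in>J. \<psi> v t * v x)))\<^sup>2) < e"
proof -
  let ?M = "lebesgue_on S"
  have um: "strongly_measurable ?M X N u"
    using u by (auto simp: Bochner_Lp_def)
  obtain \<sigma> where \<sigma>: "simple_in ?M X \<sigma>" "integrable ?M (\<lambda>t. (N (\<lambda>x. u t x - \<sigma> t x))\<^sup>2)"
    "(LINT t|?M. (N (\<lambda>x. u t x - \<sigma> t x))\<^sup>2) < e / 4"
    using Bochner_L2_simple_approximation[OF S u, of "e / 4"] \<open>e > 0\<close> by auto
  define J where "J = \<sigma> ` space ?M"
  define A where "A v = \<sigma> -` {v} \<inter> space ?M" for v
  define Q where "Q = (\<Sum>v\<in>J. N v)"
  define \<delta> where "\<delta> = e / (8 * (Q\<^sup>2 + 1) * (real (card J) + 1))"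
  have s\<sigma>: "simple_function ?M \<sigma>" and J: "J \<subseteq> X" "finite J"
    using \<sigma>(1) simple_functionD(1)[of ?M \<sigma>] by (auto simp: simple_in_def J_def)
  have "\<delta> > 0"
    using \<open>e > 0\<close> by (auto simp: \<delta>_def intro!: divide_pos_pos mult_pos_pos add_nonneg_pos)
  have A: "A v \<in> sets lebesgue" for v
    using simple_functionD(2)[OF s\<sigma>] S by (auto simp: A_def sets_restrict_space_iff)
  have "\<exists>\<psi> B. continuous_on UNIV \<psi> \<and> B \<in> lmeasurable \<and> measure lebesgue B < \<delta> \<and>
      (\<forall>x. \<bar>indicator (A v) x - \<psi> x :: real\<bar> \<le> indicator B x)" for v
    using lebesgue_set_continuous_approximation[OF A \<open>\<delta> > 0\<close>, of v] by metis
  then obtain \<psi> B where \<psi>: "\<And>v. continuous_on UNIV (\<psi> v :: 't \<Rightarrow> real)"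
    and B: "\<And>v. B v \<in> lmeasurable" "\<And>v. measure lebesgue (B v) < \<delta>"
    and diff: "\<And>v x. \<bar>indicator (A v) x - \<psi> v x\<bar> \<le> indicator (B v) x"
    by metis
  define \<tau> where "\<tau> t x = (\<Sum>v\<in>J. \<psi> v t * v x)" for t x
  define C where "C = (\<Union>v\<in>J. B v)"
  have C: "C \<in> lmeasurable"
    unfolding C_def using J B by (intro fmeasurable.finite_UN) auto
  have \<tau>_meas: "strongly_measurable ?M X N \<tau>"
    unfolding \<tau>_def using J \<psi>
    by (intro strongly_measurable_sum strongly_measurable_scale)
      (auto intro!: continuous_imp_measurable_lebesgue_on)
  have "strongly_measurable ?M X N (\<lambda>t x. -1 * \<tau> t x)"
    unfolding \<tau>_def sum_distrib_left mult.assoc[symmetric] using J \<psi>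
    by (intro strongly_measurable_sum strongly_measurable_scale)
      (auto intro!: continuous_imp_measurable_lebesgue_on continuous_intros)
  from strongly_measurable_add[OF um this]
  have ut_meas: "strongly_measurable ?M X N (\<lambda>t x. u t x - \<tau> t x)"
    by simp
  have [measurable]: "(\<lambda>t. N (\<lambda>x. u t x - \<tau> t x)) \<in> borel_measurable ?M"
    by (rule norm_measurable[OF S ut_meas])
  have Q0: "0 \<le> Q"
    using J norm_nonneg by (auto simp: Q_def intro!: sum_nonneg)
  have step: "N (\<lambda>x. \<sigma> t x - \<tau> t x) \<le> Q * indicator C t" if t: "t \<in> space ?M" for t
  proof -
    have "(\<lambda>x. \<sigma> t x - \<tau> t x) = (\<lambda>x. \<Sum>v\<in>J. (indicator (A v) t - \<psi> v t) * v x)"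
      using simple_function_sum_representation[OF s\<sigma> t]
      by (simp add: \<tau>_def J_def A_def left_diff_distrib sum_subtractf)
    then have "N (\<lambda>x. \<sigma> t x - \<tau> t x) \<le> (\<Sum>v\<in>J. N (\<lambda>x. (indicator (A v) t - \<psi> v t) * v x))"
      using J by (simp only:) (intro norm_sum_le; auto intro: scale_mem)
    also have "\<dots> \<le> (\<Sum>v\<in>J. N v * indicator C t)"
    proof (rule sum_mono)
      fix v assume v: "v \<in> J"
      have "\<bar>indicator (A v) t - \<psi> v t\<bar> \<le> (indicator C t :: real)"
        using v by (intro order_trans[OF diff]) (auto simp: C_def indicator_def)
      from mult_right_mono[OF this norm_nonneg[of v]]
      show "N (\<lambda>x. (indicator (A v) t - \<psi> v t) * v x) \<le> N v * indicator C t"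
        using subsetD[OF J(1) v] norm_scale[of v] by (simp add: mult.commute[of "N v"])
    qed
    also have "\<dots> = Q * indicator C t"
      by (simp add: Q_def sum_distrib_right)
    finally show ?thesis .
  qed
  have bound: "AE t in ?M. (N (\<lambda>x. u t x - \<tau> t x))\<^sup>2 \<le>
      2 * (N (\<lambda>x. u t x - \<sigma> t x))\<^sup>2 + 2 * Q\<^sup>2 * indicator C t"
    using strongly_measurable_AE_mem[OF um] strongly_measurable_AE_mem[OF \<tau>_meas] AE_space
  proof eventually_elim
    case (elim t)
    have \<sigma>t: "\<sigma> t \<in> X"
      using strongly_measurable_simple(2)[OF \<sigma>(1)] elim by auto
    let ?a = "N (\<lambda>x. u t x - \<sigma> t x)" and ?b = "Q * indicator C t :: real"
    have "N (\<lambda>x. u t x - \<tau> t x) \<le> ?a + ?b"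
      using norm_diff_triangle[OF elim(1) \<sigma>t elim(2)] step[OF elim(3)] by simp
    then have "(N (\<lambda>x. u t x - \<tau> t x))\<^sup>2 \<le> (?a + ?b)\<^sup>2"
      using norm_nonneg[OF diff_mem[OF elim(1,2)]] by (rule power_mono)
    also have "\<dots> \<le> 2 * ?a\<^sup>2 + 2 * ?b\<^sup>2"
      using zero_le_power2[of "?a - ?b"] by (simp add: power2_sum power2_diff)
    also have "?b\<^sup>2 = Q\<^sup>2 * indicator C t"
      by (simp add: indicator_def)
    finally show ?case by simp
  qed
  have iC: "integrable ?M (\<lambda>t. indicator C t :: real)" and mC: "(LINT t|?M. indicator C t) \<le> measure lebesgue C"
  proof -
    have i: "integrable lebesgue (\<lambda>t. indicator C t :: real)" "integrable lebesgue (\<lambda>t. indicator (S \<inter> C) t :: real)"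
      using lmeasurable_indicator_integrable[OF C]
        lmeasurable_indicator_integrable[OF fmeasurable_Int_fmeasurable[OF C S]] by (simp_all add: Int_commute)
    then show "integrable ?M (\<lambda>t. indicator C t :: real)"
      using S by (simp add: integrable_restrict_space indicator_inter_arith)
    have "(LINT t|?M. indicator C t :: real) = (LINT t|lebesgue. indicator (S \<inter> C) t)"
      by (subst integral_restrict_space, use S in simp) (simp only: indicator_inter_arith[abs_def] real_scaleR_def)
    also have "\<dots> \<le> (LINT t|lebesgue. indicator C t)"
      using i by (intro integral_mono) (auto simp: indicator_def)
    finally show "(LINT t|?M. indicator C t) \<le> measure lebesgue C"
      using C by simp
  qed
  have ib: "integrable ?M (\<lambda>t. 2 * (N (\<lambda>x. u t x - \<sigma> t x))\<^sup>2 + 2 * Q\<^sup>2 * indicator C t)"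
    using \<sigma>(2) iC by simp
  have int: "integrable ?M (\<lambda>t. (N (\<lambda>x. u t x - \<tau> t x))\<^sup>2)"
    by (rule Bochner_Integration.integrable_bound[OF ib]) (use bound in auto)
  have mC': "measure lebesgue C \<le> card J * \<delta>"
  proof -
    have "measure lebesgue C \<le> (\<Sum>v\<in>J. measure lebesgue (B v))"
      unfolding C_def using J B by (intro measure_UNION_le) (auto simp: fmeasurable_def)
    also have "\<dots> \<le> (\<Sum>v\<in>J. \<delta>)"
      using B by (intro sum_mono less_imp_le)
    finally show ?thesis by simp
  qed
  have "(LINT t|?M. (N (\<lambda>x. u t x - \<tau> t x))\<^sup>2) \<le>
      (LINT t|?M. 2 * (N (\<lambda>x. u t x - \<sigma> t x))\<^sup>2 + 2 * Q\<^sup>2 * indicator C t)"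
    by (rule integral_mono_AE[OF int ib bound])
  also have "\<dots> = 2 * (LINT t|?M. (N (\<lambda>x. u t x - \<sigma> t x))\<^sup>2) + 2 * Q\<^sup>2 * (LINT t|?M. indicator C t)"
    using \<sigma>(2) iC by simp
  also have "\<dots> < e"
  proof -
    have "Q\<^sup>2 * (LINT t|?M. indicator C t) \<le> (Q\<^sup>2 + 1) * ((real (card J) + 1) * \<delta>)"
      using mC mC' \<open>\<delta> > 0\<close> by (intro mult_mono) (auto intro: order_trans simp: algebra_simps)
    also have "\<dots> = e / 8"
    proof -
      have "Q\<^sup>2 + 1 \<noteq> 0" "real (card J) + 1 \<noteq> 0"
        using zero_le_power2[of Q] by linarith+
      moreover have "a * (c * (e / (8 * a * c))) = e / 8" if "a \<noteq> 0" "c \<noteq> 0" for a c :: real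
        using that by (simp add: field_simps)
      ultimately show ?thesis
        unfolding \<delta>_def by blast
    qed
    finally show ?thesis
      using \<sigma>(3) \<open>e > 0\<close> by simp
  qed
  finally have "(LINT t|?M. (N (\<lambda>x. u t x - \<tau> t x))\<^sup>2) < e" .
  then show ?thesis
    using that[of J \<psi>] J \<psi> int by (simp add: \<tau>_def)
qed

section \<open>The dual space of \<open>H\<^sup>1\<close>\<close>

context
  fixes \<Omega> :: "'a::euclidean_space set"
  assumes \<Omega>: "open \<Omega>"
begin

interpretation H1: function_seminorm "H1 \<Omega>" "H1_norm \<Omega>"
  using \<Omega> by (rule H1_seminorm)

lemma H1_dual_bdd:
  assumes "F \<in> H1_dual \<Omega>"
  shows "bdd_above ((\<lambda>v. \<bar>F v\<bar>) ` {v \<in> H1 \<Omega>. H1_norm \<Omega> v \<le> 1})"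
proof -
  obtain C where C: "\<And>v. v \<in> H1 \<Omega> \<Longrightarrow> \<bar>F v\<bar> \<le> C * H1_norm \<Omega> v"
    using assms unfolding H1_dual_def by blast
  have "\<bar>F v\<bar> \<le> \<bar>C\<bar>" if "v \<in> H1 \<Omega>" "H1_norm \<Omega> v \<le> 1" for v
  proof -
    have "C * H1_norm \<Omega> v \<le> \<bar>C\<bar> * 1"
      using that H1.norm_nonneg[of v] by (intro mult_mono) auto
    then show ?thesis
      using C[OF that(1)] by simp
  qed
  then show ?thesis
    by (intro bdd_aboveI2[where M = "\<bar>C\<bar>"]) auto
qed

lemma H1_dual_bound:
  assumes F: "F \<in> H1_dual \<Omega>" and v: "v \<in> H1 \<Omega>"
  shows "\<bar>F v\<bar> \<le> H1_dual_norm \<Omega> F * H1_norm \<Omega> v"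
proof (cases "H1_norm \<Omega> v = 0")
  case True
  obtain C where "\<bar>F v\<bar> \<le> C * H1_norm \<Omega> v"
    using F v unfolding H1_dual_def by blast
  then show ?thesis using True by simp
next
  case False
  then have pos: "H1_norm \<Omega> v > 0"
    using H1.norm_nonneg[OF v] by simp
  let ?c = "1 / H1_norm \<Omega> v"
  have w: "(\<lambda>x. ?c * v x) \<in> H1 \<Omega>" "H1_norm \<Omega> (\<lambda>x. ?c * v x) \<le> 1"
    using H1.scale_mem[OF v, of ?c] H1.norm_scale[OF v, of ?c] pos by simp_all
  have "\<bar>F (\<lambda>x. ?c * v x)\<bar> \<le> H1_dual_norm \<Omega> F"
    unfolding H1_dual_norm_def using w by (intro cSUP_upper H1_dual_bdd F) auto
  moreover have "F (\<lambda>x. ?c * v x) = ?c * F v"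
    using F v unfolding H1_dual_def by blast
  ultimately show ?thesis
    using pos by (simp add: abs_mult pos_divide_le_eq)
qed

lemma H1_dual_norm_le:
  assumes "\<And>v. v \<in> H1 \<Omega> \<Longrightarrow> H1_norm \<Omega> v \<le> 1 \<Longrightarrow> \<bar>F v\<bar> \<le> c"
  shows "H1_dual_norm \<Omega> F \<le> c"
  unfolding H1_dual_norm_def
  using assms H1.zero_mem H1.norm_zero by (intro cSUP_least) auto

lemma H1_dual_add:
  assumes F: "F \<in> H1_dual \<Omega>" and G: "G \<in> H1_dual \<Omega>"
  shows "(\<lambda>v. F v + G v) \<in> H1_dual \<Omega>"
proof -
  have "\<bar>F v + G v\<bar> \<le> (H1_dual_norm \<Omega> F + H1_dual_norm \<Omega> G) * H1_norm \<Omega> v" if "v \<in> H1 \<Omega>" for v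
    using H1_dual_bound[OF F that] H1_dual_bound[OF G that] by (simp add: distrib_right)
  then show ?thesis
    using F G unfolding H1_dual_def by (auto simp: distrib_left)
qed

lemma H1_dual_scale:
  assumes F: "F \<in> H1_dual \<Omega>"
  shows "(\<lambda>v. c * F v) \<in> H1_dual \<Omega>"
proof -
  have "\<bar>c * F v\<bar> \<le> (\<bar>c\<bar> * H1_dual_norm \<Omega> F) * H1_norm \<Omega> v" if "v \<in> H1 \<Omega>" for v
    using mult_left_mono[OF H1_dual_bound[OF F that], of "\<bar>c\<bar>"] by (simp add: abs_mult mult.assoc)
  then show ?thesis
    using F unfolding H1_dual_def by (auto simp: distrib_left)
qed

lemma H1_dual_scale_norm_le:
  assumes F: "F \<in> H1_dual \<Omega>"
  shows "H1_dual_norm \<Omega> (\<lambda>v. c * F v) \<le> \<bar>c\<bar> * H1_dual_norm \<Omega> F"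
proof (rule H1_dual_norm_le)
  fix v assume v: "v \<in> H1 \<Omega>" "H1_norm \<Omega> v \<le> 1"
  have "\<bar>F v\<bar> \<le> H1_dual_norm \<Omega> F"
    unfolding H1_dual_norm_def using v by (intro cSUP_upper H1_dual_bdd F) auto
  then show "\<bar>c * F v\<bar> \<le> \<bar>c\<bar> * H1_dual_norm \<Omega> F"
    by (simp add: abs_mult mult_left_mono)
qed

lemma H1_dual_norm_nonneg:
  assumes F: "F \<in> H1_dual \<Omega>"
  shows "0 \<le> H1_dual_norm \<Omega> F"
proof -
  have "\<bar>F (\<lambda>_. 0)\<bar> \<le> H1_dual_norm \<Omega> F"
    unfolding H1_dual_norm_def using H1.zero_mem H1.norm_zero by (intro cSUP_upper H1_dual_bdd F) auto
  then show ?thesis by linarith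
qed

lemma H1_dual_seminorm: "function_seminorm (H1_dual \<Omega>) (H1_dual_norm \<Omega>)"
proof
  show "(\<lambda>_. 0) \<in> H1_dual \<Omega>"
    by (auto simp: H1_dual_def intro!: exI[of _ 0])
  fix F assume F: "F \<in> H1_dual \<Omega>"
  show "(\<lambda>v. c * F v) \<in> H1_dual \<Omega>" for c
    by (rule H1_dual_scale[OF F])
  show "H1_dual_norm \<Omega> (\<lambda>v. c * F v) = \<bar>c\<bar> * H1_dual_norm \<Omega> F" for c
  proof (rule antisym[OF H1_dual_scale_norm_le[OF F]])
    show "\<bar>c\<bar> * H1_dual_norm \<Omega> F \<le> H1_dual_norm \<Omega> (\<lambda>v. c * F v)"
    proof (cases "c = 0")
      case True
      then show ?thesis
        using H1_dual_norm_nonneg[OF H1_dual_scale[OF F, of 0]] by simp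
    next
      case False
      then show ?thesis
        using H1_dual_scale_norm_le[OF H1_dual_scale[OF F, of c], of "1 / c"]
        by (simp add: pos_le_divide_eq mult.commute)
    qed
  qed
  fix G assume G: "G \<in> H1_dual \<Omega>"
  show "(\<lambda>v. F v + G v) \<in> H1_dual \<Omega>"
    by (rule H1_dual_add[OF F G])
  show "H1_dual_norm \<Omega> (\<lambda>v. F v + G v) \<le> H1_dual_norm \<Omega> F + H1_dual_norm \<Omega> G"
  proof (rule H1_dual_norm_le)
    fix v assume v: "v \<in> H1 \<Omega>" "H1_norm \<Omega> v \<le> 1"
    have "\<bar>F v\<bar> \<le> H1_dual_norm \<Omega> F" "\<bar>G v\<bar> \<le> H1_dual_norm \<Omega> G"
      unfolding H1_dual_norm_def using v by (auto intro!: cSUP_upper H1_dual_bdd F G)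
    then show "\<bar>F v + G v\<bar> \<le> H1_dual_norm \<Omega> F + H1_dual_norm \<Omega> G"
      by simp
  qed
qed

interpretation D: function_seminorm "H1_dual \<Omega>" "H1_dual_norm \<Omega>"
  by (rule H1_dual_seminorm)

lemma borel_measurable_H1_dual_eval:
  fixes w :: "'t::euclidean_space \<Rightarrow> ('a \<Rightarrow> real) \<Rightarrow> real"
  assumes "S \<in> sets lebesgue" "strongly_measurable (lebesgue_on S) (H1_dual \<Omega>) (H1_dual_norm \<Omega>) w"
    and v: "v \<in> H1 \<Omega>"
  shows "(\<lambda>t. w t v) \<in> borel_measurable (lebesgue_on S)"
proof (rule borel_measurable_strongly_measurable[OF assms(1,2)])
  fix F G assume "F \<in> H1_dual \<Omega>" "G \<in> H1_dual \<Omega>"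
  then show "\<bar>F v - G v\<bar> \<le> H1_norm \<Omega> v * H1_dual_norm \<Omega> (\<lambda>x. F x - G x)"
    using H1_dual_bound[OF D.diff_mem v] by (simp add: mult.commute)
qed

lemma has_integral_in_H1_dual_eval:
  fixes w :: "'t::euclidean_space \<Rightarrow> ('a \<Rightarrow> real) \<Rightarrow> real"
  assumes S: "S \<in> lmeasurable" and v: "v \<in> H1 \<Omega>"
    and w: "has_integral_in (lebesgue_on S) (H1_dual \<Omega>) (H1_dual_norm \<Omega>) w J"
  shows "integrable (lebesgue_on S) (\<lambda>t. w t v)" "(LINT t|lebesgue_on S. w t v) = J v"
proof -
  let ?M = "lebesgue_on S"
  interpret finite_measure ?M
    using S by (rule finite_measure_lebesgue_on)
  have Sl: "S \<in> sets lebesgue"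
    using S by (auto simp: fmeasurable_def)
  obtain s where w_meas: "strongly_measurable ?M (H1_dual \<Omega>) (H1_dual_norm \<Omega>) w" and J: "J \<in> H1_dual \<Omega>"
    and s: "\<And>k::nat. simple_in ?M (H1_dual \<Omega>) (s k)"
    and lim: "(\<lambda>k. \<integral>\<^sup>+t. ennreal (H1_dual_norm \<Omega> (\<lambda>x. w t x - s k t x)) \<partial>?M) \<longlonglongrightarrow> 0"
    and J_lim: "(\<lambda>k. H1_dual_norm \<Omega> (\<lambda>x. J x - (LINT t|?M. s k t x))) \<longlonglongrightarrow> 0"
    using w unfolding has_integral_in_def by blast
  have [measurable]: "(\<lambda>t. w t v) \<in> borel_measurable ?M"
    by (rule borel_measurable_H1_dual_eval[OF Sl w_meas v])
  have [measurable]: "(\<lambda>t. H1_dual_norm \<Omega> (\<lambda>x. w t x - s k t x)) \<in> borel_measurable ?M" for k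
    by (rule D.norm_measurable[OF Sl D.strongly_measurable_diff_simple[OF w_meas s]])
  have s_int: "integrable ?M (\<lambda>t. s k t x)" for k x
  proof (rule integrable_simple_function)
    show "simple_function ?M (\<lambda>t. s k t x)"
      by (rule strongly_measurable_simple[OF s])
    show "emeasure ?M {t \<in> space ?M. s k t x \<noteq> 0} \<noteq> \<infinity>"
      by (simp add: emeasure_eq_measure)
  qed
  have s_mem: "(\<lambda>x. LINT t|?M. s k t x) \<in> H1_dual \<Omega>" for k
  proof -
    have sf: "simple_function ?M (s k)"
      using s[of k] by (simp add: simple_in_def)
    have sets: "s k -` {F} \<inter> space ?M \<in> sets ?M" for F
      using simple_functionD(2)[OF sf] .
    have "(LINT t|?M. s k t x) = (\<Sum>F\<in>s k ` space ?M. measure ?M (s k -` {F} \<inter> space ?M) * F x)" for x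
    proof -
      have "(LINT t|?M. s k t x) = (LINT t|?M. (\<Sum>F\<in>s k ` space ?M. indicator (s k -` {F} \<inter> space ?M) t * F x))"
        by (intro Bochner_Integration.integral_cong refl simple_function_sum_representation[OF sf])
      also have "\<dots> = (\<Sum>F\<in>s k ` space ?M. (LINT t|?M. indicator (s k -` {F} \<inter> space ?M) t * F x))"
        using sets by (intro Bochner_Integration.integral_sum integrable_mult_left integrable_real_indicator)
          (auto simp: emeasure_eq_measure)
      also have "\<dots> = (\<Sum>F\<in>s k ` space ?M. measure ?M (s k -` {F} \<inter> space ?M) * F x)"
        using sets by (intro sum.cong) auto
      finally show ?thesis .
    qed
    moreover have "(\<lambda>x. \<Sum>F\<in>s k ` space ?M. measure ?M (s k -` {F} \<inter> space ?M) * F x) \<in> H1_dual \<Omega>"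
      using simple_functionD(1)[OF sf] strongly_measurable_simple(2)[OF s]
      by (intro D.sum_mem D.scale_mem) auto
    ultimately show ?thesis by simp
  qed
  have diff: "(\<lambda>k. \<integral>\<^sup>+t. ennreal (norm (s k t v - w t v)) \<partial>?M) \<longlonglongrightarrow> 0"
  proof (rule tendsto_sandwich[OF _ _ tendsto_const])
    let ?n = "\<lambda>k. \<integral>\<^sup>+t. ennreal (H1_dual_norm \<Omega> (\<lambda>x. w t x - s k t x)) \<partial>?M"
    show "(\<lambda>k. ennreal (H1_norm \<Omega> v) * ?n k) \<longlonglongrightarrow> 0"
      using tendsto_mult_ennreal[OF tendsto_const lim, of "ennreal (H1_norm \<Omega> v)"] by simp
    have "(\<integral>\<^sup>+t. ennreal (norm (s k t v - w t v)) \<partial>?M) \<le> ennreal (H1_norm \<Omega> v) * ?n k" for k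
    proof -
      have "AE t in ?M. ennreal (norm (s k t v - w t v)) \<le>
          ennreal (H1_norm \<Omega> v) * ennreal (H1_dual_norm \<Omega> (\<lambda>x. w t x - s k t x))"
        using strongly_measurable_AE_mem[OF w_meas] AE_space
      proof eventually_elim
        case (elim t)
        have m: "(\<lambda>x. w t x - s k t x) \<in> H1_dual \<Omega>"
          using elim strongly_measurable_simple(2)[OF s] by (intro D.diff_mem) auto
        show ?case
          using H1_dual_bound[OF m v] H1.norm_nonneg[OF v] D.norm_nonneg[OF m]
          by (simp add: abs_minus_commute mult.commute flip: ennreal_mult)
      qed
      then have "(\<integral>\<^sup>+t. ennreal (norm (s k t v - w t v)) \<partial>?M) \<le>
          (\<integral>\<^sup>+t. ennreal (H1_norm \<Omega> v) * ennreal (H1_dual_norm \<Omega> (\<lambda>x. w t x - s k t x)) \<partial>?M)"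
        by (rule nn_integral_mono_AE)
      also have "\<dots> = ennreal (H1_norm \<Omega> v) * ?n k"
        by (rule nn_integral_cmult) measurable
      finally show ?thesis .
    qed
    then show "\<forall>\<^sub>F k in sequentially. (\<integral>\<^sup>+t. ennreal (norm (s k t v - w t v)) \<partial>?M) \<le> ennreal (H1_norm \<Omega> v) * ?n k"
      by simp
  qed simp
  show int: "integrable ?M (\<lambda>t. w t v)"
  proof -
    have "\<forall>\<^sub>F k in sequentially. (\<integral>\<^sup>+t. ennreal (norm (s k t v - w t v)) \<partial>?M) < 1"
      using diff by (intro order_tendstoD(2)) auto
    then obtain k where k: "(\<integral>\<^sup>+t. ennreal (norm (s k t v - w t v)) \<partial>?M) < 1"
      by (auto simp: eventually_sequentially)
    have [measurable]: "(\<lambda>t. s k t v) \<in> borel_measurable ?M"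
      using s_int by auto
    have "integrable ?M (\<lambda>t. s k t v - w t v)"
      using k by (intro integrableI_bounded) (auto intro: less_trans)
    from Bochner_Integration.integrable_diff[OF s_int[of k v] this] show ?thesis by simp
  qed
  have "(\<lambda>k. LINT t|?M. s k t v) \<longlonglongrightarrow> (LINT t|?M. w t v)"
    by (rule tendsto_L1_int[OF s_int int diff])
  moreover have "(\<lambda>k. LINT t|?M. s k t v) \<longlonglongrightarrow> J v"
  proof -
    have "(\<lambda>k. (LINT t|?M. s k t v) - J v) \<longlonglongrightarrow> 0"
    proof (rule Lim_null_comparison)
      show "(\<lambda>k. H1_dual_norm \<Omega> (\<lambda>x. J x - (LINT t|?M. s k t x)) * H1_norm \<Omega> v) \<longlonglongrightarrow> 0"
        using tendsto_mult_right[OF J_lim, of "H1_norm \<Omega> v"] by simp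
      show "\<forall>\<^sub>F k in sequentially. norm ((LINT t|?M. s k t v) - J v) \<le>
          H1_dual_norm \<Omega> (\<lambda>x. J x - (LINT t|?M. s k t x)) * H1_norm \<Omega> v"
        using H1_dual_bound[OF D.diff_mem[OF J s_mem] v] by (auto simp: abs_minus_commute)
    qed
    then show ?thesis by (simp add: LIM_zero_iff)
  qed
  ultimately show "(LINT t|?M. w t v) = J v"
    by (rule LIMSEQ_unique)
qed

end

section \<open>Jointly measurable representatives\<close>

lemma simple_L2_joint_version:
  fixes s :: "real \<Rightarrow> 'a::euclidean_space \<Rightarrow> real"
  assumes s: "simple_in (lebesgue_on S) (L2 \<Omega>) s" and S: "S \<in> sets lebesgue" and \<Omega>: "\<Omega> \<in> sets lebesgue"
  obtains B where "B \<in> borel_measurable borel"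
    "AE t in lebesgue_on S. AE x in lebesgue_on \<Omega>. B (t, x) = s t x"
proof -
  let ?M = "lebesgue_on S"
  have sf: "simple_function ?M s" and R: "s ` space ?M \<subseteq> L2 \<Omega>"
    using s by (auto simp: simple_in_def)
  define A where "A v = s -` {v} \<inter> space ?M" for v
  have "A v \<in> sets lebesgue" for v
    using simple_functionD(2)[OF sf] S by (auto simp: A_def sets_restrict_space_iff)
  then have "(\<lambda>t. indicator (A v) t :: real) \<in> borel_measurable lebesgue" for v
    by simp
  then have "\<exists>a. a \<in> borel_measurable lborel \<and> (AE t in lborel. indicator (A v) t = (a t :: real))" for v
    using completion_ex_borel_measurable_real by blast
  then obtain a :: "('a \<Rightarrow> real) \<Rightarrow> real \<Rightarrow> real" where a: "\<And>v. a v \<in> borel_measurable lborel"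
    "\<And>v. AE t in lborel. indicator (A v) t = a v t"
    by metis
  have "\<exists>c. c \<in> borel_measurable lborel \<and> (AE x in lborel. indicator \<Omega> x *\<^sub>R v x = (c x :: real))" if "v \<in> L2 \<Omega>" for v
  proof -
    have "(\<lambda>x. indicator \<Omega> x *\<^sub>R v x) \<in> borel_measurable lebesgue"
      using L2_measurable[OF that] \<Omega> by (subst (asm) borel_measurable_restrict_space_iff) auto
    then show ?thesis
      using completion_ex_borel_measurable_real by blast
  qed
  then obtain c where c: "\<And>v. v \<in> L2 \<Omega> \<Longrightarrow> c v \<in> borel_measurable lborel"
    "\<And>v. v \<in> L2 \<Omega> \<Longrightarrow> AE x in lborel. indicator \<Omega> x *\<^sub>R v x = c v x"
    by metis
  define B where "B z = (\<Sum>v\<in>s ` space ?M. a v (fst z) * c v (snd z))" for z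
  have "B \<in> borel_measurable (borel \<Otimes>\<^sub>M borel)"
    unfolding B_def
  proof (rule borel_measurable_sum)
    fix v assume "v \<in> s ` space ?M"
    then have [measurable]: "a v \<in> borel_measurable borel" "c v \<in> borel_measurable borel"
      using a(1) c(1) R by auto
    show "(\<lambda>z. a v (fst z) * c v (snd z)) \<in> borel_measurable (borel \<Otimes>\<^sub>M borel)"
      by measurable
  qed
  then have "B \<in> borel_measurable borel"
    by (simp add: borel_prod)
  moreover have "AE t in ?M. AE x in lebesgue_on \<Omega>. B (t, x) = s t x"
  proof -
    have fin: "countable (s ` space ?M)"
      using simple_functionD(1)[OF sf] by (rule countable_finite)
    have "AE t in lborel. \<forall>v\<in>s ` space ?M. indicator (A v) t = a v t"
      unfolding AE_ball_countable[OF fin] using a(2) by blast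
    then have at: "AE t in ?M. \<forall>v\<in>s ` space ?M. indicator (A v) t = a v t"
      unfolding AE_lebesgue_on_iff[OF S] by eventually_elim blast
    have "AE x in lborel. \<forall>v\<in>s ` space ?M. indicator \<Omega> x *\<^sub>R v x = c v x"
      unfolding AE_ball_countable[OF fin] using c(2) R by blast
    then have cx: "AE x in lebesgue_on \<Omega>. \<forall>v\<in>s ` space ?M. v x = c v x"
      unfolding AE_lebesgue_on_iff[OF \<Omega>] by eventually_elim (metis indicator_simps(1) scaleR_one)
    show ?thesis
      using at AE_space
    proof eventually_elim
      case (elim t)
      show ?case
        using cx
      proof eventually_elim
        case (elim x)
        have "s t x = (\<Sum>v\<in>s ` space ?M. indicator (A v) t * v x)"
          unfolding A_def using simple_function_sum_representation[OF sf \<open>t \<in> space ?M\<close>] .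
        also have "\<dots> = B (t, x)"
          unfolding B_def fst_conv snd_conv
          using elim \<open>\<forall>v\<in>s ` space ?M. indicator (A v) t = a v t\<close> by (intro sum.cong) auto
        finally show ?case ..
      qed
    qed
  qed
  ultimately show ?thesis
    using that by blast
qed

lemma strongly_measurable_joint_version:
  fixes u :: "real \<Rightarrow> 'a::euclidean_space \<Rightarrow> real"
  assumes u: "strongly_measurable (lebesgue_on S) (L2 \<Omega>) (L2_norm \<Omega>) u"
    and S: "S \<in> lmeasurable" and \<Omega>: "\<Omega> \<in> sets lebesgue"
  obtains B where "B \<in> borel_measurable borel"
    "AE t in lebesgue_on S. AE x in lebesgue_on \<Omega>. B (t, x) = u t x"
proof -
  let ?M = "lebesgue_on S"
  interpret finite_measure ?M
    using S by (rule finite_measure_lebesgue_on)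
  have Sl: "S \<in> sets lebesgue"
    using S by (auto simp: fmeasurable_def)
  obtain s where s: "\<And>k. simple_in ?M (L2 \<Omega>) (s k)"
    and lim: "AE t in ?M. u t \<in> L2 \<Omega> \<and> (\<lambda>k::nat. L2_norm \<Omega> (\<lambda>x. u t x - s k t x)) \<longlonglongrightarrow> 0"
    using u unfolding strongly_measurable_def by blast
  define d where "d k t = min 1 (L2_norm \<Omega> (\<lambda>x. u t x - s k t x))" for k t
  have d0: "0 \<le> d k t" for k t
    by (simp add: d_def L2_norm_nonneg)
  have [measurable]: "(\<lambda>t. L2_norm \<Omega> (\<lambda>x. u t x - s k t x)) \<in> borel_measurable ?M" for k
    by (rule L2N.norm_measurable[OF Sl L2N.strongly_measurable_diff_simple[OF u s]])
  have d_meas [measurable]: "d k \<in> borel_measurable ?M" for k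
    unfolding d_def by measurable
  have d_int: "integrable ?M (d k)" for k
    by (rule integrable_const_bound[where B = 1]) (auto simp: d_def L2_norm_nonneg)
  have "(\<lambda>k. LINT t|?M. d k t) \<longlonglongrightarrow> (LINT t|?M. 0)"
  proof (rule integral_dominated_convergence[where w = "\<lambda>_. 1"])
    show "AE t in ?M. (\<lambda>k. d k t) \<longlonglongrightarrow> 0"
      using lim
    proof eventually_elim
      case (elim t)
      have "(\<lambda>k. d k t) \<longlonglongrightarrow> min 1 0"
        unfolding d_def using elim by (intro tendsto_min tendsto_const) auto
      then show ?case by simp
    qed
  qed (auto simp: d_def L2_norm_nonneg)
  then have "\<exists>k. (LINT t|?M. d k t) < (1 / 2) ^ j" for j
  proof -
    assume "(\<lambda>k. LINT t|?M. d k t) \<longlonglongrightarrow> (LINT t|?M. 0)"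
    then have "\<forall>\<^sub>F k in sequentially. (LINT t|?M. d k t) < (1 / 2) ^ j"
      by (intro order_tendstoD(2)) auto
    then show ?thesis by (auto simp: eventually_sequentially)
  qed
  then obtain r where r: "\<And>j. (LINT t|?M. d (r j) t) < (1 / 2) ^ j"
    by metis
  have "summable (\<lambda>j. LINT t|?M. d (r j) t)"
    by (rule summable_comparison_test[OF _ summable_geometric[of "1 / 2 :: real"]])
      (use r d0 in \<open>auto intro!: exI[of _ 0] less_imp_le simp: integral_nonneg\<close>)
  then have sum_d: "AE t in ?M. summable (\<lambda>j. d (r j) t)"
    by (intro AE_summable d_int d0)
  have "\<forall>j. \<exists>B. B \<in> borel_measurable borel \<and> (AE t in ?M. AE x in lebesgue_on \<Omega>. B (t, x) = s (r j) t x)"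
    by (intro allI, rule simple_L2_joint_version[OF s Sl \<Omega>]) blast
  from choice[OF this] obtain B where
    Bj: "\<forall>j. B j \<in> borel_measurable borel \<and> (AE t in ?M. AE x in lebesgue_on \<Omega>. B j (t, x) = s (r j) t x)"
    by blast
  have B: "B j \<in> borel_measurable borel" "AE t in ?M. AE x in lebesgue_on \<Omega>. B j (t, x) = s (r j) t x" for j
    using spec[OF Bj, of j] by (rule conjunct1, rule conjunct2)
  have allB: "AE t in ?M. \<forall>j. AE x in lebesgue_on \<Omega>. B j (t, x) = s (r j) t x"
    unfolding AE_all_countable using B(2) by blast
  have "AE t in ?M. AE x in lebesgue_on \<Omega>. lim (\<lambda>j. B j (t, x)) = u t x"
    using lim sum_d allB AE_space
  proof eventually_elim
    case (elim t)
    have mem: "(\<lambda>x. u t x - s (r j) t x) \<in> L2 \<Omega>" for j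
      using elim strongly_measurable_simple(2)[OF s] by (intro L2_diff) auto
    have "\<forall>\<^sub>F j in sequentially. d (r j) t < 1"
      using summable_LIMSEQ_zero[OF elim(2)] by (intro order_tendstoD(2)) auto
    then have "\<forall>\<^sub>F j in sequentially. norm ((L2_norm \<Omega> (\<lambda>x. u t x - s (r j) t x))\<^sup>2) \<le> d (r j) t"
    proof eventually_elim
      case (elim j)
      then have "L2_norm \<Omega> (\<lambda>x. u t x - s (r j) t x) = d (r j) t"
        by (auto simp: d_def)
      moreover have "(d (r j) t)\<^sup>2 \<le> d (r j) t"
        using elim d0[of "r j" t] by (simp add: power2_eq_square mult_left_le)
      ultimately show ?case by simp
    qed
    then have "summable (\<lambda>j. (L2_norm \<Omega> (\<lambda>x. u t x - s (r j) t x))\<^sup>2)"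
      using elim(2) by (rule summable_comparison_test_ev)
    then have "AE x in lebesgue_on \<Omega>. summable (\<lambda>j. (u t x - s (r j) t x)\<^sup>2)"
      using mem by (intro AE_summable) (auto simp: L2_norm_squared L2_def)
    moreover have "AE x in lebesgue_on \<Omega>. \<forall>j. B j (t, x) = s (r j) t x"
      unfolding AE_all_countable using elim(3) by blast
    ultimately show ?case
    proof eventually_elim
      case (elim x)
      have "(\<lambda>j. (u t x - s (r j) t x)\<^sup>2) \<longlonglongrightarrow> 0"
        using elim(1) by (rule summable_LIMSEQ_zero)
      from tendsto_real_sqrt[OF this] have "(\<lambda>j. u t x - s (r j) t x) \<longlonglongrightarrow> 0"
        by (simp add: tendsto_rabs_zero_iff)
      from tendsto_diff[OF tendsto_const[of "u t x"] this] have "(\<lambda>j. s (r j) t x) \<longlonglongrightarrow> u t x"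
        by simp
      then show ?case
        using elim(2) by (simp add: limI)
    qed
  qed
  moreover have "(\<lambda>z. lim (\<lambda>j. B j z)) \<in> borel_measurable borel"
    using B(1) by measurable
  ultimately show ?thesis
    using that by blast
qed

lemma nonneg_aeI:
  fixes \<Omega> :: "'a::euclidean_space set"
  assumes B: "B \<in> borel_measurable borel"
    and eq: "AE t in lebesgue_on I. AE x in lebesgue_on \<Omega>. B (t, x) = u t x"
    and nonneg: "AE t in lebesgue_on I. AE x in lebesgue_on \<Omega>. 0 \<le> u t x"
  shows "nonneg_ae I \<Omega> u"
  unfolding nonneg_ae_def
proof (intro bexI conjI)
  show "(\<lambda>z. max 0 (B z)) \<in> borel_measurable (lebesgue_on (I \<times> \<Omega>))"
    using B by (intro measurable_restrict_space1 measurable_completion) auto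
  show "AE t in lebesgue_on I. AE x in lebesgue_on \<Omega>. max 0 (B (t, x)) = u t x"
    using eq nonneg
  proof eventually_elim
    case (elim t)
    from elim(1,2) show ?case
      by eventually_elim auto
  qed
qed auto

section \<open>Tensor products as test functions\<close>

lemma tensor_product_test_function:
  fixes \<Omega> :: "'a::euclidean_space set"
  assumes \<Omega>: "open \<Omega>" and \<eta>: "continuous_on UNIV \<eta>" "\<And>t. 0 \<le> \<eta> t" and p: "p \<in> H1 \<Omega>" "\<And>x. 0 \<le> p x"
  shows "(\<lambda>t x. \<eta> t * p x) \<in> L2_V T \<Omega> \<inter> C_H T \<Omega>" "nonneg_ae {0<..<T} \<Omega> (\<lambda>t x. \<eta> t * p x)"
proof -
  interpret H1: function_seminorm "H1 \<Omega>" "H1_norm \<Omega>"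
    using \<Omega> by (rule H1_seminorm)
  let ?M = "lebesgue_on {0<..<T}"
  interpret finite_measure ?M
    by (rule finite_measure_lebesgue_on) simp
  have [measurable]: "\<eta> \<in> borel_measurable ?M"
    by (rule continuous_imp_measurable_lebesgue_on[OF \<eta>(1)])
  note pL2 = H1_L2[OF p(1)]
  have sm: "strongly_measurable ?M (H1 \<Omega>) (H1_norm \<Omega>) (\<lambda>t x. \<eta> t * p x)"
    by (rule H1.strongly_measurable_scale[OF _ p(1)]) measurable
  have "bounded (\<eta> ` {0..T})"
    by (intro compact_imp_bounded compact_continuous_image continuous_on_subset[OF \<eta>(1)]) auto
  then obtain C where "\<forall>y\<in>\<eta> ` {0..T}. norm y \<le> C"
    unfolding bounded_iff by blast
  then have C: "\<bar>\<eta> t\<bar> \<le> C" if "t \<in> {0..T}" for t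
    using that by auto
  have "integrable ?M (\<lambda>t. (H1_norm \<Omega> (\<lambda>x. \<eta> t * p x))\<^sup>2)"
  proof (rule integrable_const_bound[where B = "(C * H1_norm \<Omega> p)\<^sup>2"])
    show "AE t in ?M. norm ((H1_norm \<Omega> (\<lambda>x. \<eta> t * p x))\<^sup>2) \<le> (C * H1_norm \<Omega> p)\<^sup>2"
      using C H1.norm_nonneg[OF p(1)]
      by (auto simp: H1.norm_scale[OF p(1)] intro!: AE_I2 power_mono mult_right_mono)
    show "(\<lambda>t. (H1_norm \<Omega> (\<lambda>x. \<eta> t * p x))\<^sup>2) \<in> borel_measurable ?M"
      by (simp add: H1.norm_scale[OF p(1)])
  qed
  then have V: "(\<lambda>t x. \<eta> t * p x) \<in> L2_V T \<Omega>"
    using sm by (simp add: L2_V_def Bochner_Lp_def)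
  have "(\<lambda>t x. \<eta> t * p x) \<in> C_H T \<Omega>"
    unfolding C_H_def
  proof (intro CollectI conjI ballI)
    show "(\<lambda>x. \<eta> t * p x) \<in> L2 \<Omega>" for t
      by (rule L2_scale[OF pL2])
    fix s assume "s \<in> {0..T}"
    have "(\<eta> \<longlongrightarrow> \<eta> s) (at s within {0..T})"
      using \<eta>(1) by (meson UNIV_I continuous_on_def subset_UNIV tendsto_within_subset)
    then have "((\<lambda>t. \<bar>\<eta> t - \<eta> s\<bar> * L2_norm \<Omega> p) \<longlongrightarrow> \<bar>\<eta> s - \<eta> s\<bar> * L2_norm \<Omega> p) (at s within {0..T})"
      by (intro tendsto_intros)
    moreover have "L2_norm \<Omega> (\<lambda>x. \<eta> t * p x - \<eta> s * p x) = \<bar>\<eta> t - \<eta> s\<bar> * L2_norm \<Omega> p" for t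
      using L2N.norm_scale[OF pL2, of "\<eta> t - \<eta> s"] by (simp add: left_diff_distrib)
    ultimately show "((\<lambda>t. L2_norm \<Omega> (\<lambda>x. \<eta> t * p x - \<eta> s * p x)) \<longlongrightarrow> 0) (at s within {0..T})"
      by simp
  qed
  with V show "(\<lambda>t x. \<eta> t * p x) \<in> L2_V T \<Omega> \<inter> C_H T \<Omega>" by simp
  have "strongly_measurable ?M (L2 \<Omega>) (L2_norm \<Omega>) (\<lambda>t x. \<eta> t * p x)"
    by (rule L2N.strongly_measurable_scale[OF _ pL2]) measurable
  then obtain B where "B \<in> borel_measurable borel"
    "AE t in ?M. AE x in lebesgue_on \<Omega>. B (t, x) = \<eta> t * p x"
    using strongly_measurable_joint_version[of "{0<..<T}" \<Omega>] \<Omega> by auto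
  then show "nonneg_ae {0<..<T} \<Omega> (\<lambda>t x. \<eta> t * p x)"
    by (rule nonneg_aeI) (simp add: \<eta> p)
qed

section \<open>Real functions of time\<close>

lemma lebesgue_on_subset:
  fixes f :: "'a::euclidean_space \<Rightarrow> real"
  assumes f: "integrable (lebesgue_on S) f" and K: "K \<subseteq> S" "K \<in> sets lebesgue" "S \<in> sets lebesgue"
  shows "integrable (lebesgue_on K) f"
    and "(\<And>x. 0 \<le> f x) \<Longrightarrow> (LINT x|lebesgue_on K. f x) \<le> (LINT x|lebesgue_on S. f x)"
proof -
  have fS: "integrable lebesgue (\<lambda>x. indicator S x *\<^sub>R f x)"
    using f K by (simp add: integrable_restrict_space)
  have "integrable lebesgue (\<lambda>x. (indicator S x *\<^sub>R f x) * indicator K x)"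
    by (rule integrable_real_mult_indicator[OF K(2) fS])
  moreover have "(indicator S x *\<^sub>R f x) * indicator K x = indicator K x *\<^sub>R f x" for x
    using K(1) by (auto simp: indicator_def)
  ultimately have fK: "integrable lebesgue (\<lambda>x. indicator K x *\<^sub>R f x)"
    by (simp only:)
  then show "integrable (lebesgue_on K) f"
    using K by (simp add: integrable_restrict_space)
  assume "\<And>x. 0 \<le> f x"
  then have "(LINT x|lebesgue. indicator K x *\<^sub>R f x) \<le> (LINT x|lebesgue. indicator S x *\<^sub>R f x)"
    using K(1) by (intro integral_mono fK fS) (auto simp: indicator_def)
  then show "(LINT x|lebesgue_on K. f x) \<le> (LINT x|lebesgue_on S. f x)"
    using K by (simp add: integral_restrict_space)
qed

lemma AE_lebesgue_on_subset:
  assumes "AE x in lebesgue_on S. P x" "K \<subseteq> S" "K \<in> sets lebesgue" "S \<in> sets lebesgue"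
  shows "AE x in lebesgue_on K. P x"
  using assms by (auto simp: AE_restrict_space_iff elim!: eventually_mono)

text \<open>Proved by averaging the hypothesis over \<open>r \<in> [h, \<tau> + h]\<close> with \<open>t = r - h\<close> and letting \<open>h \<rightarrow> 0\<close>.
  That it holds for \<open>t\<close> uniformly near \<open>r\<close> is essential: a bound for the left derivatives of \<open>G\<close> at almost
  every \<open>r\<close> would not exclude singular increments.\<close>

lemma increment_le_integral:
  fixes G \<rho> :: "real \<Rightarrow> real"
  assumes G: "continuous_on {0..T} G" and \<rho>: "integrable (lebesgue_on {0<..<T}) \<rho>" "\<And>r. 0 \<le> \<rho> r"
    and \<delta>: "0 < \<delta>"
    and le: "AE r in lebesgue_on {0<..<T}. \<forall>t. 0 < t \<and> t < r \<and> r < t + \<delta> \<longrightarrow>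
      G r - G t \<le> (r - t) * \<rho> r"
    and \<tau>: "0 < \<tau>" "\<tau> < T"
  shows "G \<tau> - G 0 \<le> (LINT r|lebesgue_on {0<..<T}. \<rho> r)"
proof -
  define R where "R = (LINT r|lebesgue_on {0<..<T}. \<rho> r)"
  define \<Gamma> where "\<Gamma> x = integral {0..x} G" for x
  have Gint: "G integrable_on {a..b}" if "0 \<le> a" "b \<le> T" for a b
    using that by (intro integrable_continuous_real continuous_on_subset[OF G]) auto
  have key: "\<Gamma> (\<tau> + h) - \<Gamma> \<tau> - \<Gamma> h \<le> h * R" if h: "0 < h" "\<tau> + h < T" "h < \<delta>" for h
  proof -
    let ?K = "{h..\<tau> + h}"
    have sub: "?K \<subseteq> {0<..<T}"
      using h by auto
    have cG: "continuous_on ?K G" "continuous_on ?K (\<lambda>r. G (r - h))"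
      using h by (auto intro!: continuous_on_subset[OF G] continuous_on_compose2[OF G] continuous_intros)
    have iK: "integrable (lebesgue_on ?K) (\<lambda>r. G r - G (r - h))"
      using cG by (intro continuous_imp_integrable_real continuous_on_diff)
    have \<rho>K: "integrable (lebesgue_on ?K) \<rho>"
      by (rule lebesgue_on_subset(1)[OF \<rho>(1) sub]) auto
    have "AE r in lebesgue_on ?K. \<forall>t. 0 < t \<and> t < r \<and> r < t + \<delta> \<longrightarrow> G r - G t \<le> (r - t) * \<rho> r"
      by (rule AE_lebesgue_on_subset[OF le sub]) auto
    moreover have "AE r in lebesgue_on ?K. r \<noteq> h"
      by (auto simp: AE_lebesgue_on_iff intro: eventually_mono[OF AE_lborel_singleton])
    ultimately have "AE r in lebesgue_on ?K. G r - G (r - h) \<le> h * \<rho> r"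
      using AE_space
    proof eventually_elim
      case (elim r)
      then show ?case
        using elim(1)[rule_format, of "r - h"] h by auto
    qed
    then have "(LINT r|lebesgue_on ?K. G r - G (r - h)) \<le> (LINT r|lebesgue_on ?K. h * \<rho> r)"
      using iK \<rho>K by (intro integral_mono_AE) auto
    also have "\<dots> \<le> h * R"
      unfolding R_def using h lebesgue_on_subset(2)[OF \<rho>(1) sub _ _ \<rho>(2)] by (simp add: mult_left_mono)
    also have "(LINT r|lebesgue_on ?K. G r - G (r - h)) = integral ?K (\<lambda>r. G r - G (r - h))"
      by (rule lebesgue_integral_eq_integral[OF iK]) auto
    also have "\<dots> = integral ?K G - integral ?K (\<lambda>r. G (r - h))"
      using cG by (intro Henstock_Kurzweil_Integration.integral_diff integrable_continuous_real)
    also have "integral ?K (\<lambda>r. G (r - h)) = \<Gamma> \<tau>"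
      using integral_shift_Icc_real[of h "\<tau> + h" G "- h"] by (simp add: o_def \<Gamma>_def)
    also have "integral ?K G = \<Gamma> (\<tau> + h) - \<Gamma> h"
      unfolding \<Gamma>_def using Henstock_Kurzweil_Integration.integral_combine[of 0 h "\<tau> + h" G] Gint[of 0 "\<tau> + h"] h \<tau> by simp
    finally show ?thesis by simp
  qed
  have deriv: "(\<Gamma> has_real_derivative G x) (at x within {0..T})" if "x \<in> {0..T}" for x
    unfolding \<Gamma>_def using G that by (rule integral_has_real_derivative)
  define c where "c = min (T - \<tau>) \<delta>"
  have c: "0 < c" "c \<le> T - \<tau>" "c \<le> \<delta>"
    using \<tau> \<delta> by (auto simp: c_def)
  define h where "h k = c / real (Suc (Suc k))" for k
  have h: "0 < h k" "\<tau> + h k < T" "h k < \<delta>" for k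
  proof -
    have "h k < c / 1"
      unfolding h_def using c by (intro divide_strict_left_mono) auto
    then show "0 < h k" "\<tau> + h k < T" "h k < \<delta>"
      using c by (auto simp: h_def)
  qed
  have h0: "h \<longlonglongrightarrow> 0"
    using LIMSEQ_Suc[OF LIMSEQ_Suc[OF lim_const_over_n[of c]]] by (simp add: h_def[abs_def])
  have lim: "(\<lambda>k. (\<Gamma> (x + h k) - \<Gamma> x) / h k) \<longlonglongrightarrow> G x" if x: "0 \<le> x" "x \<le> \<tau>" for x
  proof -
    have "((\<lambda>y. (\<Gamma> y - \<Gamma> x) / (y - x)) \<longlongrightarrow> G x) (at x within {0..T})"
      using deriv[of x] x \<tau> by (simp add: has_field_derivative_iff)
    moreover have "filterlim (\<lambda>k. x + h k) (at x within {0..T}) sequentially"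
      unfolding filterlim_at
    proof
      show "\<forall>\<^sub>F k in sequentially. x + h k \<in> {0..T} \<and> x + h k \<noteq> x"
      proof (intro always_eventually allI)
        fix k
        show "x + h k \<in> {0..T} \<and> x + h k \<noteq> x"
          using h[of k] x by simp
      qed
      show "(\<lambda>k. x + h k) \<longlonglongrightarrow> x"
        using tendsto_add[OF tendsto_const h0, of x] by simp
    qed
    ultimately have "(\<lambda>k. (\<Gamma> (x + h k) - \<Gamma> x) / (x + h k - x)) \<longlonglongrightarrow> G x"
      by (rule filterlim_compose)
    then show ?thesis by simp
  qed
  have "(\<Gamma> (\<tau> + h k) - \<Gamma> \<tau>) / h k - (\<Gamma> (0 + h k) - \<Gamma> 0) / h k \<le> R" for k
  proof -
    have "\<Gamma> 0 = 0" by (simp add: \<Gamma>_def)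
    then show ?thesis
      using key[OF h, of k] h(1)[of k] by (simp add: pos_divide_le_eq mult.commute flip: diff_divide_distrib)
  qed
  moreover have "(\<lambda>k. (\<Gamma> (\<tau> + h k) - \<Gamma> \<tau>) / h k - (\<Gamma> (0 + h k) - \<Gamma> 0) / h k) \<longlonglongrightarrow> G \<tau> - G 0"
    using \<tau> by (intro tendsto_diff lim) auto
  ultimately show ?thesis
    unfolding R_def by (intro LIMSEQ_le_const2) auto
qed

lemma integral_lebesgue_on_zero_outside:
  fixes f :: "'a::euclidean_space \<Rightarrow> real"
  assumes "K \<subseteq> S" "K \<in> sets lebesgue" "S \<in> sets lebesgue" "\<And>x. x \<notin> K \<Longrightarrow> f x = 0"
  shows "(LINT x|lebesgue_on S. f x) = (LINT x|lebesgue_on K. f x)"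
proof -
  have "(\<lambda>x. indicator S x *\<^sub>R f x) = (\<lambda>x. indicator K x *\<^sub>R f x)"
  proof
    fix x show "indicator S x *\<^sub>R f x = indicator K x *\<^sub>R f x"
      using assms(1) assms(4)[of x] by (cases "x \<in> K") auto
  qed
  moreover have "(LINT x|lebesgue_on S. f x) = (LINT x|lebesgue. indicator S x *\<^sub>R f x)"
    "(LINT x|lebesgue_on K. f x) = (LINT x|lebesgue. indicator K x *\<^sub>R f x)"
    using assms(2,3) integral_restrict_space[of _ lebesgue f] by simp_all
  ultimately show ?thesis
    by (simp only:)
qed

lemma integral_indicator_greaterThanLessThan:
  fixes f :: "real \<Rightarrow> real"
  assumes f: "integrable (lebesgue_on {0<..<T}) f" and tr: "0 \<le> t" "t < r" "r \<le> T"
  shows "(LINT s|lebesgue_on {0<..<T}. indicator {t<..<r} s * f s) = integral {t..r} f"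
proof -
  have sub: "{t<..<r} \<subseteq> {0<..<T}"
    using tr by auto
  have i: "integrable (lebesgue_on {t<..<r}) f"
    by (rule lebesgue_on_subset(1)[OF f sub]) auto
  have "(LINT s|lebesgue_on {0<..<T}. indicator {t<..<r} s * f s) =
      (LINT s|lebesgue_on {t<..<r}. indicator {t<..<r} s * f s)"
    by (rule integral_lebesgue_on_zero_outside[OF sub]) auto
  also have "\<dots> = (LINT s|lebesgue_on {t<..<r}. f s)"
    by (rule Bochner_Integration.integral_cong) auto
  also have "\<dots> = integral {t<..<r} f"
    by (rule lebesgue_integral_eq_integral[OF i]) auto
  also have "\<dots> = integral {t..r} f"
    by (simp add: integral_open_interval_real)
  finally show ?thesis .
qed

lemma increment_le_integral_sum:
  fixes G \<rho> \<psi> :: "real \<Rightarrow> real"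
  assumes G: "continuous_on {0..T} G" and \<rho>: "integrable (lebesgue_on {0<..<T}) \<rho>" "\<And>r. 0 \<le> \<rho> r"
    and \<psi>: "integrable (lebesgue_on {0<..<T}) \<psi>" "\<And>r. 0 \<le> \<psi> r" and \<delta>: "0 < \<delta>"
    and le: "AE r in lebesgue_on {0<..<T}. \<forall>t. 0 < t \<and> t < r \<and> r < t + \<delta> \<longrightarrow>
      G r - G t \<le> (LINT s|lebesgue_on {0<..<T}. indicator {t<..<r} s * \<psi> s) + (r - t) * \<rho> r"
    and \<tau>: "0 < \<tau>" "\<tau> < T"
  shows "G \<tau> - G 0 \<le> (LINT r|lebesgue_on {0<..<T}. \<psi> r) + (LINT r|lebesgue_on {0<..<T}. \<rho> r)"
proof -
  have "\<psi> integrable_on {0<..<T}"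
    by (rule integrable_on_lebesgue_on[OF \<psi>(1)]) simp
  then have \<psi>T: "\<psi> integrable_on {0..T}"
    by (simp add: integrable_on_open_interval_real)
  define H where "H x = G x - integral {0..x} \<psi>" for x
  have "continuous_on {0..T} H"
    unfolding H_def by (intro continuous_on_diff G indefinite_integral_continuous_1 \<psi>T)
  moreover have "AE r in lebesgue_on {0<..<T}. \<forall>t. 0 < t \<and> t < r \<and> r < t + \<delta> \<longrightarrow> H r - H t \<le> (r - t) * \<rho> r"
    using le AE_space
  proof eventually_elim
    case (elim r)
    show ?case
    proof (intro allI impI)
      fix t assume t: "0 < t \<and> t < r \<and> r < t + \<delta>"
      have "\<psi> integrable_on {0..r}"
        using elim by (intro integrable_on_subinterval[OF \<psi>T]) auto
      then have "integral {0..r} \<psi> = integral {0..t} \<psi> + integral {t..r} \<psi>"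
        using t Henstock_Kurzweil_Integration.integral_combine[of 0 t r \<psi>] by simp
      then show "H r - H t \<le> (r - t) * \<rho> r"
        using elim(1)[rule_format, OF t] t elim(2) integral_indicator_greaterThanLessThan[OF \<psi>(1), of t r]
        by (simp add: H_def)
    qed
  qed
  ultimately have "H \<tau> - H 0 \<le> (LINT r|lebesgue_on {0<..<T}. \<rho> r)"
    by (rule increment_le_integral[OF _ \<rho> \<delta> _ \<tau>])
  moreover have "integral {0..\<tau>} \<psi> \<le> (LINT r|lebesgue_on {0<..<T}. \<psi> r)"
  proof -
    have "integral {0..\<tau>} \<psi> = (LINT s|lebesgue_on {0<..<T}. indicator {0<..<\<tau>} s * \<psi> s)"
      using integral_indicator_greaterThanLessThan[OF \<psi>(1), of 0 \<tau>] \<tau> by simp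
    also have "\<dots> = (LINT s|lebesgue_on {0<..<\<tau>}. indicator {0<..<\<tau>} s * \<psi> s)"
      using \<tau> by (intro integral_lebesgue_on_zero_outside) auto
    also have "\<dots> = (LINT s|lebesgue_on {0<..<\<tau>}. \<psi> s)"
      by (rule Bochner_Integration.integral_cong) auto
    also have "\<dots> \<le> (LINT r|lebesgue_on {0<..<T}. \<psi> r)"
      using \<tau> by (intro lebesgue_on_subset(2)[OF \<psi>(1) _ _ _ \<psi>(2)]) auto
    finally show ?thesis .
  qed
  ultimately show ?thesis
    by (simp add: H_def)
qed

lemma box_cutoff_real: "box_cutoff c a b t = flat c 0 (t - a) * flat c 0 (b - t)" for t :: real
  by (simp add: box_cutoff_def)

lemma deriv_box_cutoff:
  fixes a b t :: real
  assumes c: "c > 0"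
  defines "D \<equiv> \<lambda>t. c * (flat c 2 (t - a) * flat c 0 (b - t) - flat c 0 (t - a) * flat c 2 (b - t))"
  shows "(box_cutoff c a b has_real_derivative D t) (at t)" "continuous_on UNIV D"
    "t \<le> (a + b) / 2 \<Longrightarrow> 0 \<le> D t" "(a + b) / 2 \<le> t \<Longrightarrow> D t \<le> 0" "t \<notin> {a..b} \<Longrightarrow> D t = 0"
proof -
  have f: "(flat c 0 has_real_derivative c * flat c 2 s) (at s)" for s
    using flat_has_derivative[OF c, of 0 s] by (simp add: numeral_2_eq_2)
  have "((\<lambda>t. flat c 0 (t - a)) has_real_derivative c * flat c 2 (t - a) * 1) (at t)"
    by (rule DERIV_chain2[OF f]) (auto intro!: derivative_eq_intros)
  moreover have "((\<lambda>t. flat c 0 (b - t)) has_real_derivative c * flat c 2 (b - t) * - 1) (at t)"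
    by (rule DERIV_chain2[OF f]) (auto intro!: derivative_eq_intros)
  ultimately have *: "(box_cutoff c a b has_real_derivative
      (c * flat c 2 (t - a)) * flat c 0 (b - t) + (c * flat c 2 (b - t) * - 1) * flat c 0 (t - a)) (at t)"
    unfolding box_cutoff_real[abs_def]
    using DERIV_mult by fastforce
  then show "(box_cutoff c a b has_real_derivative D t) (at t)"
    by (simp add: D_def algebra_simps)
  have cont: "continuous_on UNIV (flat c m)" for m
    using Ck_flat[OF c, of 0 m] by simp
  show "continuous_on UNIV D"
    unfolding D_def
    by (intro continuous_intros continuous_on_compose2[OF cont]) auto
  show "t \<notin> {a..b} \<Longrightarrow> D t = 0"
    by (auto simp: D_def flat_def)
  have sq: "flat c 2 s = flat c 0 s / s\<^sup>2" for s
    by (simp add: flat_def)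
  have D: "D t = c * (flat c 0 (t - a) * flat c 0 (b - t)) * (1 / (t - a)\<^sup>2 - 1 / (b - t)\<^sup>2)" for t
    by (simp add: D_def sq algebra_simps)
  have nn: "0 \<le> c * (flat c 0 (t - a) * flat c 0 (b - t))"
    using c flat_bounds[OF c] by (intro mult_nonneg_nonneg) auto
  show "0 \<le> D t" if t: "t \<le> (a + b) / 2"
  proof (cases "a < t")
    case True
    then have "1 / (b - t)\<^sup>2 \<le> 1 / (t - a)\<^sup>2"
      using t by (intro divide_left_mono power_mono mult_pos_pos zero_less_power) (auto simp: field_simps)
    then show ?thesis
      unfolding D by (intro mult_nonneg_nonneg nn) simp
  qed (simp add: D flat_def)
  show "D t \<le> 0" if t: "(a + b) / 2 \<le> t"
  proof (cases "t < b")
    case True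
    then have "1 / (t - a)\<^sup>2 \<le> 1 / (b - t)\<^sup>2"
      using t by (intro divide_left_mono power_mono mult_pos_pos zero_less_power) (auto simp: field_simps)
    then show ?thesis
      unfolding D by (intro mult_nonneg_nonpos nn) simp
  qed (simp add: D flat_def)
qed

text \<open>The derivatives of the cutoffs of \<open>(a, b)\<close> tend to \<open>\<delta>\<^sub>a - \<delta>\<^sub>b\<close>: this is integration by parts
  for polynomials, and the derivatives have total variation at most 2.\<close>

lemma deriv_box_cutoff_tendsto:
  fixes g :: "real \<Rightarrow> real"
  assumes ab: "a < b" and g: "continuous_on {a..b} g"
  shows "(\<lambda>k. LINT t|lebesgue_on {a..b}. deriv (box_cutoff (1 / Suc k) a b) t * g t) \<longlonglongrightarrow> g a - g b"
proof (rule LIMSEQ_I)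
  fix e :: real assume "e > 0"
  define c where "c k = 1 / real (Suc k)" for k
  have c: "c k > 0" for k by (simp add: c_def)
  define D where "D k t = c k * (flat (c k) 2 (t - a) * flat (c k) 0 (b - t) - flat (c k) 0 (t - a) * flat (c k) 2 (b - t))" for k t
  define F where "F k = box_cutoff (c k) a b" for k
  note D = deriv_box_cutoff[OF c, where a = a and b = b, folded D_def F_def]
  have dF: "deriv (F k) t = D k t" for k t
    using D(1) by (rule DERIV_imp_deriv)
  have contD: "continuous_on S (D k)" for k S
    using D(2) continuous_on_subset by blast
  have F01: "0 \<le> F k t" "F k t \<le> 1" for k t
    using box_cutoff_bounds[OF c] by (auto simp: F_def)
  have F0: "F k a = 0" "F k b = 0" for k
    by (auto simp: F_def box_cutoff_real flat_def)
  have contF: "continuous_on S (F k)" for k S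
    using D(1) by (meson DERIV_isCont continuous_at_imp_continuous_on)
  let ?m = "(a + b) / 2"
  obtain p where p: "real_polynomial_function p" "\<And>x. x \<in> {a..b} \<Longrightarrow> \<bar>g x - p x\<bar> < e / 8"
    using Stone_Weierstrass_real_polynomial_function[OF _ g, of "e / 8"] \<open>e > 0\<close> by auto
  obtain p' where p': "real_polynomial_function p'" "\<And>x. (p has_real_derivative p' x) (at x)"
    using has_real_derivative_polynomial_function[OF p(1)] by blast
  have contp: "continuous_on S p" "continuous_on S p'" for S
    using p(1) p'(1) by (auto intro: continuous_on_polymonial_function simp: real_polynomial_function_eq)
  have int: "integrable (lebesgue_on {a..b}) f" if "continuous_on {a..b} f" for f :: "real \<Rightarrow> real"
    using that by (rule continuous_imp_integrable_real)
  have int_eq: "(LINT t|lebesgue_on {a..b}. f t) = integral {a..b} f" if "continuous_on {a..b} f" for f :: "real \<Rightarrow> real"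
    using int[OF that] by (rule lebesgue_integral_eq_integral) simp
  have FTC: "(f' has_integral f y - f x) {x..y}"
    if "x \<le> y" "\<And>t. (f has_real_derivative f' t) (at t)" for f f' :: "real \<Rightarrow> real" and x y
  proof (rule fundamental_theorem_of_calculus[OF that(1)])
    show "(f has_vector_derivative f' t) (at t within {x..y})" for t
      using has_field_derivative_at_within[OF that(2)]
      by (simp only: has_real_derivative_iff_has_vector_derivative)
  qed
  have parts: "(LINT t|lebesgue_on {a..b}. D k t * p t) = - (LINT t|lebesgue_on {a..b}. F k t * p' t)" for k
  proof -
    have "((\<lambda>t. D k t * p t + p' t * F k t) has_integral F k b * p b - F k a * p a) {a..b}"
      using ab by (intro FTC DERIV_mult D(1) p'(2)) simp
    then have "(LINT t|lebesgue_on {a..b}. D k t * p t + p' t * F k t) = 0"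
      by (subst int_eq) (auto simp: F0 integral_unique intro!: continuous_intros contD contp contF)
    then show ?thesis
      by (subst (asm) Bochner_Integration.integral_add)
        (auto intro!: int continuous_intros contD contp contF simp: mult.commute)
  qed
  have "(\<lambda>k. LINT t|lebesgue_on {a..b}. F k t * p' t) \<longlonglongrightarrow> (LINT t|lebesgue_on {a..b}. p' t)"
  proof (rule integral_dominated_convergence[where w = "\<lambda>t. \<bar>p' t\<bar>"])
    have "AE t in lebesgue_on {a..b}. t \<in> box a b"
      using AE_cbox_diff_box[of a b] by (subst AE_lebesgue_on_iff) (simp, simp only: cbox_interval)
    then show "AE t in lebesgue_on {a..b}. (\<lambda>k. F k t * p' t) \<longlonglongrightarrow> p' t"
    proof eventually_elim
      case (elim t)
      have "(\<lambda>k. F k t) \<longlonglongrightarrow> 1"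
        using box_cutoff_tendsto[of a b t] elim by (simp add: F_def c_def)
      from tendsto_mult[OF this tendsto_const[of "p' t"]] show ?case by simp
    qed
    show "AE t in lebesgue_on {a..b}. norm (F k t * p' t) \<le> \<bar>p' t\<bar>" for k
      using F01[of k] by (auto simp: abs_mult intro!: AE_I2 mult_left_le_one_le)
    show "integrable (lebesgue_on {a..b}) (\<lambda>t. \<bar>p' t\<bar>)"
      using contp by (intro int continuous_intros)
    show "(\<lambda>t. F k t * p' t) \<in> borel_measurable (lebesgue_on {a..b})" for k
      by (intro borel_measurable_integrable int continuous_intros contp contF)
    show "p' \<in> borel_measurable (lebesgue_on {a..b})"
      by (intro borel_measurable_integrable int contp)
  qed
  also have "(LINT t|lebesgue_on {a..b}. p' t) = p b - p a"
  proof -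
    have "(p' has_integral p b - p a) {a..b}"
      using ab by (intro FTC p'(2)) simp
    then show ?thesis
      using contp by (simp add: int_eq integral_unique)
  qed
  finally have "(\<lambda>k. LINT t|lebesgue_on {a..b}. F k t * p' t) \<longlonglongrightarrow> p b - p a" .
  from LIMSEQ_D[OF this, of "e / 4"] \<open>e > 0\<close> obtain k0 where
    "\<forall>k\<ge>k0. norm ((LINT t|lebesgue_on {a..b}. F k t * p' t) - (p b - p a)) < e / 4"
    by auto
  then have k0: "\<bar>(LINT t|lebesgue_on {a..b}. F k t * p' t) - (p b - p a)\<bar> < e / 4" if "k \<ge> k0" for k
    using that by simp
  have total: "integral {a..b} (\<lambda>t. \<bar>D k t\<bar>) \<le> 2" for k
  proof -
    have "((\<lambda>t. \<bar>D k t\<bar>) has_integral F k ?m - F k a) {a..?m}"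
      by (rule has_integral_eq[OF _ FTC[OF _ D(1)]]) (use D(3)[of _ k] ab in auto)
    moreover have "((\<lambda>t. \<bar>D k t\<bar>) has_integral - (F k b - F k ?m)) {?m..b}"
      by (rule has_integral_eq[OF _ has_integral_neg[OF FTC[OF _ D(1)]]]) (use D(4)[of _ k] ab in auto)
    ultimately have "((\<lambda>t. \<bar>D k t\<bar>) has_integral (F k ?m - F k a + - (F k b - F k ?m))) {a..b}"
      using ab by (intro has_integral_combine[of a ?m b]) auto
    then show ?thesis
      using F01[of k ?m] F0[of k] by (simp add: integral_unique)
  qed
  have "\<bar>(LINT t|lebesgue_on {a..b}. deriv (F k) t * g t) - (g a - g b)\<bar> < e" if k: "k \<ge> k0" for k
  proof -
    have i: "integrable (lebesgue_on {a..b}) (\<lambda>t. D k t * g t)" "integrable (lebesgue_on {a..b}) (\<lambda>t. D k t * p t)"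
      by (intro int continuous_intros contD contp g)+
    have "(LINT t|lebesgue_on {a..b}. D k t * g t) - (LINT t|lebesgue_on {a..b}. D k t * p t) =
        (LINT t|lebesgue_on {a..b}. D k t * (g t - p t))"
      using i by (simp add: right_diff_distrib)
    also have "\<bar>\<dots>\<bar> \<le> (LINT t|lebesgue_on {a..b}. \<bar>D k t * (g t - p t)\<bar>)"
      by (rule integral_abs_bound)
    also have "\<dots> \<le> (LINT t|lebesgue_on {a..b}. \<bar>D k t\<bar> * (e / 8))"
    proof (intro integral_mono_AE int continuous_intros contD contp g AE_I2)
      fix t assume "t \<in> space (lebesgue_on {a..b})"
      then have "\<bar>g t - p t\<bar> \<le> e / 8"
        using p(2)[of t] by simp
      from mult_left_mono[OF this, of "\<bar>D k t\<bar>"]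
      show "\<bar>D k t * (g t - p t)\<bar> \<le> \<bar>D k t\<bar> * (e / 8)"
        by (simp only: abs_mult abs_ge_zero simp_thms)
    qed
    also have "\<dots> = (LINT t|lebesgue_on {a..b}. \<bar>D k t\<bar>) * (e / 8)"
      by simp
    also have "(LINT t|lebesgue_on {a..b}. \<bar>D k t\<bar>) = integral {a..b} (\<lambda>t. \<bar>D k t\<bar>)"
      by (intro int_eq continuous_intros contD)
    also have "\<dots> * (e / 8) \<le> e / 4"
      using mult_right_mono[OF total[of k], of "e / 8"] \<open>e > 0\<close> by simp
    finally have 1: "\<bar>(LINT t|lebesgue_on {a..b}. D k t * g t) - (LINT t|lebesgue_on {a..b}. D k t * p t)\<bar> \<le> e / 4" .
    have 2: "\<bar>(LINT t|lebesgue_on {a..b}. D k t * p t) - (p a - p b)\<bar> < e / 4"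
      using k0[OF k] unfolding parts by linarith
    have "\<bar>g a - p a\<bar> < e / 8" "\<bar>g b - p b\<bar> < e / 8"
      using p(2) ab by auto
    with 1 2 show ?thesis
      unfolding dF by linarith
  qed
  then show "\<exists>k0. \<forall>k\<ge>k0. norm ((LINT t|lebesgue_on {a..b}. deriv (box_cutoff (1 / Suc k) a b) t * g t) - (g a - g b)) < e"
    unfolding F_def c_def by auto
qed

lemma increment_eq_integral_weak_derivative:
  fixes g \<omega> :: "real \<Rightarrow> real"
  assumes g: "continuous_on {0..T} g" and \<omega>: "integrable (lebesgue_on {0<..<T}) \<omega>"
    and weak: "\<And>\<phi>. \<phi> \<in> test_functions {0<..<T} \<Longrightarrow>
      (LINT t|lebesgue_on {0<..<T}. deriv \<phi> t * g t) = - (LINT t|lebesgue_on {0<..<T}. \<phi> t * \<omega> t)"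
    and ab: "0 < a" "a < b" "b < T"
  shows "g b - g a = (LINT t|lebesgue_on {0<..<T}. indicator {a<..<b} t * \<omega> t)"
proof -
  let ?F = "\<lambda>k. box_cutoff (1 / Suc k) a b"
  have F: "?F k \<in> test_functions {0<..<T}" for k
    using ab by (intro box_cutoff_test_function) auto
  have [measurable]: "?F k \<in> borel_measurable (lebesgue_on {0<..<T})" for k
    by (rule continuous_imp_measurable_lebesgue_on[OF test_function_continuous[OF F]])
  have [measurable]: "\<omega> \<in> borel_measurable (lebesgue_on {0<..<T})"
    using \<omega> by auto
  have "(\<lambda>k. LINT t|lebesgue_on {0<..<T}. ?F k t * \<omega> t) \<longlonglongrightarrow>
      (LINT t|lebesgue_on {0<..<T}. indicator {a<..<b} t * \<omega> t)"
  proof (rule integral_dominated_convergence[where w = "\<lambda>t. \<bar>\<omega> t\<bar>"])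
    show "AE t in lebesgue_on {0<..<T}. (\<lambda>k. ?F k t * \<omega> t) \<longlonglongrightarrow> indicator {a<..<b} t * \<omega> t"
      using box_cutoff_tendsto[of a b] by (auto intro!: AE_I2 tendsto_mult simp: box_real)
    show "AE t in lebesgue_on {0<..<T}. norm (?F k t * \<omega> t) \<le> \<bar>\<omega> t\<bar>" for k
      using box_cutoff_bounds[of "1 / Suc k" a b] by (auto simp: abs_mult intro!: AE_I2 mult_left_le_one_le)
    show "(\<lambda>t. indicator {a<..<b} t * \<omega> t) \<in> borel_measurable (lebesgue_on {0<..<T})"
    proof -
      have "(indicator {a<..<b} :: real \<Rightarrow> real) \<in> borel_measurable (lebesgue_on {0<..<T})"
        by (intro measurable_restrict_space1 measurable_completion) simp
      then show ?thesis by measurable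
    qed
    show "(\<lambda>t. ?F k t * \<omega> t) \<in> borel_measurable (lebesgue_on {0<..<T})" for k
      by measurable
    show "integrable (lebesgue_on {0<..<T}) (\<lambda>t. \<bar>\<omega> t\<bar>)"
      using \<omega> by (rule integrable_abs)
  qed
  from tendsto_minus[OF this]
  have "(\<lambda>k. LINT t|lebesgue_on {0<..<T}. deriv (?F k) t * g t) \<longlonglongrightarrow>
      - (LINT t|lebesgue_on {0<..<T}. indicator {a<..<b} t * \<omega> t)"
    using weak[OF F] by simp
  moreover have "(LINT t|lebesgue_on {0<..<T}. deriv (?F k) t * g t) = (LINT t|lebesgue_on {a..b}. deriv (?F k) t * g t)" for k
  proof (rule integral_lebesgue_on_zero_outside)
    show "deriv (?F k) t * g t = 0" if "t \<notin> {a..b}" for t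
      using DERIV_imp_deriv[OF deriv_box_cutoff(1)[of "1 / Suc k" a b t]] deriv_box_cutoff(5)[of "1 / Suc k" t a b] that
      by simp
  qed (use ab in auto)
  moreover have "(\<lambda>k. LINT t|lebesgue_on {a..b}. deriv (?F k) t * g t) \<longlonglongrightarrow> g a - g b"
    using ab by (intro deriv_box_cutoff_tendsto continuous_on_subset[OF g]) auto
  ultimately have "- (LINT t|lebesgue_on {0<..<T}. indicator {a<..<b} t * \<omega> t) = g a - g b"
    using LIMSEQ_unique by simp
  then show ?thesis by simp
qed

section \<open>The parabolic equation\<close>

lemma C_H_tendsto:
  assumes v: "v \<in> C_H T \<Omega>" and L: "\<And>a b. a \<in> L2 \<Omega> \<Longrightarrow> b \<in> L2 \<Omega> \<Longrightarrow> \<bar>L a - L b\<bar> \<le> C * L2_norm \<Omega> (\<lambda>x. a x - b x)"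
  shows "continuous_on {0..T} (\<lambda>t. L (v t) :: real)"
  unfolding continuous_on_def
proof
  fix s assume s: "s \<in> {0..T}"
  have "((\<lambda>t. C * L2_norm \<Omega> (\<lambda>x. v t x - v s x)) \<longlongrightarrow> 0) (at s within {0..T})"
    using v s tendsto_mult_left[of "\<lambda>t. L2_norm \<Omega> (\<lambda>x. v t x - v s x)" 0 _ C] by (auto simp: C_H_def)
  moreover have "\<forall>\<^sub>F t in at s within {0..T}. norm (L (v t) - L (v s)) \<le> C * L2_norm \<Omega> (\<lambda>x. v t x - v s x)"
    using v s L by (auto simp: C_H_def eventually_at_filter)
  ultimately have "((\<lambda>t. L (v t) - L (v s)) \<longlongrightarrow> 0) (at s within {0..T})"
    by (rule Lim_null_comparison[rotated])
  then show "((\<lambda>t. L (v t)) \<longlongrightarrow> L (v s)) (at s within {0..T})"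
    by (simp add: LIM_zero_iff)
qed

lemma L2_inner_diff_le:
  assumes "a \<in> L2 \<Omega>" "b \<in> L2 \<Omega>" "v \<in> L2 \<Omega>"
  shows "\<bar>L2_inner \<Omega> a v - L2_inner \<Omega> b v\<bar> \<le> L2_norm \<Omega> v * L2_norm \<Omega> (\<lambda>x. a x - b x)"
proof -
  have "L2_inner \<Omega> a v - L2_inner \<Omega> b v = L2_inner \<Omega> (\<lambda>x. a x - b x) v"
    using assms by (simp add: L2_inner_def left_diff_distrib L2_product_integrable)
  then show ?thesis
    using L2.Cauchy_Schwarz[OF L2_diff[OF assms(1,2)] assms(3)] by (simp add: L2_norm_def mult.commute)
qed

lemma neg_energy_increment:
  assumes a: "a \<in> L2 \<Omega>" and b: "b \<in> L2 \<Omega>"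
  shows "(L2_norm \<Omega> (\<lambda>x. max (- b x) 0))\<^sup>2 / 2 - (L2_norm \<Omega> (\<lambda>x. max (- a x) 0))\<^sup>2 / 2 \<le>
    - (L2_inner \<Omega> b (\<lambda>x. max (- b x) 0) - L2_inner \<Omega> a (\<lambda>x. max (- b x) 0))"
proof -
  have pt: "(max (- y) 0)\<^sup>2 / 2 - (max (- x) 0)\<^sup>2 / 2 \<le> - (y * max (- y) 0 - x * max (- y) 0)" for x y :: real
  proof (cases "y < 0")
    case True
    have sq: "0 \<le> (y - x)\<^sup>2" "0 \<le> y\<^sup>2" by simp_all
    show ?thesis
    proof (cases "x < 0")
      case True
      then show ?thesis
        using sq \<open>y < 0\<close> by (simp add: max_def power2_eq_square algebra_simps)
    next
      case False
      then have "x * y \<le> 0"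
        using \<open>y < 0\<close> by (simp add: mult_nonneg_nonpos)
      with sq have "y\<^sup>2 / 2 \<le> y\<^sup>2 - x * y" by linarith
      then show ?thesis
        using False \<open>y < 0\<close> by (simp add: max_def power2_eq_square algebra_simps)
    qed
  qed auto
  have i: "integrable (lebesgue_on \<Omega>) (\<lambda>x. (max (- v x) 0)\<^sup>2)" if "v \<in> L2 \<Omega>" for v
    using L2_neg[OF that] by (simp add: L2_def)
  note j = L2_product_integrable[OF a L2_neg[OF b]] L2_product_integrable[OF b L2_neg[OF b]]
  have "(LINT x|lebesgue_on \<Omega>. (max (- b x) 0)\<^sup>2 / 2 - (max (- a x) 0)\<^sup>2 / 2) \<le>
      (LINT x|lebesgue_on \<Omega>. - (b x * max (- b x) 0 - a x * max (- b x) 0))"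
    using i[OF a] i[OF b] j pt by (intro integral_mono) auto
  then show ?thesis
    using i[OF a] i[OF b] j by (simp add: L2_norm_squared L2_inner_def)
qed

lemma mult_le_AM_GM:
  fixes a m \<kappa> :: real
  assumes "\<kappa> > 0"
  shows "a * m \<le> a\<^sup>2 / (2 * \<kappa>) + \<kappa> / 2 * m\<^sup>2"
proof -
  have "0 \<le> (a - \<kappa> * m)\<^sup>2 / (2 * \<kappa>)"
    using assms by simp
  also have "\<dots> = a\<^sup>2 / (2 * \<kappa>) + \<kappa> / 2 * m\<^sup>2 - a * m"
    using assms by (simp add: power2_diff field_simps power2_eq_square)
  finally show ?thesis by simp
qed

lemma Bochner_L2_norm_integrable:
  assumes "finite_measure M" and "integrable M (\<lambda>t. (f t)\<^sup>2)" "f \<in> borel_measurable M"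
  shows "integrable M (f :: _ \<Rightarrow> real)"
proof (rule Bochner_Integration.integrable_bound)
  interpret finite_measure M by fact
  show "integrable M (\<lambda>t. 1 + (f t)\<^sup>2)"
    using assms(2) by simp
  have "\<bar>a\<bar> \<le> 1 + a\<^sup>2" for a :: real
    using zero_le_power2[of "\<bar>a\<bar> - 1"] by (simp add: power2_diff)
  then show "AE t in M. norm (f t) \<le> norm (1 + (f t)\<^sup>2)"
    by (auto intro!: AE_I2)
qed fact

locale parabolic_problem =
  fixes \<Omega> :: "'a::euclidean_space set" and T :: real and f1 :: "real \<Rightarrow> 'a \<Rightarrow> real"
    and f2 :: "real \<Rightarrow> ('a \<Rightarrow> real) \<Rightarrow> real" and u0 :: "'a \<Rightarrow> real" and u :: "real \<Rightarrow> 'a \<Rightarrow> real"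
    and v :: "real \<Rightarrow> 'a \<Rightarrow> real"
  assumes \<Omega>: "open \<Omega>" and T: "0 < T"
    and f1: "f1 \<in> L1_H T \<Omega>" and f2: "f2 \<in> L2_V_dual T \<Omega>"
    and f_nonneg: "\<And>v. v \<in> L2_V T \<Omega> \<inter> C_H T \<Omega> \<Longrightarrow> nonneg_ae {0<..<T} \<Omega> v \<Longrightarrow>
        0 \<le> source_pairing T \<Omega> f1 f2 v"
    and u0: "u0 \<in> L2 \<Omega>" "AE x in lebesgue_on \<Omega>. 0 \<le> u0 x"
    and u: "weak_solution T \<Omega> f1 f2 u0 u"
    and v: "v \<in> C_H T \<Omega>" "AE t in lebesgue_on {0<..<T}. AE x in lebesgue_on \<Omega>. v t x = u t x"
      "AE x in lebesgue_on \<Omega>. v 0 x = u0 x"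
begin

abbreviation M where "M \<equiv> lebesgue_on {0<..<T}"

abbreviation neg :: "('a \<Rightarrow> real) \<Rightarrow> 'a \<Rightarrow> real" where "neg h \<equiv> \<lambda>x. max (- h x) 0"

definition w where "w = time_deriv T \<Omega> u"

definition energy where "energy t = (L2_norm \<Omega> (neg (v t)))\<^sup>2 / 2"

definition source where "source p t = L2_inner \<Omega> (f1 t) p + f2 t p"

sublocale fin: finite_measure M
  by (rule finite_measure_lebesgue_on) simp

sublocale V: function_seminorm "H1 \<Omega>" "H1_norm \<Omega>"
  using \<Omega> by (rule H1_seminorm)

sublocale D: function_seminorm "H1_dual \<Omega>" "H1_dual_norm \<Omega>"
  using \<Omega> by (rule H1_dual_seminorm)

lemma I_sets: "{0<..<T} \<in> sets lebesgue" and I_lmeasurable: "{0<..<T} \<in> lmeasurable"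
  and \<Omega>_sets: "\<Omega> \<in> sets lebesgue"
  using \<Omega> by auto

lemma u_L2_V: "u \<in> L2_V T \<Omega>"
  using u by (simp add: weak_solution_def W_def)

lemma u_meas: "strongly_measurable M (H1 \<Omega>) (H1_norm \<Omega>) u"
  and u_int: "integrable M (\<lambda>t. (H1_norm \<Omega> (u t))\<^sup>2)"
  using u_L2_V by (auto simp: L2_V_def Bochner_Lp_def)

lemma w: "w \<in> L2_V_dual T \<Omega>" "has_time_deriv T \<Omega> u w"
proof -
  have "\<exists>w. w \<in> L2_V_dual T \<Omega> \<and> has_time_deriv T \<Omega> u w"
    using u by (auto simp: weak_solution_def W_def)
  from someI_ex[OF this] show "w \<in> L2_V_dual T \<Omega>" "has_time_deriv T \<Omega> u w"
    by (simp_all add: w_def time_deriv_def)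
qed

lemma v_L2: "t \<in> {0..T} \<Longrightarrow> v t \<in> L2 \<Omega>"
  using v(1) by (auto simp: C_H_def)

lemma dual_eval_integrable:
  assumes F: "F \<in> L2_V_dual T \<Omega>" and p: "p \<in> H1 \<Omega>"
  shows "integrable M (\<lambda>t. F t p)"
proof -
  have F_meas: "strongly_measurable M (H1_dual \<Omega>) (H1_dual_norm \<Omega>) F"
    and F_int: "integrable M (\<lambda>t. (H1_dual_norm \<Omega> (F t))\<^sup>2)"
    using F by (auto simp: L2_V_dual_def Bochner_Lp_def)
  have "integrable M (\<lambda>t. H1_dual_norm \<Omega> (F t))"
    by (rule Bochner_L2_norm_integrable[OF fin.finite_measure_axioms F_int D.norm_measurable[OF I_sets F_meas]])
  then have "integrable M (\<lambda>t. H1_dual_norm \<Omega> (F t) * H1_norm \<Omega> p)"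
    by simp
  then show ?thesis
  proof (rule Bochner_Integration.integrable_bound)
    show "(\<lambda>t. F t p) \<in> borel_measurable M"
      by (rule borel_measurable_H1_dual_eval[OF \<Omega> I_sets F_meas p])
    show "AE t in M. norm (F t p) \<le> norm (H1_dual_norm \<Omega> (F t) * H1_norm \<Omega> p)"
      using strongly_measurable_AE_mem[OF F_meas]
      by eventually_elim (use H1_dual_bound[OF \<Omega> _ p] in \<open>auto intro: order_trans[OF _ abs_ge_self]\<close>)
  qed
qed

lemma f1_inner_integrable:
  assumes p: "p \<in> L2 \<Omega>"
  shows "integrable M (\<lambda>t. L2_inner \<Omega> (f1 t) p)"
proof -
  have f1_meas: "strongly_measurable M (L2 \<Omega>) (L2_norm \<Omega>) f1"
    and f1_int: "integrable M (\<lambda>t. L2_norm \<Omega> (f1 t) * L2_norm \<Omega> p)"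
    using f1 by (auto simp: L1_H_def Bochner_Lp_def)
  show ?thesis
  proof (rule Bochner_Integration.integrable_bound[OF f1_int])
    show "(\<lambda>t. L2_inner \<Omega> (f1 t) p) \<in> borel_measurable M"
      by (rule borel_measurable_strongly_measurable[OF I_sets f1_meas, where C = "L2_norm \<Omega> p"])
        (rule L2_inner_diff_le[OF _ _ p])
    show "AE t in M. norm (L2_inner \<Omega> (f1 t) p) \<le> norm (L2_norm \<Omega> (f1 t) * L2_norm \<Omega> p)"
      using strongly_measurable_AE_mem[OF f1_meas]
    proof eventually_elim
      case (elim t)
      from L2.Cauchy_Schwarz[OF elim p] show ?case
        unfolding L2_norm_def[symmetric] by (auto intro: order_trans[OF _ abs_ge_self])
    qed
  qed
qed

lemma source_integrable: "p \<in> H1 \<Omega> \<Longrightarrow> integrable M (source p)"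
  unfolding source_def[abs_def]
  by (intro Bochner_Integration.integrable_add f1_inner_integrable dual_eval_integrable f2 H1_L2)

lemma source_pairing_tensor:
  assumes p: "p \<in> H1 \<Omega>" and \<eta>: "continuous_on UNIV \<eta>" "\<And>t. \<bar>\<eta> t\<bar> \<le> 1"
  shows "source_pairing T \<Omega> f1 f2 (\<lambda>t x. \<eta> t * p x) = (LINT t|M. \<eta> t * source p t)"
proof -
  have [measurable]: "\<eta> \<in> borel_measurable M"
    by (rule continuous_imp_measurable_lebesgue_on[OF \<eta>(1)])
  have int: "integrable M (\<lambda>t. \<eta> t * k t)" if "integrable M k" for k
    using integrable_mult_bounded[where p = \<eta>, OF that _ \<eta>(2)] by (simp add: mult.commute)
  note i = f1_inner_integrable[OF H1_L2[OF p]] dual_eval_integrable[OF f2 p]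
  have "L2_inner \<Omega> (f1 t) (\<lambda>x. \<eta> t * p x) = \<eta> t * L2_inner \<Omega> (f1 t) p" for t
    by (simp add: L2_inner_def mult.left_commute[of _ "\<eta> t"])
  then have 1: "(LINT t|M. L2_inner \<Omega> (f1 t) (\<lambda>x. \<eta> t * p x)) = (LINT t|M. \<eta> t * L2_inner \<Omega> (f1 t) p)"
    by simp
  have eq: "AE t in M. \<eta> t * f2 t p = f2 t (\<lambda>x. \<eta> t * p x)"
  proof -
    have "AE t in M. f2 t \<in> H1_dual \<Omega>"
      using f2 strongly_measurable_AE_mem by (auto simp: L2_V_dual_def Bochner_Lp_def)
    then show ?thesis
      by eventually_elim (use p in \<open>auto simp: H1_dual_def\<close>)
  qed
  have 2: "(LINT t|M. f2 t (\<lambda>x. \<eta> t * p x)) = (LINT t|M. \<eta> t * f2 t p)"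
  proof (rule integral_cong_AE)
    show "(\<lambda>t. \<eta> t * f2 t p) \<in> borel_measurable M"
      using i(2) by measurable
    then show "(\<lambda>t. f2 t (\<lambda>x. \<eta> t * p x)) \<in> borel_measurable M"
      using eq by (rule borel_measurable_lebesgue_on_AE[OF I_sets])
    show "AE t in M. f2 t (\<lambda>x. \<eta> t * p x) = \<eta> t * f2 t p"
      using eq by eventually_elim simp
  qed
  show ?thesis
    unfolding source_pairing_def 1 2 source_def
    using int[OF i(1)] int[OF i(2)] by (simp add: distrib_left)
qed

lemma source_interval_nonneg:
  assumes p: "p \<in> H1 \<Omega>" "\<And>x. 0 \<le> p x" and ab: "a < b"
  shows "0 \<le> (LINT t|M. indicator {a<..<b} t * source p t)"
proof -
  let ?F = "\<lambda>k. box_cutoff (1 / Suc k) a b"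
  have contF: "continuous_on UNIV (?F k)" for k
    using Ck_box_cutoff[of "1 / Suc k" 0 a b] by simp
  have [measurable]: "?F k \<in> borel_measurable M" for k
    by (rule continuous_imp_measurable_lebesgue_on[OF contF])
  have F: "0 \<le> ?F k t" "?F k t \<le> 1" for k t
    using box_cutoff_bounds[of "1 / Suc k" a b t] by auto
  have "0 \<le> (LINT t|M. ?F k t * source p t)" for k
    using f_nonneg[OF tensor_product_test_function[OF \<Omega> contF F(1) p]] F
    by (subst source_pairing_tensor[symmetric, OF p(1) contF]) auto
  moreover have "(\<lambda>k. LINT t|M. ?F k t * source p t) \<longlonglongrightarrow> (LINT t|M. indicator {a<..<b} t * source p t)"
  proof (rule integral_dominated_convergence[where w = "\<lambda>t. \<bar>source p t\<bar>"])
    have [measurable]: "(indicator {a<..<b} :: real \<Rightarrow> real) \<in> borel_measurable M" "source p \<in> borel_measurable M"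
      using source_integrable[OF p(1)] by (auto intro!: measurable_restrict_space1 measurable_completion)
    show "(\<lambda>t. indicator {a<..<b} t * source p t) \<in> borel_measurable M"
      "(\<lambda>t. ?F k t * source p t) \<in> borel_measurable M" for k
      by measurable
    show "integrable M (\<lambda>t. \<bar>source p t\<bar>)"
      using source_integrable[OF p(1)] by (rule integrable_abs)
    show "AE t in M. (\<lambda>k. ?F k t * source p t) \<longlonglongrightarrow> indicator {a<..<b} t * source p t"
      using box_cutoff_tendsto[of a b] by (auto intro!: AE_I2 tendsto_mult simp: box_real)
    show "AE t in M. norm (?F k t * source p t) \<le> \<bar>source p t\<bar>" for k
      using F[of k] by (auto simp: abs_mult intro!: AE_I2 mult_left_le_one_le)
  qed
  ultimately show ?thesis
    by (intro LIMSEQ_le_const) auto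
qed

lemma solution_increment:
  assumes p: "p \<in> H1 \<Omega>" and ab: "0 < a" "a < b" "b < T"
  shows "L2_inner \<Omega> (v b) p - L2_inner \<Omega> (v a) p = (LINT t|M. indicator {a<..<b} t * w t p)"
proof (rule increment_eq_integral_weak_derivative[OF _ dual_eval_integrable[OF w(1) p] _ ab])
  show "continuous_on {0..T} (\<lambda>t. L2_inner \<Omega> (v t) p)"
    by (rule C_H_tendsto[OF v(1), where C = "L2_norm \<Omega> p"]) (rule L2_inner_diff_le[OF _ _ H1_L2[OF p]])
  fix \<phi> assume \<phi>: "\<phi> \<in> test_functions {0<..<T}"
  obtain J where J: "has_integral_in M (H1_dual \<Omega>) (H1_dual_norm \<Omega>) (\<lambda>t v. deriv \<phi> t * L2_inner \<Omega> (u t) v) J"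
    "has_integral_in M (H1_dual \<Omega>) (H1_dual_norm \<Omega>) (\<lambda>t v. - (\<phi> t * w t v)) J"
    using w(2) \<phi> unfolding has_time_deriv_def by blast
  note e1 = has_integral_in_H1_dual_eval[OF \<Omega> I_lmeasurable p J(1)]
  note e2 = has_integral_in_H1_dual_eval[OF \<Omega> I_lmeasurable p J(2)]
  have eq: "AE t in M. deriv \<phi> t * L2_inner \<Omega> (u t) p = deriv \<phi> t * L2_inner \<Omega> (v t) p"
    using v(2) strongly_measurable_AE_mem[OF u_meas] AE_space
  proof eventually_elim
    case (elim t)
    have "L2_inner \<Omega> (v t) p = L2_inner \<Omega> (u t) p"
      using elim p by (intro L2_inner_cong_AE v_L2) (auto intro: H1_L2)
    then show ?case by simp
  qed
  have "(LINT t|M. deriv \<phi> t * L2_inner \<Omega> (v t) p) = (LINT t|M. deriv \<phi> t * L2_inner \<Omega> (u t) p)"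
  proof (rule integral_cong_AE)
    show m: "(\<lambda>t. deriv \<phi> t * L2_inner \<Omega> (u t) p) \<in> borel_measurable M"
      using e1(1) by (rule borel_measurable_integrable)
    show "(\<lambda>t. deriv \<phi> t * L2_inner \<Omega> (v t) p) \<in> borel_measurable M"
      by (rule borel_measurable_lebesgue_on_AE[OF I_sets m eq])
    show "AE t in M. deriv \<phi> t * L2_inner \<Omega> (v t) p = deriv \<phi> t * L2_inner \<Omega> (u t) p"
      using eq by eventually_elim (rule sym)
  qed
  also have "\<dots> = (LINT t|M. - (\<phi> t * w t p))"
    using e1(2) e2(2) by simp
  finally show "(LINT t|M. deriv \<phi> t * L2_inner \<Omega> (v t) p) = - (LINT t|M. \<phi> t * w t p)"
    by simp
qed

lemma energy_continuous: "continuous_on {0..T} energy"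
proof -
  have "continuous_on {0..T} (\<lambda>t. L2_norm \<Omega> (neg (v t)))"
  proof (rule C_H_tendsto[OF v(1), where C = 1])
    fix a b assume ab: "a \<in> L2 \<Omega>" "b \<in> L2 \<Omega>"
    have "\<bar>L2_norm \<Omega> (neg a) - L2_norm \<Omega> (neg b)\<bar> \<le> L2_norm \<Omega> (\<lambda>x. neg a x - neg b x)"
      by (rule L2N.norm_diff_bound[OF L2_neg[OF ab(1)] L2_neg[OF ab(2)]])
    also have "\<dots> \<le> L2_norm \<Omega> (\<lambda>x. a x - b x)"
      using ab by (intro L2_norm_mono L2_diff L2_neg) (auto simp: max_def)
    finally show "\<bar>L2_norm \<Omega> (neg a) - L2_norm \<Omega> (neg b)\<bar> \<le> 1 * L2_norm \<Omega> (\<lambda>x. a x - b x)"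
      by simp
  qed
  then show ?thesis
    unfolding energy_def by (intro continuous_intros) auto
qed

lemma energy_0: "energy 0 = 0"
proof -
  have "AE x in lebesgue_on \<Omega>. (neg (v 0) x)\<^sup>2 = 0"
    using v(3) u0(2) by eventually_elim auto
  then have "(LINT x|lebesgue_on \<Omega>. (neg (v 0) x)\<^sup>2) = (LINT x|lebesgue_on \<Omega>. 0)"
    using L2_measurable[OF v_L2[of 0]] T by (intro integral_cong_AE) auto
  then show ?thesis
    by (simp add: energy_def L2_norm_squared)
qed

lemma energy_increment_le:
  "AE r in M. u r \<in> H1 \<Omega> \<and> (\<forall>t k. 0 < t \<longrightarrow> t < r \<longrightarrow> integrable M k \<longrightarrow>
    (AE s in M. t < s \<and> s < r \<and> u s \<in> H1 \<Omega> \<longrightarrow> H1_norm \<Omega> (\<lambda>x. u s x - u r x) * H1_norm \<Omega> (u r) \<le> k s) \<longrightarrow>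
    energy r - energy t \<le> (LINT s|M. indicator {t<..<r} s * k s))"
  using v(2) strongly_measurable_AE_mem[OF u_meas] AE_space
proof eventually_elim
  case (elim r)
  note r = this
  show ?case
  proof (intro conjI allI impI)
    show "u r \<in> H1 \<Omega>" by (rule r(2))
    fix t k assume t: "0 < t" "t < r" and k: "integrable M k"
      and bound: "AE s in M. t < s \<and> s < r \<and> u s \<in> H1 \<Omega> \<longrightarrow>
        H1_norm \<Omega> (\<lambda>x. u s x - u r x) * H1_norm \<Omega> (u r) \<le> k s"
    have trT: "t \<in> {0..T}" "r \<in> {0..T}" "r < T"
      using t r(3) by auto
    define p where "p = neg (u r)"
    have p: "p \<in> H1 \<Omega>" "0 \<le> p x" for x
      using H1_neg[OF r(2) \<Omega>] by (auto simp: p_def)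
    have ae: "AE x in lebesgue_on \<Omega>. neg (v r) x = p x"
      using r(1) by eventually_elim (simp add: p_def)
    have vp: "L2_inner \<Omega> h (neg (v r)) = L2_inner \<Omega> h p" if "h \<in> L2 \<Omega>" for h
      using L2_inner_cong_AE[OF L2_neg[OF v_L2[OF trT(2)]] H1_L2[OF p(1)] that ae]
      by (metis L2.inner_commute)
    have ind: "integrable M (\<lambda>s. indicator {t<..<r} s * g s)" if g: "integrable M g" for g :: "real \<Rightarrow> real"
    proof -
      have "integrable M (\<lambda>s. g s * indicator {t<..<r} s)"
        using g t trT by (intro integrable_real_mult_indicator) (auto simp: sets_restrict_space_iff)
      then show ?thesis
        by (simp add: mult.commute)
    qed
    have "energy r - energy t \<le> - (L2_inner \<Omega> (v r) p - L2_inner \<Omega> (v t) p)"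
      using neg_energy_increment[OF v_L2[OF trT(1)] v_L2[OF trT(2)]] trT
      by (simp add: energy_def vp v_L2)
    also have "\<dots> = - (LINT s|M. indicator {t<..<r} s * w s p)"
      using solution_increment[OF p(1) t(1,2) trT(3)] by simp
    also have "\<dots> \<le> (LINT s|M. indicator {t<..<r} s * (source p s - w s p))"
      using source_interval_nonneg[OF p t(2)] ind[OF source_integrable[OF p(1)]]
        ind[OF dual_eval_integrable[OF w(1) p(1)]] by (simp add: right_diff_distrib)
    also have "\<dots> \<le> (LINT s|M. indicator {t<..<r} s * k s)"
    proof (rule integral_mono_AE)
      show "integrable M (\<lambda>s. indicator {t<..<r} s * (source p s - w s p))"
        by (intro ind Bochner_Integration.integrable_diff source_integrable dual_eval_integrable w p)
      show "integrable M (\<lambda>s. indicator {t<..<r} s * k s)"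
        by (rule ind[OF k])
      have "AE s in M. w s p + grad_inner \<Omega> (u s) p = source p s"
        using u p(1) by (simp add: weak_solution_def w_def source_def)
      then show "AE s in M. indicator {t<..<r} s * (source p s - w s p) \<le> indicator {t<..<r} s * k s"
        using bound strongly_measurable_AE_mem[OF u_meas]
      proof eventually_elim
        case (elim s)
        show ?case
        proof (cases "s \<in> {t<..<r}")
          case True
          have "source p s - w s p = grad_inner \<Omega> (u s) p"
            using elim(1) by simp
          also have "\<dots> \<le> H1_norm \<Omega> (\<lambda>x. u s x - u r x) * H1_norm \<Omega> (u r)"
            unfolding p_def by (rule grad_inner_neg_le[OF elim(3) r(2) \<Omega>])
          also have "\<dots> \<le> k s"
            using elim True by auto
          finally show ?thesis using True by simp
        qed simp
      qed
    qed
    finally show "energy r - energy t \<le> (LINT s|M. indicator {t<..<r} s * k s)" .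
  qed
qed

lemma step_continuity:
  assumes J: "finite J" "J \<subseteq> H1 \<Omega>" and \<psi>: "\<And>h. h \<in> J \<Longrightarrow> continuous_on UNIV (\<psi> h :: real \<Rightarrow> real)" and "\<theta> > 0"
  obtains \<delta> where "\<delta> > 0" "\<And>s r. s \<in> {0..T} \<Longrightarrow> r \<in> {0..T} \<Longrightarrow> \<bar>s - r\<bar> < \<delta> \<Longrightarrow>
    H1_norm \<Omega> (\<lambda>x. (\<Sum>h\<in>J. \<psi> h s * h x) - (\<Sum>h\<in>J. \<psi> h r * h x)) \<le> \<theta>"
proof -
  define q where "q = (\<Sum>h\<in>J. H1_norm \<Omega> h) + 1"
  have nn: "0 \<le> (\<Sum>h\<in>J. H1_norm \<Omega> h)"
    using J V.norm_nonneg by (intro sum_nonneg) auto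
  have "\<exists>d>0. \<forall>s\<in>{0..T}. \<forall>r\<in>{0..T}. dist r s < d \<longrightarrow> dist (\<psi> h r) (\<psi> h s) < \<theta> / q" if "h \<in> J" for h
  proof -
    have "uniformly_continuous_on {0..T} (\<psi> h)"
      using \<psi>[OF that] by (intro compact_uniformly_continuous continuous_on_subset[OF \<psi>[OF that]]) auto
    moreover have "\<theta> / q > 0"
      using \<open>\<theta> > 0\<close> nn by (simp add: q_def)
    ultimately show ?thesis
      unfolding uniformly_continuous_on_def by blast
  qed
  then obtain d where d: "\<And>h. h \<in> J \<Longrightarrow> d h > 0"
    "\<And>h s r. h \<in> J \<Longrightarrow> s \<in> {0..T} \<Longrightarrow> r \<in> {0..T} \<Longrightarrow> dist r s < d h \<Longrightarrow> dist (\<psi> h r) (\<psi> h s) < \<theta> / q"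
    by metis
  define \<delta> where "\<delta> = Min (insert 1 (d ` J))"
  have \<delta>: "\<delta> > 0" "\<And>h. h \<in> J \<Longrightarrow> \<delta> \<le> d h"
    using J(1) d(1) by (auto simp: \<delta>_def)
  show ?thesis
  proof (rule that[OF \<delta>(1)])
    fix s r assume sr: "s \<in> {0..T}" "r \<in> {0..T}" "\<bar>s - r\<bar> < \<delta>"
    have "(\<lambda>x. (\<Sum>h\<in>J. \<psi> h s * h x) - (\<Sum>h\<in>J. \<psi> h r * h x)) = (\<lambda>x. \<Sum>h\<in>J. (\<psi> h s - \<psi> h r) * h x)"
      by (simp add: left_diff_distrib sum_subtractf)
    then have "H1_norm \<Omega> (\<lambda>x. (\<Sum>h\<in>J. \<psi> h s * h x) - (\<Sum>h\<in>J. \<psi> h r * h x)) \<le>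
        (\<Sum>h\<in>J. H1_norm \<Omega> (\<lambda>x. (\<psi> h s - \<psi> h r) * h x))"
      using J by (simp only:) (intro V.norm_sum_le; auto intro: V.scale_mem)
    also have "\<dots> \<le> (\<Sum>h\<in>J. \<theta> / q * H1_norm \<Omega> h)"
    proof (rule sum_mono)
      fix h assume h: "h \<in> J"
      have "\<bar>\<psi> h s - \<psi> h r\<bar> \<le> \<theta> / q"
        using d(2)[OF h sr(2,1)] sr(3) \<delta>(2)[OF h] by (simp add: dist_real_def)
      from mult_right_mono[OF this V.norm_nonneg[OF subsetD[OF J(2) h]]]
      show "H1_norm \<Omega> (\<lambda>x. (\<psi> h s - \<psi> h r) * h x) \<le> \<theta> / q * H1_norm \<Omega> h"
        using V.norm_scale[OF subsetD[OF J(2) h]] by simp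
    qed
    also have "\<dots> = \<theta> * ((\<Sum>h\<in>J. H1_norm \<Omega> h) / q)"
      by (simp add: sum_distrib_left sum_divide_distrib)
    also have "\<dots> \<le> \<theta> * 1"
      using \<open>\<theta> > 0\<close> nn by (intro mult_left_mono) (auto simp: q_def)
    finally show "H1_norm \<Omega> (\<lambda>x. (\<Sum>h\<in>J. \<psi> h s * h x) - (\<Sum>h\<in>J. \<psi> h r * h x)) \<le> \<theta>"
      by simp
  qed
qed

text \<open>In the increment over \<open>[t, r]\<close>, the solution \<open>u s\<close> is compared with \<open>u r\<close> through an
  approximation of \<open>u\<close> in \<open>L\<^sup>2(I; V)\<close> that is continuous in time.\<close>

lemma energy_bound:
  assumes \<tau>: "0 < \<tau>" "\<tau> < T" and \<kappa>: "\<kappa> > 0"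
  shows "energy \<tau> \<le> \<kappa> * (9 / 2 + (LINT t|M. (H1_norm \<Omega> (u t))\<^sup>2) / 2)"
proof -
  define m where "m t = H1_norm \<Omega> (u t)" for t
  obtain J \<psi> where J: "finite J" "J \<subseteq> H1 \<Omega>" and \<psi>: "\<And>h. h \<in> J \<Longrightarrow> continuous_on UNIV (\<psi> h :: real \<Rightarrow> real)"
    and e_int: "integrable M (\<lambda>t. (H1_norm \<Omega> (\<lambda>x. u t x - (\<Sum>h\<in>J. \<psi> h t * h x)))\<^sup>2)"
    and e_small: "(LINT t|M. (H1_norm \<Omega> (\<lambda>x. u t x - (\<Sum>h\<in>J. \<psi> h t * h x)))\<^sup>2) < \<kappa>\<^sup>2"
    using V.Bochner_L2_continuous_approximation[OF I_sets, of u "\<kappa>\<^sup>2"] u_L2_V \<kappa> by (auto simp: L2_V_def)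
  define \<sigma> where "\<sigma> t = (\<lambda>x. \<Sum>h\<in>J. \<psi> h t * h x)" for t
  define e where "e t = H1_norm \<Omega> (\<lambda>x. u t x - \<sigma> t x)" for t
  have \<sigma>: "\<sigma> t \<in> H1 \<Omega>" for t
    unfolding \<sigma>_def using J by (intro V.sum_mem V.scale_mem) auto
  have ei: "integrable M (\<lambda>t. (e t)\<^sup>2)" and es: "(LINT t|M. (e t)\<^sup>2) < \<kappa>\<^sup>2"
    using e_int e_small by (simp_all add: e_def \<sigma>_def)
  have mi: "integrable M (\<lambda>t. (m t)\<^sup>2)"
    using u_int by (simp add: m_def)
  define \<theta> where "\<theta> = \<kappa> / (1 + T)"
  have \<theta>: "\<theta> > 0" "\<theta>\<^sup>2 * T \<le> \<kappa>\<^sup>2"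
  proof -
    show "\<theta> > 0" using \<kappa> T by (simp add: \<theta>_def)
    have "T \<le> (1 + T)\<^sup>2"
      using T by (simp add: power2_sum)
    then have "\<kappa>\<^sup>2 * T \<le> \<kappa>\<^sup>2 * (1 + T)\<^sup>2"
      by (intro mult_left_mono) auto
    then show "\<theta>\<^sup>2 * T \<le> \<kappa>\<^sup>2"
      using T by (simp add: \<theta>_def power_divide pos_divide_le_eq)
  qed
  obtain \<delta> where \<delta>: "\<delta> > 0" "\<And>s r. s \<in> {0..T} \<Longrightarrow> r \<in> {0..T} \<Longrightarrow> \<bar>s - r\<bar> < \<delta> \<Longrightarrow>
      H1_norm \<Omega> (\<lambda>x. \<sigma> s x - \<sigma> r x) \<le> \<theta>"
    using step_continuity[where \<psi> = \<psi>, OF J \<psi> \<theta>(1)] unfolding \<sigma>_def by blast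
  define c where "c = 3 / (2 * \<kappa>)"
  have c: "c > 0" "c * \<kappa>\<^sup>2 = 3 / 2 * \<kappa>"
    using \<kappa> by (auto simp: c_def power2_eq_square)
  define \<rho> where "\<rho> r = c * (\<theta>\<^sup>2 + (e r)\<^sup>2) + \<kappa> / 2 * (m r)\<^sup>2" for r
  have \<rho>i: "integrable M \<rho>"
    unfolding \<rho>_def[abs_def] using ei mi by auto
  have "AE r in M. \<forall>t. 0 < t \<and> t < r \<and> r < t + \<delta> \<longrightarrow>
      energy r - energy t \<le> (LINT s|M. indicator {t<..<r} s * (c * (e s)\<^sup>2)) + (r - t) * \<rho> r"
    using energy_increment_le AE_space
  proof eventually_elim
    case (elim r)
    have r: "0 < r" "r < T" and ur: "u r \<in> H1 \<Omega>"
      using elim by auto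
    show ?case
    proof (intro allI impI)
      fix t assume t: "0 < t \<and> t < r \<and> r < t + \<delta>"
      let ?k = "\<lambda>s. c * (e s)\<^sup>2 + \<rho> r"
      have ki: "integrable M ?k"
        using ei by simp
      have "H1_norm \<Omega> (\<lambda>x. u s x - u r x) * m r \<le> ?k s" if s: "t < s" "s < r" "u s \<in> H1 \<Omega>" for s
      proof -
        have "H1_norm \<Omega> (\<lambda>x. u s x - u r x) \<le> H1_norm \<Omega> (\<lambda>x. u s x - \<sigma> s x) + H1_norm \<Omega> (\<lambda>x. \<sigma> s x - u r x)"
          by (rule V.norm_diff_triangle[OF s(3) \<sigma> ur])
        also have "H1_norm \<Omega> (\<lambda>x. \<sigma> s x - u r x) \<le> H1_norm \<Omega> (\<lambda>x. \<sigma> s x - \<sigma> r x) + H1_norm \<Omega> (\<lambda>x. \<sigma> r x - u r x)"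
          by (rule V.norm_diff_triangle[OF \<sigma> \<sigma> ur])
        also have "H1_norm \<Omega> (\<lambda>x. \<sigma> r x - u r x) = e r"
          unfolding e_def by (rule V.norm_diff_commute[OF \<sigma> ur])
        also have "H1_norm \<Omega> (\<lambda>x. \<sigma> s x - \<sigma> r x) \<le> \<theta>"
          using s t r by (intro \<delta>(2)) auto
        finally have "H1_norm \<Omega> (\<lambda>x. u s x - u r x) \<le> e s + \<theta> + e r"
          by (simp add: e_def)
        then have "H1_norm \<Omega> (\<lambda>x. u s x - u r x) * m r \<le> (e s + \<theta> + e r) * m r"
          using V.norm_nonneg[OF ur] by (intro mult_right_mono) (auto simp: m_def)
        also have "\<dots> \<le> (e s + \<theta> + e r)\<^sup>2 / (2 * \<kappa>) + \<kappa> / 2 * (m r)\<^sup>2"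
          by (rule mult_le_AM_GM[OF \<kappa>])
        also have "(e s + \<theta> + e r)\<^sup>2 / (2 * \<kappa>) \<le> (3 * ((e s)\<^sup>2 + \<theta>\<^sup>2 + (e r)\<^sup>2)) / (2 * \<kappa>)"
        proof (rule divide_right_mono)
          have "0 \<le> (e s - \<theta>)\<^sup>2 + (e s - e r)\<^sup>2 + (\<theta> - e r)\<^sup>2"
            by simp
          then show "(e s + \<theta> + e r)\<^sup>2 \<le> 3 * ((e s)\<^sup>2 + \<theta>\<^sup>2 + (e r)\<^sup>2)"
            by (simp add: power2_eq_square algebra_simps)
        qed (use \<kappa> in simp)
        also have "\<dots> = c * ((e s)\<^sup>2 + \<theta>\<^sup>2 + (e r)\<^sup>2)"
          by (simp add: c_def)
        finally show ?thesis
          by (simp add: \<rho>_def algebra_simps)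
      qed
      then have "AE s in M. t < s \<and> s < r \<and> u s \<in> H1 \<Omega> \<longrightarrow>
          H1_norm \<Omega> (\<lambda>x. u s x - u r x) * H1_norm \<Omega> (u r) \<le> ?k s"
        by (simp add: m_def)
      then have "energy r - energy t \<le> (LINT s|M. indicator {t<..<r} s * ?k s)"
        using elim(1) t ki by blast
      also have "\<dots> = integral {t..r} ?k"
        using t r by (intro integral_indicator_greaterThanLessThan ki) auto
      also have "\<dots> = integral {t..r} (\<lambda>s. c * (e s)\<^sup>2) + integral {t..r} (\<lambda>s. \<rho> r)"
      proof (rule Henstock_Kurzweil_Integration.integral_add)
        have "integrable (lebesgue_on {t..r}) (\<lambda>s. c * (e s)\<^sup>2)"
          by (rule lebesgue_on_subset(1)[OF integrable_mult_right[OF ei]]) (use t r in auto)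
        then show "(\<lambda>s. c * (e s)\<^sup>2) integrable_on {t..r}"
          by (rule integrable_on_lebesgue_on) simp
      qed (rule integrable_const_ivl)
      also have "integral {t..r} (\<lambda>s. c * (e s)\<^sup>2) = (LINT s|M. indicator {t<..<r} s * (c * (e s)\<^sup>2))"
        using integral_indicator_greaterThanLessThan[OF integrable_mult_right[OF ei], of t r c] t r by simp
      also have "integral {t..r} (\<lambda>s. \<rho> r) = (r - t) * \<rho> r"
        using t by simp
      finally show "energy r - energy t \<le> (LINT s|M. indicator {t<..<r} s * (c * (e s)\<^sup>2)) + (r - t) * \<rho> r" .
    qed
  qed
  then have "energy \<tau> - energy 0 \<le> (LINT t|M. c * (e t)\<^sup>2) + (LINT t|M. \<rho> t)"
    using c \<kappa> ei by (intro increment_le_integral_sum[OF energy_continuous \<rho>i _ _ _ \<delta>(1) _ \<tau>])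
      (auto simp: \<rho>_def)
  also have "(LINT t|M. \<rho> t) = c * (\<theta>\<^sup>2 * T + (LINT t|M. (e t)\<^sup>2)) + \<kappa> / 2 * (LINT t|M. (m t)\<^sup>2)"
  proof -
    have "measure M (space M) = T"
      using T by (simp add: measure_restrict_space)
    then show ?thesis
      unfolding \<rho>_def using ei mi by (simp add: distrib_left)
  qed
  also have "(LINT t|M. c * (e t)\<^sup>2) + (c * (\<theta>\<^sup>2 * T + (LINT t|M. (e t)\<^sup>2)) + \<kappa> / 2 * (LINT t|M. (m t)\<^sup>2)) \<le>
      c * \<kappa>\<^sup>2 + (c * (\<kappa>\<^sup>2 + \<kappa>\<^sup>2) + \<kappa> / 2 * (LINT t|M. (m t)\<^sup>2))"
    using c es \<theta> \<kappa> by (intro add_mono mult_left_mono) auto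
  also have "\<dots> = \<kappa> * (9 / 2 + (LINT t|M. (m t)\<^sup>2) / 2)"
    using c(2) by (simp add: algebra_simps)
  finally show ?thesis
    by (simp add: energy_0 m_def)
qed

lemma energy_eq_0:
  assumes \<tau>: "0 < \<tau>" "\<tau> < T"
  shows "energy \<tau> = 0"
proof -
  let ?C = "9 / 2 + (LINT t|M. (H1_norm \<Omega> (u t))\<^sup>2) / 2"
  have C: "?C > 0"
    by (intro add_pos_nonneg) auto
  have "energy \<tau> \<le> 0"
  proof (rule field_le_epsilon)
    fix \<epsilon> :: real assume "\<epsilon> > 0"
    then show "energy \<tau> \<le> 0 + \<epsilon>"
      using energy_bound[OF \<tau>, of "\<epsilon> / ?C"] C by simp
  qed
  then show ?thesis
    by (simp add: energy_def antisym)
qed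

lemma solution_nonneg: "nonneg_ae {0<..<T} \<Omega> u"
proof -
  have "strongly_measurable M (L2 \<Omega>) (L2_norm \<Omega>) u"
    by (rule strongly_measurable_mono[OF u_meas, where C = 1])
      (auto simp: L2_norm_le_H1_norm L2_norm_nonneg V.diff_mem H1_L2)
  then obtain B where B: "B \<in> borel_measurable borel" "AE t in M. AE x in lebesgue_on \<Omega>. B (t, x) = u t x"
    by (rule strongly_measurable_joint_version[OF _ I_lmeasurable \<Omega>_sets])
  have "AE t in M. AE x in lebesgue_on \<Omega>. 0 \<le> u t x"
    using v(2) AE_space
  proof eventually_elim
    case (elim t)
    have t: "0 < t" "t < T"
      using elim by auto
    have "L2_norm \<Omega> (neg (v t)) = 0"
      using energy_eq_0[OF t] by (simp add: energy_def)
    then have "AE x in lebesgue_on \<Omega>. neg (v t) x = 0"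
      using t by (intro L2_norm_eq_0_AE L2_neg v_L2) auto
    with elim(1) show ?case
      by eventually_elim (auto simp: max_def split: if_splits)
  qed
  with B show ?thesis
    by (rule nonneg_aeI)
qed

end

theorem theorem3p4:
  fixes \<Omega> :: "(real ^ 'n) set" and T :: real
    and f1 :: "real \<Rightarrow> real ^ 'n \<Rightarrow> real"
    and f2 :: "real \<Rightarrow> (real ^ 'n \<Rightarrow> real) \<Rightarrow> real"
    and u0 :: "real ^ 'n \<Rightarrow> real"
    and u :: "real \<Rightarrow> real ^ 'n \<Rightarrow> real"
  assumes domain: "open \<Omega>" "connected \<Omega>" "\<Omega> \<noteq> {}"
    and T: "0 < T"
    and f: "f1 \<in> L1_H T \<Omega>" "f2 \<in> L2_V_dual T \<Omega>"
    and f_nonneg: "\<And>v. v \<in> L2_V T \<Omega> \<inter> C_H T \<Omega> \<Longrightarrow> nonneg_ae {0<..<T} \<Omega> v \<Longrightarrow>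
        0 \<le> source_pairing T \<Omega> f1 f2 v"
    and u0: "u0 \<in> L2 \<Omega>" "AE x in lebesgue_on \<Omega>. 0 \<le> u0 x"
    and u: "weak_solution T \<Omega> f1 f2 u0 u"
  shows "nonneg_ae {0<..<T} \<Omega> u"
proof -
  obtain v where "v \<in> C_H T \<Omega>" "AE t in lebesgue_on {0<..<T}. AE x in lebesgue_on \<Omega>. v t x = u t x"
    "AE x in lebesgue_on \<Omega>. v 0 x = u0 x"
    using u unfolding weak_solution_def has_initial_value_def by blast
  then interpret parabolic_problem \<Omega> T f1 f2 u0 u v
    using assms by unfold_locales
  show ?thesis
    by (rule solution_nonneg)
qed

end
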